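(* Let $G$ be a separable locally compact group acting measurably on a measure space $(X,\nu)$, where $\nu$ is a $\sigma$-finite measure on $X$ which is quasi-invariant under the action of $G$. The following properties are equivalent: (i) the action of $G$ on $X$ is co-amenable; (ii) the representation $\lambda_X$ almost has invariant vectors; (iii) the representation $\lambda_X\otimes\overline{\lambda_X}$ almost has invariant vectors.
   Context: The action of $G$ on $(X,\nu)$ is co-amenable if there exists a $G$-invariant mean on $L^\infty(X,\nu)$, that is, a positive linear functional $M$ on $L^\infty(X,\nu)$ such that $M(1_X)=1$ and $M({}_g\varphi)=M(\varphi)$ for all $g\in G$ and $\varphi\in L^\infty(X,\nu)$, where ${}_g\varphi(x)=\varphi(g^{-1}x)$. The unitary representation $\lambda_X$ of $G$ on $L^2(X,\nu)$ is defined by $$\lambda_X(g)\xi(x)=\sqrt{\frac{d\nu(g^{-1}x)}{d\nu(x)}}\;\xi(g^{-1}x),\qquad g\in G,\ x\in X,\ \xi\in L^2(X,\nu).$$ For a unitary representation (strongly continuous homomorphism into the unitary group of a Hilbert space) $(\pi,\mathcal{H})$ of $G$, the (inner) tensor product $\pi\otimes\overline{\pi}$ is the unitary representation of $G$ on $\mathcal{H}\otimes\overline{\mathcal{H}}$ (with $\overline{\mathcal{H}}$ the conjugate Hilbert space and $\overline{\pi}$ the conjugate representation) given by $x\mapsto\pi(x)\otimes\overline{\pi}(x)$. Equivalently, it is realized on the Hilbert space of Hilbert-Schmidt operators on $\mathcal{H}$ by $(\pi\otimes\overline{\pi})(x)T=\pi(x)T\pi(x^{-1})$. A unitary representation $(\sigma,\mathcal{K})$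 of $G$ almost has invariant vectors if, for every compact subset $K$ of $G$ and every $\varepsilon>0$, there exists a unit vector $\xi\in\mathcal{K}$ such that $\max_{x\in K}\Vert\sigma(x)\xi-\xi\Vert<\varepsilon$. *)

theory Defs
  imports "HOL-Analysis.Analysis"
begin

text \<open>
  Groups are written additively, following the class \<^class>\<open>topological_group_add\<close>, which does
  not include commutativity: \<open>g + h\<close> is the product, \<open>- g\<close> the inverse and \<open>0\<close> the identity.
\<close>

definition measurable_action ::
    "'x measure \<Rightarrow> ('g::topological_group_add \<Rightarrow> 'x \<Rightarrow> 'x) \<Rightarrow> bool" where
  "measurable_action M act \<longleftrightarrow>
     (\<lambda>(g, x). act g x) \<in> borel \<Otimes>\<^sub>M M \<rightarrow>\<^sub>M M \<and>
     (\<forall>x\<in>space M. act 0 x = x) \<and>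
     (\<forall>g h. \<forall>x\<in>space M. act (g + h) x = act g (act h x))"

definition quasi_invariant :: "'x measure \<Rightarrow> ('g \<Rightarrow> 'x \<Rightarrow> 'x) \<Rightarrow> bool" where
  "quasi_invariant M act \<longleftrightarrow> (\<forall>g. null_sets (distr M M (act g)) = null_sets M)"


text \<open>
  The elements of the spaces \<open>L\<^sup>\<infinity>\<close> and \<open>L\<^sup>2\<close> are classes of complex-valued measurable functions
  modulo equality almost everywhere.
\<close>

definition ae_class :: "'x measure \<Rightarrow> ('x \<Rightarrow> complex) \<Rightarrow> ('x \<Rightarrow> complex) set" where
  "ae_class M f = {h \<in> borel_measurable M. AE x in M. h x = f x}"

definition rep :: "('x \<Rightarrow> complex) set \<Rightarrow> 'x \<Rightarrow> complex" where
  "rep A = (SOME f. f \<in> A)"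

definition ess_bounded :: "'x measure \<Rightarrow> ('x \<Rightarrow> complex) set" where
  "ess_bounded M = {f \<in> borel_measurable M. \<exists>C. AE x in M. norm (f x) \<le> C}"

text \<open>
  A functional on \<open>L\<^sup>\<infinity>\<close> is evaluated at classes of essentially bounded functions only, so its
  values elsewhere are irrelevant.
\<close>

definition is_mean :: "'x measure \<Rightarrow> (('x \<Rightarrow> complex) set \<Rightarrow> complex) \<Rightarrow> bool" where
  "is_mean M m \<longleftrightarrow>
     (\<forall>f\<in>ess_bounded M. \<forall>h\<in>ess_bounded M.
        m (ae_class M (\<lambda>x. f x + h x)) = m (ae_class M f) + m (ae_class M h)) \<and>
     (\<forall>c. \<forall>f\<in>ess_bounded M. m (ae_class M (\<lambda>x. c * f x)) = c * m (ae_class M f)) \<and>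
     (\<forall>f\<in>ess_bounded M. (AE x in M. f x \<in> \<real>\<^sub>\<ge>\<^sub>0) \<longrightarrow> m (ae_class M f) \<in> \<real>\<^sub>\<ge>\<^sub>0) \<and>
     m (ae_class M (\<lambda>x. 1)) = 1"

definition co_amenable :: "'x measure \<Rightarrow> ('g::group_add \<Rightarrow> 'x \<Rightarrow> 'x) \<Rightarrow> bool" where
  "co_amenable M act \<longleftrightarrow>
     (\<exists>m. is_mean M m \<and>
        (\<forall>g. \<forall>f\<in>ess_bounded M.
           m (ae_class M (\<lambda>x. f (act (- g) x))) = m (ae_class M f)))"


text \<open>
  Complex inner product spaces with explicit carrier; the inner product is linear in its first
  argument.
\<close>

record 'v cinner_space =
  vectors :: "'v set"
  vadd :: "'v \<Rightarrow> 'v \<Rightarrow> 'v"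
  vscale :: "complex \<Rightarrow> 'v \<Rightarrow> 'v"
  vinner :: "'v \<Rightarrow> 'v \<Rightarrow> complex"

definition vdiff :: "'v cinner_space \<Rightarrow> 'v \<Rightarrow> 'v \<Rightarrow> 'v" where
  "vdiff H v w = vadd H v (vscale H (-1) w)"

definition vnorm :: "'v cinner_space \<Rightarrow> 'v \<Rightarrow> real" where
  "vnorm H v = sqrt (Re (vinner H v v))"

definition L2 :: "'x measure \<Rightarrow> ('x \<Rightarrow> complex) set cinner_space" where
  "L2 M = \<lparr>
     vectors = {ae_class M f |f. f \<in> borel_measurable M \<and> integrable M (\<lambda>x. (norm (f x))\<^sup>2)},
     vadd = (\<lambda>A B. ae_class M (\<lambda>x. rep A x + rep B x)),
     vscale = (\<lambda>c A. ae_class M (\<lambda>x. c * rep A x)),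
     vinner = (\<lambda>A B. \<integral>x. rep A x * cnj (rep B x) \<partial>M)\<rparr>"

text \<open>
  The derivative \<open>d\<nu>(g\<inverse>x)/d\<nu>(x)\<close> is that of the image measure \<open>A \<mapsto> \<nu>(g\<inverse>A)\<close> with
  respect to \<open>\<nu>\<close>.
\<close>

definition lambda_rep ::
    "'x measure \<Rightarrow> ('g::group_add \<Rightarrow> 'x \<Rightarrow> 'x) \<Rightarrow> 'g \<Rightarrow> ('x \<Rightarrow> complex) set \<Rightarrow> ('x \<Rightarrow> complex) set"
  where
  "lambda_rep M act g A =
     ae_class M (\<lambda>x.
       complex_of_real (sqrt (enn2real (RN_deriv M (distr M M (act g)) x))) * rep A (act (- g) x))"


text \<open>
  The tensor product of a Hilbert space with its conjugate, realised as the Hilbert-Schmidt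
  operators. Neither the set of these operators nor their inner product depends on the chosen
  orthonormal basis. Operators are functions on the carrier, \<^const>\<open>undefined\<close> outside of it.
\<close>

definition orthonormal_basis :: "'v cinner_space \<Rightarrow> 'v set \<Rightarrow> bool" where
  "orthonormal_basis H B \<longleftrightarrow>
     B \<subseteq> vectors H \<and>
     (\<forall>e\<in>B. \<forall>f\<in>B. vinner H e f = (if e = f then 1 else 0)) \<and>
     (\<forall>v\<in>vectors H. (\<forall>e\<in>B. vinner H v e = 0) \<longrightarrow> vinner H v v = 0)"

definition some_basis :: "'v cinner_space \<Rightarrow> 'v set" where
  "some_basis H = (SOME B. orthonormal_basis H B)"

definition bounded_operators :: "'v cinner_space \<Rightarrow> ('v \<Rightarrow> 'v) set" where
  "bounded_operators H =
     {T \<in> vectors H \<rightarrow>\<^sub>E vectors H.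
        (\<forall>v\<in>vectors H. \<forall>w\<in>vectors H. T (vadd H v w) = vadd H (T v) (T w)) \<and>
        (\<forall>c. \<forall>v\<in>vectors H. T (vscale H c v) = vscale H c (T v)) \<and>
        (\<exists>C. \<forall>v\<in>vectors H. vnorm H (T v) \<le> C * vnorm H v)}"

definition HS :: "'v cinner_space \<Rightarrow> ('v \<Rightarrow> 'v) cinner_space" where
  "HS H = \<lparr>
     vectors = {T \<in> bounded_operators H. (\<lambda>e. (vnorm H (T e))\<^sup>2) summable_on some_basis H},
     vadd = (\<lambda>S T. \<lambda>v\<in>vectors H. vadd H (S v) (T v)),
     vscale = (\<lambda>c T. \<lambda>v\<in>vectors H. vscale H c (T v)),
     vinner = (\<lambda>S T. \<Sum>\<^sub>\<infinity>e\<in>some_basis H. vinner H (S e) (T e))\<rparr>"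

definition tensor_conj ::
    "'v cinner_space \<Rightarrow> ('g::group_add \<Rightarrow> 'v \<Rightarrow> 'v) \<Rightarrow> 'g \<Rightarrow> ('v \<Rightarrow> 'v) \<Rightarrow> ('v \<Rightarrow> 'v)" where
  "tensor_conj H \<pi> g T = (\<lambda>v\<in>vectors H. \<pi> g (T (\<pi> (- g) v)))"


definition almost_has_invariant_vectors ::
    "'v cinner_space \<Rightarrow> ('g::topological_space \<Rightarrow> 'v \<Rightarrow> 'v) \<Rightarrow> bool" where
  "almost_has_invariant_vectors H \<sigma> \<longleftrightarrow>
     (\<forall>K \<epsilon>. compact K \<and> 0 < \<epsilon> \<longrightarrow>
        (\<exists>\<xi>\<in>vectors H. vnorm H \<xi> = 1 \<and> (\<forall>g\<in>K. vnorm H (vdiff H (\<sigma> g \<xi>) \<xi>) < \<epsilon>)))"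

end

theory Submission
  imports Defs "HOL-Probability.Probability_Measure" "HOL-Library.Function_Algebras"
begin

text \<open>
  The three properties are linked in a cycle: almost invariant vectors yield almost invariant
  Hilbert-Schmidt operators, these yield an invariant mean, and an invariant mean yields
  almost invariant vectors.

  A unit vector \<open>\<xi>\<close> gives the operator \<open>v \<mapsto> \<langle>v,
  \<xi>\<rangle> \<xi>\<close>, of Hilbert-Schmidt norm 1. Conjugation with
  \<open>\<lambda>(g)\<close> turns it into the operator of \<open>\<lambda>(g)\<xi>\<close>,
  and two such operators are at distance at most twice that of the vectors
  (\<open>almost_invariant_tensor\<close>).

  A Hilbert-Schmidt operator \<open>T\<close> of norm 1 gives the mean \<open>\<phi> \<mapsto>
  Tr(\<phi> T T\<^sup>*) = (\<Sum>e. \<integral>\<phi> \<bar>T e\<bar>\<^sup>2)\<close>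
  (\<open>diag\<close>). Conjugating \<open>T\<close> translates this mean, and operators that
  are close in norm have means that are close, uniformly on the unit ball. So the limit of
  these means along an ultrafilter of more and more invariant operators is invariant
  (\<open>co_amenable_if_tensor\<close>). That conjugation translates the mean amounts to the
  independence of Hilbert-Schmidt sums of the orthonormal basis; one inequality, for finite
  orthonormal families, is enough (\<open>Hilbert_Schmidt_orthonormal_le\<close>), because the
  other one follows from it for the inverse group element.

  For the remaining implication let \<open>\<mu>\<close> be an invariant mean. If no density
  \<open>f\<close> were moved by less than \<open>\<epsilon>\<close> in
  \<open>L\<^sup>1\<close> by each element of a finite set, separation of convex sets would
  give bounded functions \<open>\<phi>\<^sub>g\<close> for which \<open>\<Sum>g.
  \<phi>\<^sub>g \<circ> g - \<phi>\<^sub>g\<close> is at least \<open>\<epsilon>\<close>,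
  although its mean is 0. The square root of an almost invariant density is an almost
  invariant vector. This only reaches finitely many group elements, whereas a compact set is
  asked for. Therefore only densities are used that have been averaged over the group by a
  probability measure \<open>\<rho>\<close> for which left translation is continuous at 0 in
  total variation (\<open>left_continuous_prob\<close>): such a density is moved little by all
  elements near 0, with a bound that depends on \<open>\<rho>\<close> alone
  (\<open>push_close\<close>), and finitely many translates of a neighbourhood of 0 cover the
  compact set. A measure \<open>\<rho>\<close> of this kind is the normalised restriction of a
  left Haar measure to a compact set.

  For averaged densities the separation argument needs that \<open>\<mu>\<close> takes the
  same value at the averages of \<open>\<phi>\<close> and of \<open>\<phi> \<circ> g\<close>
  (\<open>mean_smear_translate\<close>). Invariance of \<open>\<mu>\<close> does not give this
  at once, because \<open>\<mu>\<close> does not commute with integrals. But if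
  \<open>\<phi>\<close> is first averaged over a measure concentrated near 0, the resulting
  function \<open>\<Theta>\<close> is uniformly continuous along the orbits. As
  \<open>G\<close> is separable, every average of \<open>\<Theta>\<close> is then a uniform
  limit of finite convex combinations of translates of \<open>\<Theta>\<close>, so that
  \<open>\<mu>\<close> does not distinguish it from \<open>\<Theta>\<close>
  (\<open>mean_smear_eq\<close>); and averaging \<open>\<Theta>\<close> over
  \<open>\<rho>\<close> is almost the same as averaging \<open>\<phi>\<close> over
  \<open>\<rho>\<close>, because \<open>\<rho>\<close> hardly changes under small
  translations. So the mean of the average of \<open>\<phi>\<close> does not depend on
  \<open>\<rho>\<close>.
\<close>

section \<open>Ultrafilters\<close>

text \<open>
  Both limits below, that of ratios of covering numbers and that of means, are taken along an
  ultrafilter, where every bounded family of numbers converges.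
\<close>

definition ultra :: "'a filter \<Rightarrow> bool" where
  "ultra U \<longleftrightarrow> U \<noteq> bot \<and> (\<forall>P. eventually P U \<or> eventually (\<lambda>x. \<not> P x) U)"

lemma ultra_not_bot: "ultra U \<Longrightarrow> U \<noteq> bot"
  by (simp add: ultra_def)

text \<open>
  By Zorn's lemma there is a minimal proper filter below \<open>F\<close>. If the complement
  of a set does not belong to it, its trace on that set is still proper and hence equal to it.
\<close>

lemma ultra_refines:
  assumes "F \<noteq> (bot :: 'a filter)"
  shows "\<exists>U\<le>F. ultra U"
proof -
  let ?S = "{G. G \<le> F \<and> G \<noteq> bot}"
  have "\<exists>m\<in>?S. \<forall>a\<in>?S. m \<ge> a \<longrightarrow> a = m"
  proof (rule predicate_Zorn)
    show "partial_order_on ?S (relation_of (\<ge>) ?S)"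
      by (rule partial_order_on_relation_ofI) auto
    fix C assume C: "C \<in> Chains (relation_of (\<ge>) ?S)"
    then have sub: "C \<subseteq> ?S"
      by (auto simp: Chains_def relation_of_def)
    have tot: "\<And>a b. a \<in> C \<Longrightarrow> b \<in> C \<Longrightarrow> a \<le> b \<or> b \<le> a"
      using C by (auto simp: Chains_def relation_of_def)
    show "\<exists>u\<in>?S. \<forall>a\<in>C. a \<ge> u"
    proof (cases "C = {}")
      case True then show ?thesis using assms by auto
    next
      case False
      have "eventually P (Inf C) \<longleftrightarrow> (\<exists>b\<in>C. eventually P b)" for P
      proof (rule eventually_Inf_base[OF False])
        fix F G assume "F \<in> C" "G \<in> C"
        then show "\<exists>x\<in>C. x \<le> inf F G"
          using tot[of F G] by (auto simp: inf_absorb1 inf_absorb2)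
      qed
      then have "\<not> eventually (\<lambda>_. False) (Inf C)"
        using sub by (auto simp: trivial_limit_def)
      then have "Inf C \<noteq> bot" by auto
      moreover have "Inf C \<le> F"
        using False sub by (auto intro: Inf_lower2)
      ultimately show ?thesis by (intro bexI[of _ "Inf C"]) (auto intro: Inf_lower)
    qed
  qed
  then obtain U where U: "U \<le> F" "U \<noteq> bot" and min: "\<And>G. G \<le> F \<Longrightarrow> G \<noteq> bot \<Longrightarrow> G \<le> U \<Longrightarrow> G = U"
    by auto
  have "eventually P U \<or> eventually (\<lambda>x. \<not> P x) U" for P
  proof (rule disjCI)
    assume "\<not> eventually (\<lambda>x. \<not> P x) U"
    then have "inf U (principal {x. P x}) \<noteq> bot"
      by (auto simp: trivial_limit_def eventually_inf_principal)
    then have "inf U (principal {x. P x}) = U"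
      using U by (intro min) (auto intro: le_infI1)
    moreover have "eventually P (inf U (principal {x. P x}))"
      by (simp add: eventually_inf_principal)
    ultimately show "eventually P U" by simp
  qed
  with U show ?thesis unfolding ultra_def by blast
qed

text \<open>
  By compactness the image filter has a cluster point, and a cluster point of an ultrafilter
  is a limit.
\<close>

lemma ultra_tendsto_Lim:
  fixes f :: "'a \<Rightarrow> 'b::{heine_borel,t2_space}"
  assumes U: "ultra U" and ev: "eventually (\<lambda>x. f x \<in> S) U" and S: "bounded S"
  shows "(f \<longlongrightarrow> Lim U f) U"
proof -
  let ?F = "filtermap f U"
  have "compact (closure S)" using S by simp
  moreover have "?F \<noteq> bot" using U by (simp add: filtermap_bot_iff ultra_def)
  moreover have "eventually (\<lambda>y. y \<in> closure S) ?F"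
    using ev by (auto simp: eventually_filtermap elim!: eventually_mono intro: closure_subset[THEN subsetD])
  ultimately obtain l where l: "inf (nhds l) ?F \<noteq> bot"
    unfolding compact_filter by blast
  have "(f \<longlongrightarrow> l) U"
    unfolding tendsto_def
  proof (intro allI impI)
    fix T assume T: "open T" "l \<in> T"
    have "\<not> eventually (\<lambda>x. f x \<notin> T) U"
    proof
      assume "eventually (\<lambda>x. f x \<notin> T) U"
      then have "eventually (\<lambda>y. y \<notin> T) ?F" by (simp add: eventually_filtermap)
      moreover have "eventually (\<lambda>y. y \<in> T) (nhds l)" using T by (simp add: eventually_nhds_in_open)
      ultimately have "eventually (\<lambda>_. False) (inf (nhds l) ?F)"
        unfolding eventually_inf by blast
      with l show False by (simp add: trivial_limit_def)
    qed
    then show "eventually (\<lambda>x. f x \<in> T) U" using U by (auto simp: ultra_def)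
  qed
  then show ?thesis using U by (simp add: tendsto_Lim ultra_def)
qed

section \<open>Translations and covering numbers\<close>

lemma translation_vimage: "(+) (a::'g::group_add) ` U = (+) (- a) -` U"
proof
  show "(+) a ` U \<subseteq> (+) (- a) -` U" by (auto simp: add.assoc[symmetric])
  show "(+) (- a) -` U \<subseteq> (+) a ` U"
  proof
    fix x assume "x \<in> (+) (- a) -` U"
    then have "x = a + (- a + x)" "- a + x \<in> U" by (simp_all add: add.assoc[symmetric])
    then show "x \<in> (+) a ` U" by blast
  qed
qed

lemma translation_translation: "(+) a ` (+) b ` U = (+) (a + b :: 'g::group_add) ` U"
  by (auto simp: image_image add.assoc)

lemma open_translation_group:
  "open U \<Longrightarrow> open ((+) (a::'g::topological_group_add) ` U)"
  unfolding translation_vimage by (intro open_vimage continuous_intros)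

lemma compact_translation_group:
  "compact K \<Longrightarrow> compact ((+) (a::'g::topological_group_add) ` K)"
  by (intro compact_continuous_image continuous_intros)

lemma nbhd_diff:
  fixes W :: "'g::topological_group_add set"
  assumes "open W" "0 \<in> W"
  obtains U where "open U" "0 \<in> U" "\<And>u v. u \<in> U \<Longrightarrow> v \<in> U \<Longrightarrow> - u + v \<in> W"
proof -
  have "((\<lambda>p. - fst p + snd p) \<longlongrightarrow> - 0 + 0) (nhds (0 :: 'g) \<times>\<^sub>F nhds (0::'g))"
    by (intro tendsto_add tendsto_minus filterlim_fst filterlim_snd)
  then have "eventually (\<lambda>p. - fst p + snd p \<in> W) (nhds (0 :: 'g) \<times>\<^sub>F nhds (0::'g))"
    using assms by (auto simp: tendsto_def)
  then obtain P Q where P: "eventually P (nhds (0::'g))" and Q: "eventually Q (nhds (0::'g))"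
    and PQ: "\<And>x y. P x \<Longrightarrow> Q y \<Longrightarrow> - x + y \<in> W"
    by (auto simp: eventually_prod_filter)
  obtain S T where "open S" "0 \<in> S" "\<forall>x\<in>S. P x" "open T" "0 \<in> T" "\<forall>x\<in>T. Q x"
    using P Q unfolding eventually_nhds by blast
  then show ?thesis using PQ by (intro that[of "S \<inter> T"]) auto
qed

text \<open>
  A topological group is regular: if \<open>- U + U\<close> lies in \<open>W\<close>, so does
  the closure of \<open>U\<close>. Hence one compact neighbourhood of 0 yields arbitrarily
  small ones at every point.
\<close>

lemma compact_nbhd_inside:
  fixes O' :: "'g::{topological_group_add, t2_space} set"
  assumes K0: "compact (K0::'g set)" "0 \<in> interior K0" and O': "open O'" "x \<in> O'"
  obtains V C where "open V" "compact C" "x \<in> V" "V \<subseteq> C" "C \<subseteq> O'"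
proof -
  let ?W = "interior K0 \<inter> ((+) (- x) ` O')"
  have "open ?W" "0 \<in> ?W"
    using O' K0 by (auto intro!: open_translation_group image_eqI[of _ _ x])
  then obtain U where U: "open U" "0 \<in> U" "\<And>u v. u \<in> U \<Longrightarrow> v \<in> U \<Longrightarrow> - u + v \<in> ?W"
    by (rule nbhd_diff) blast
  have cl: "closure U \<subseteq> ?W"
  proof
    fix y assume y: "y \<in> closure U"
    define N where "N = {z. z - y \<in> U}"
    have "open N" unfolding N_def
      using open_vimage[OF U(1), of "\<lambda>z. z + (- y)"] by (simp add: vimage_def continuous_intros)
    moreover have "y \<in> N" using U by (simp add: N_def)
    ultimately obtain z where "z \<in> N" "z \<in> U"
      using y by (meson closure_iff_nhds_not_empty disjoint_iff inf_commute subset_refl)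
    then have "- (z - y) + z \<in> ?W" using U(3)[of "z - y" z] by (simp add: N_def)
    then show "y \<in> ?W" by (simp add: algebra_simps)
  qed
  have "compact (closure U)"
    using compact_Int_closed[OF K0(1), of "closure U"] cl interior_subset[of K0]
    by (metis closed_closure inf.absorb2 inf.boundedE subset_trans)
  moreover have "(+) x ` closure U \<subseteq> O'"
  proof clarify
    fix c assume "c \<in> closure U"
    then obtain q where "q \<in> O'" "c = - x + q" using cl by blast
    then show "x + c \<in> O'" by (simp add: add.assoc[symmetric])
  qed
  moreover have "x \<in> (+) x ` U" using U(2) by (rule image_eqI[rotated]) simp
  ultimately show ?thesis using U(1) closure_subset[of U]
    by (intro that[of "(+) x ` U" "(+) x ` closure U"] open_translation_group
        compact_translation_group image_mono)
qed

text \<open>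
  Turns a covering of a compact set by open sets into one by compact sets inside them; this
  makes the content of open sets countably subadditive.
\<close>

lemma compact_split:
  fixes K :: "'g::{topological_group_add, t2_space} set"
  assumes K0: "compact (K0::'g set)" "0 \<in> interior K0" and K: "compact K" "K \<subseteq> (\<Union>i. Q i)" and Q: "\<And>i::'a. open (Q i)"
  obtains C I where "finite I" "\<forall>i. compact (C i)" "\<forall>i. C i \<subseteq> Q i" "K \<subseteq> (\<Union>i\<in>I. C i)"
proof -
  define good where "good x t \<longleftrightarrow> open (fst (snd t)) \<and> compact (snd (snd t)) \<and> x \<in> fst (snd t) \<and>
    fst (snd t) \<subseteq> snd (snd t) \<and> snd (snd t) \<subseteq> Q (fst t)" for x and t :: "'a \<times> 'g set \<times> 'g set"
  have "\<exists>t. good x t" if x: "x \<in> K" for x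
  proof -
    obtain i where i: "x \<in> Q i" using K x by blast
    obtain V C where "open V" "compact C" "x \<in> V" "V \<subseteq> C" "C \<subseteq> Q i"
      by (rule compact_nbhd_inside[OF K0 Q i])
    then have "good x (i, V, C)" by (simp add: good_def)
    then show ?thesis ..
  qed
  then have good: "good x (SOME t. good x t)" if "x \<in> K" for x
    using that by (blast intro: someI_ex)
  define i where "i x = fst (SOME t. good x t)" for x
  define V where "V x = fst (snd (SOME t. good x t))" for x
  define C where "C x = snd (snd (SOME t. good x t))" for x
  have V: "open (V x)" "compact (C x)" "x \<in> V x" "V x \<subseteq> C x" "C x \<subseteq> Q (i x)" if "x \<in> K" for x
    using good[OF that] by (auto simp: good_def i_def V_def C_def)
  have cover: "K \<subseteq> (\<Union>x\<in>K. V x)" using V(3) by auto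
  obtain X where X: "X \<subseteq> K" "finite X" "K \<subseteq> (\<Union>x\<in>X. V x)"
    by (rule compactE_image[OF K(1) V(1) cover])
  let ?C = "\<lambda>j. \<Union>x\<in>{x\<in>X. i x = j}. C x"
  show ?thesis
  proof (rule that[of "i ` X" ?C])
    show "finite (i ` X)" using X by simp
    show "\<forall>j. compact (?C j)" using X V by (intro allI compact_UN) auto
    show "\<forall>j. ?C j \<subseteq> Q j"
    proof (intro allI UN_least)
      fix j x assume "x \<in> {x \<in> X. i x = j}"
      then show "C x \<subseteq> Q j" using V(5)[of x] X(1) by auto
    qed
    have "V x \<subseteq> (\<Union>j\<in>i ` X. ?C j)" if "x \<in> X" for x
      using X(1) V(4)[of x] that by (intro order_trans[OF V(4)]) auto
    then show "K \<subseteq> (\<Union>j\<in>i ` X. ?C j)" by (rule order_trans[OF X(3) UN_least])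
  qed
qed

text \<open>
  The relative sizes of compact sets, measured by covering numbers, become left invariant and
  additive in the limit as \<open>U\<close> shrinks; Haar measure is built from these limits.
\<close>

definition cov :: "'g::group_add set \<Rightarrow> 'g set \<Rightarrow> nat" where
  "cov K U = (LEAST n. \<exists>F. finite F \<and> card F = n \<and> K \<subseteq> (\<Union>x\<in>F. (+) x ` U))"

lemma cov_le: "finite F \<Longrightarrow> K \<subseteq> (\<Union>x\<in>F. (+) x ` U) \<Longrightarrow> cov K U \<le> card F"
  unfolding cov_def by (rule Least_le) auto

lemma cov_witness:
  fixes K :: "'g::topological_group_add set"
  assumes "compact K" "open U" "0 \<in> U"
  obtains F where "finite F" "card F = cov K U" "K \<subseteq> (\<Union>x\<in>F. (+) x ` U)"
proof -
  have in_trans: "x \<in> (+) x ` U" for x using assms(3) by (rule image_eqI[rotated]) simp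
  have cover: "K \<subseteq> (\<Union>x\<in>UNIV. (+) x ` U)" using in_trans by blast
  obtain F where "F \<subseteq> UNIV" "finite F" "K \<subseteq> (\<Union>x\<in>F. (+) x ` U)"
    by (rule compactE_image[OF assms(1) open_translation_group[OF assms(2)] cover])
  then have "\<exists>n. \<exists>F. finite F \<and> card F = n \<and> K \<subseteq> (\<Union>x\<in>F. (+) x ` U)" by auto
  from LeastI_ex[OF this] that show ?thesis unfolding cov_def by auto
qed

lemma cov_mono:
  fixes K :: "'g::topological_group_add set"
  assumes "K \<subseteq> L" "compact L" "open U" "0 \<in> U"
  shows "cov K U \<le> cov L U"
proof -
  obtain F where F: "finite F" "card F = cov L U" "L \<subseteq> (\<Union>x\<in>F. (+) x ` U)"
    using cov_witness[OF assms(2-4)] .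
  then show ?thesis using cov_le[of F K U] assms(1) by simp
qed

lemma cov_Un:
  fixes K :: "'g::topological_group_add set"
  assumes "compact K" "compact L" "open U" "0 \<in> U"
  shows "cov (K \<union> L) U \<le> cov K U + cov L U"
proof -
  obtain F where F: "finite F" "card F = cov K U" "K \<subseteq> (\<Union>x\<in>F. (+) x ` U)"
    using cov_witness[OF assms(1,3,4)] .
  obtain G where G: "finite G" "card G = cov L U" "L \<subseteq> (\<Union>x\<in>G. (+) x ` U)"
    using cov_witness[OF assms(2-4)] .
  have "cov (K \<union> L) U \<le> card (F \<union> G)" using F G by (intro cov_le) auto
  also have "\<dots> \<le> card F + card G" by (rule card_Un_le)
  finally show ?thesis using F G by simp
qed

lemma cov_translation_le:
  fixes K :: "'g::topological_group_add set"
  assumes "compact K" "open U" "0 \<in> U"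
  shows "cov ((+) a ` K) U \<le> cov K U"
proof -
  obtain F where F: "finite F" "card F = cov K U" "K \<subseteq> (\<Union>x\<in>F. (+) x ` U)"
    using cov_witness[OF assms] .
  have "cov ((+) a ` K) U \<le> card ((+) a ` F)"
    using F by (intro cov_le) (force simp: add.assoc)+
  then show ?thesis using F by (simp add: card_image)
qed

lemma cov_translation:
  fixes K :: "'g::topological_group_add set"
  assumes "compact K" "open U" "0 \<in> U"
  shows "cov ((+) a ` K) U = cov K U"
proof (rule antisym)
  show "cov K U \<le> cov ((+) a ` K) U"
    using cov_translation_le[OF compact_translation_group[OF assms(1), of a] assms(2,3), of "- a"]
    by (simp add: translation_translation)
qed (rule cov_translation_le[OF assms])

text \<open>
  A translate that meets only one of the two sets can be counted for that set alone, so an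
  optimal covering of the union splits.
\<close>

lemma cov_Un_disjoint:
  fixes K :: "'g::topological_group_add set"
  assumes "compact K" "compact L" "open U" "0 \<in> U"
    and sep: "\<And>x. (+) x ` U \<inter> K = {} \<or> (+) x ` U \<inter> L = {}"
  shows "cov K U + cov L U \<le> cov (K \<union> L) U"
proof -
  obtain F where F: "finite F" "card F = cov (K \<union> L) U" "K \<union> L \<subseteq> (\<Union>x\<in>F. (+) x ` U)"
    by (rule cov_witness[OF compact_Un[OF assms(1,2)] assms(3,4)])
  let ?A = "{x\<in>F. (+) x ` U \<inter> K \<noteq> {}}" and ?B = "{x\<in>F. (+) x ` U \<inter> L \<noteq> {}}"
  have "cov K U \<le> card ?A" "cov L U \<le> card ?B" using F by (intro cov_le; force)+
  moreover have "card ?A + card ?B = card (?A \<union> ?B)"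
    using F sep by (intro card_Un_disjoint[symmetric]) auto
  moreover have "card (?A \<union> ?B) \<le> card F" using F by (intro card_mono) auto
  ultimately show ?thesis using F by simp
qed

text \<open>
  Covering first by \<open>V\<close> and then every translate of \<open>V\<close> by
  \<open>U\<close> bounds the ratios of covering numbers independently of \<open>U\<close>.
\<close>

lemma cov_mult:
  fixes K :: "'g::topological_group_add set"
  assumes "compact K" "compact L" "open V" "0 \<in> V" "V \<subseteq> L" "open U" "0 \<in> U"
  shows "cov K U \<le> cov K V * cov L U"
proof -
  obtain F where F: "finite F" "card F = cov K V" "K \<subseteq> (\<Union>x\<in>F. (+) x ` V)"
    using cov_witness[OF assms(1,3,4)] .
  obtain G where G: "finite G" "card G = cov L U" "L \<subseteq> (\<Union>x\<in>G. (+) x ` U)"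
    using cov_witness[OF assms(2,6,7)] .
  have "cov K U \<le> card ((\<lambda>(x, y). x + y) ` (F \<times> G))"
  proof (rule cov_le)
    show "K \<subseteq> (\<Union>x\<in>(\<lambda>(x, y). x + y) ` (F \<times> G). (+) x ` U)"
    proof
      fix k assume "k \<in> K"
      then obtain x v where x: "x \<in> F" "v \<in> V" "k = x + v" using F by auto
      then obtain y u where "y \<in> G" "u \<in> U" "v = y + u" using G assms(5) by (auto dest!: subsetD)
      with x show "k \<in> (\<Union>x\<in>(\<lambda>(x, y). x + y) ` (F \<times> G). (+) x ` U)"
        by (force simp: add.assoc)
    qed
  qed (use F G in auto)
  also have "\<dots> \<le> card (F \<times> G)" using F G by (intro card_image_le) auto
  finally show ?thesis using F G by (simp add: card_cartesian_product)
qed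

text \<open>
  The compact set \<open>- K + L\<close> misses 0, and a translate of \<open>U\<close> that
  meets both \<open>K\<close> and \<open>L\<close> produces an element of it in \<open>- U +
  U\<close>.
\<close>

lemma separating_nbhd:
  fixes K :: "'g::{topological_group_add, t2_space} set"
  assumes "compact K" "compact L" "K \<inter> L = {}"
  obtains U where "open U" "0 \<in> U" "\<forall>x. \<forall>V\<subseteq>U. (+) x ` V \<inter> K = {} \<or> (+) x ` V \<inter> L = {}"
proof -
  let ?D = "(\<lambda>p. - fst p + snd p) ` (K \<times> L)"
  have "compact ?D"
    using assms by (intro compact_continuous_image compact_Times continuous_intros)
  moreover have "0 \<notin> ?D"
  proof
    assume "0 \<in> ?D"
    then obtain k l where "k \<in> K" "l \<in> L" "- k + l = 0" by auto
    moreover from this have "l = k" by (metis add.right_neutral add_minus_cancel)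
    ultimately show False using assms by auto
  qed
  ultimately have "open (- ?D)" "0 \<in> - ?D" by (auto intro: compact_imp_closed)
  then obtain U where U: "open U" "0 \<in> U" "\<And>u v. u \<in> U \<Longrightarrow> v \<in> U \<Longrightarrow> - u + v \<in> - ?D"
    by (rule nbhd_diff) blast
  have "(+) x ` V \<inter> K = {} \<or> (+) x ` V \<inter> L = {}" if "V \<subseteq> U" for x V
  proof (rule ccontr)
    assume "\<not> ?thesis"
    then obtain u v where uv: "u \<in> V" "v \<in> V" "x + u \<in> K" "x + v \<in> L" by auto
    have "- (x + u) + (x + v) = - u + v"
      by (metis minus_add add.assoc minus_add_cancel)
    then have "- u + v \<in> ?D" using uv by (force intro!: image_eqI[of _ _ "(x+u, x+v)"])
    with U(3)[of u v] uv that show False by auto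
  qed
  then show ?thesis by (intro that[OF U(1,2)] allI impI)
qed

section \<open>Haar measure\<close>

text \<open>
  The total variation distance between \<open>\<rho>\<close> and its translate by
  \<open>u\<close>, tested on measurable functions. In this form it applies directly to
  functions along an orbit of the action.
\<close>

definition shift_close :: "'g::topological_group_add measure \<Rightarrow> real \<Rightarrow> 'g \<Rightarrow> bool" where
  "shift_close \<rho> e u \<longleftrightarrow>
     (\<forall>\<phi>. \<phi> \<in> borel_measurable borel \<longrightarrow> (\<forall>x. \<bar>\<phi> x\<bar> \<le> (1::real)) \<longrightarrow>
        \<bar>(\<integral>h. \<phi> (u + h) \<partial>\<rho>) - (\<integral>h. \<phi> h \<partial>\<rho>)\<bar> \<le> e)"

lemma shift_closeD:
  fixes \<phi> :: "'g::topological_group_add \<Rightarrow> real"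
  assumes "shift_close \<rho> e u" "\<phi> \<in> borel_measurable borel" "\<And>x. \<bar>\<phi> x\<bar> \<le> 1"
  shows "\<bar>(\<integral>h. \<phi> (u + h) \<partial>\<rho>) - (\<integral>h. \<phi> h \<partial>\<rho>)\<bar> \<le> e"
  using assms by (simp add: shift_close_def)

text \<open>
  A substitute for the probability measures that are absolutely continuous with respect to
  Haar measure: their only property needed later is continuity of translations in
  \<open>L\<^sup>1\<close>.
\<close>

definition left_continuous_prob :: "'g::topological_group_add measure \<Rightarrow> bool" where
  "left_continuous_prob \<rho> \<longleftrightarrow> prob_space \<rho> \<and> sets \<rho> = sets borel \<and>
     (\<forall>e>0. \<exists>U. open U \<and> 0 \<in> U \<and> (\<forall>u\<in>U. shift_close \<rho> e u))"

text \<open>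
  The data of the construction of Haar measure from covering numbers: a compact reference set
  \<open>K0\<close> that gets content 1, and sets \<open>B n\<close> that shrink to 0 along an
  ultrafilter.
\<close>

locale haar_content =
  fixes K0 :: "'g::{topological_group_add, t2_space} set" and B :: "nat \<Rightarrow> 'g set" and \<U> :: "nat filter"
  assumes K0: "compact K0" "0 \<in> interior K0"
    and B: "\<And>n. open (B n)" "\<And>n. 0 \<in> B n"
      "\<And>S. open S \<Longrightarrow> 0 \<in> S \<Longrightarrow> eventually (\<lambda>n. B n \<subseteq> S) \<U>"
    and U: "ultra \<U>"
begin

definition ratio :: "'g set \<Rightarrow> nat \<Rightarrow> real" where
  "ratio K n = real (cov K (B n)) / real (cov K0 (B n))"

definition content :: "'g set \<Rightarrow> real" where
  "content K = Lim \<U> (ratio K)"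

definition open_content :: "'g set \<Rightarrow> ennreal" where
  "open_content V = (SUP K\<in>{K. compact K \<and> K \<subseteq> V}. ennreal (content K))"

definition haar_outer :: "'g set \<Rightarrow> ennreal" where
  "haar_outer A = (INF V\<in>{V. open V \<and> A \<subseteq> V}. open_content V)"

definition haar :: "'g measure" where
  "haar = measure_of UNIV (sets borel) haar_outer"

text \<open>
  The ratios are bounded by the number of translates of the interior of \<open>K0\<close> that
  cover \<open>K\<close>, whatever \<open>n\<close>.
\<close>

lemma content_tendsto:
  assumes "compact K"
  shows "(ratio K \<longlongrightarrow> content K) \<U>"
  unfolding content_def
proof (rule ultra_tendsto_Lim[OF U])
  let ?c = "real (cov K (interior K0))"
  have "ratio K n \<in> {0..?c}" for n
  proof -
    have "cov K (B n) \<le> cov K (interior K0) * cov K0 (B n)"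
      by (rule cov_mult[OF assms K0(1) open_interior K0(2) interior_subset B(1,2)])
    then have "real (cov K (B n)) \<le> ?c * real (cov K0 (B n))"
      by (metis of_nat_le_iff of_nat_mult)
    then show ?thesis
      by (cases "cov K0 (B n) = 0") (simp_all add: ratio_def divide_le_eq)
  qed
  then show "eventually (\<lambda>n. ratio K n \<in> {0..?c}) \<U>" by simp
  show "bounded {0..?c}" by simp
qed

lemma U_not_bot: "\<U> \<noteq> bot"
  using U by (rule ultra_not_bot)

lemma content_nonneg: "compact K \<Longrightarrow> 0 \<le> content K"
  by (rule tendsto_lowerbound[OF content_tendsto _ U_not_bot]) (auto simp: ratio_def)

lemma content_mono: "K \<subseteq> L \<Longrightarrow> compact K \<Longrightarrow> compact L \<Longrightarrow> content K \<le> content L"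
  by (rule tendsto_le[OF U_not_bot content_tendsto content_tendsto])
     (auto simp: ratio_def B intro!: always_eventually divide_right_mono cov_mono)

lemma content_Un_le:
  assumes "compact K" "compact L"
  shows "content (K \<union> L) \<le> content K + content L"
proof (rule tendsto_le[OF U_not_bot tendsto_add[OF content_tendsto content_tendsto] content_tendsto])
  show "eventually (\<lambda>n. ratio (K \<union> L) n \<le> ratio K n + ratio L n) \<U>"
    unfolding ratio_def add_divide_distrib[symmetric] of_nat_add[symmetric]
    by (intro always_eventually allI divide_right_mono of_nat_mono cov_Un assms B) auto
qed (use assms in auto)

text \<open>
  Covering numbers are additive as soon as the covering sets are too small to meet both
  \<open>K\<close> and \<open>L\<close>, which holds eventually.
\<close>

lemma content_Un_disjoint:
  assumes "compact K" "compact L" "K \<inter> L = {}"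
  shows "content K + content L \<le> content (K \<union> L)"
proof (rule tendsto_le[OF U_not_bot content_tendsto tendsto_add[OF content_tendsto content_tendsto]])
  obtain W where W: "open W" "0 \<in> W" "\<forall>x. \<forall>V\<subseteq>W. (+) x ` V \<inter> K = {} \<or> (+) x ` V \<inter> L = {}"
    by (rule separating_nbhd[OF assms])
  show "eventually (\<lambda>n. ratio K n + ratio L n \<le> ratio (K \<union> L) n) \<U>"
    using B(3)[OF W(1,2)]
  proof eventually_elim
    case (elim n)
    then have "cov K (B n) + cov L (B n) \<le> cov (K \<union> L) (B n)"
      by (intro cov_Un_disjoint assms B W(3)[rule_format])
    then show ?case
      unfolding ratio_def add_divide_distrib[symmetric] of_nat_add[symmetric]
      by (intro divide_right_mono of_nat_mono) auto
  qed
qed (use assms in auto)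

lemma content_translation: "compact K \<Longrightarrow> content ((+) a ` K) = content K"
  unfolding content_def by (simp add: ratio_def[abs_def] cov_translation B)

lemma content_K0: "content K0 = 1"
proof -
  have "ratio K0 n = 1" for n
  proof -
    obtain F where F: "finite F" "card F = cov K0 (B n)" "K0 \<subseteq> (\<Union>x\<in>F. (+) x ` B n)"
      using cov_witness[OF K0(1) B(1,2)] .
    have "F \<noteq> {}" using F(3) K0(2) interior_subset[of K0] by auto
    then have "cov K0 (B n) \<noteq> 0" using F by auto
    then show ?thesis by (simp add: ratio_def)
  qed
  then have "ratio K0 = (\<lambda>_. 1)" by auto
  then show ?thesis
    using tendsto_Lim[OF U_not_bot tendsto_const[of "1::real"]] by (simp add: content_def)
qed

lemma content_empty: "content {} = 0"
  using content_Un_disjoint[of "{}" "{}"] content_nonneg[of "{}"] by simp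

lemma content_UN_le:
  "finite I \<Longrightarrow> (\<And>i. compact (C i)) \<Longrightarrow> content (\<Union>i\<in>I. C i) \<le> (\<Sum>i\<in>I. content (C i))"
proof (induction I rule: finite_induct)
  case (insert i I)
  have "content (C i \<union> (\<Union>i\<in>I. C i)) \<le> content (C i) + content (\<Union>i\<in>I. C i)"
    using insert by (intro content_Un_le compact_UN) auto
  then show ?case using insert by simp
qed (simp add: content_empty)

lemma open_content_upper: "compact K \<Longrightarrow> K \<subseteq> V \<Longrightarrow> ennreal (content K) \<le> open_content V"
  unfolding open_content_def by (rule SUP_upper) auto

lemma open_content_mono: "V \<subseteq> W \<Longrightarrow> open_content V \<le> open_content W"
  unfolding open_content_def by (rule SUP_subset_mono) auto

lemma open_content_UN:
  fixes Q :: "nat \<Rightarrow> 'g set"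
  assumes "\<And>i. open (Q i)"
  shows "open_content (\<Union>i. Q i) \<le> (\<Sum>i. open_content (Q i))"
  unfolding open_content_def[of "\<Union>i. Q i"]
proof (rule SUP_least, clarify)
  fix K assume K: "compact K" "K \<subseteq> (\<Union>i. Q i)"
  obtain C I where C: "finite I" "\<forall>i. compact (C i)" "\<forall>i. C i \<subseteq> Q i" "K \<subseteq> (\<Union>i\<in>I. C i)"
    by (rule compact_split[OF K0 K assms])
  have "content K \<le> content (\<Union>i\<in>I. C i)"
    using C K by (intro content_mono compact_UN) auto
  also have "\<dots> \<le> (\<Sum>i\<in>I. content (C i))" using C by (intro content_UN_le) auto
  finally have "ennreal (content K) \<le> (\<Sum>i\<in>I. ennreal (content (C i)))"
    using C content_nonneg by (simp add: ennreal_leI sum_ennreal)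
  also have "\<dots> \<le> (\<Sum>i\<in>I. open_content (Q i))"
    using C by (intro sum_mono open_content_upper) auto
  also have "\<dots> \<le> (\<Sum>i. open_content (Q i))"
    using C by (intro sum_le_suminf) auto
  finally show "ennreal (content K) \<le> (\<Sum>i. open_content (Q i))" .
qed

lemma haar_outer_open: "open V \<Longrightarrow> haar_outer V = open_content V"
  unfolding haar_outer_def
  by (intro antisym INF_lower INF_greatest) (auto intro: open_content_mono)

lemma haar_outer_le: "open V \<Longrightarrow> A \<subseteq> V \<Longrightarrow> haar_outer A \<le> open_content V"
  unfolding haar_outer_def by (rule INF_lower) auto

lemma haar_outer_mono: "A \<subseteq> C \<Longrightarrow> haar_outer A \<le> haar_outer C"
  unfolding haar_outer_def by (rule INF_superset_mono) auto

lemma haar_outer_translation_le: "haar_outer ((+) a ` A) \<le> haar_outer A"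
  unfolding haar_outer_def[of A]
proof (rule INF_greatest, clarify)
  fix V assume V: "open V" "A \<subseteq> V"
  have "haar_outer ((+) a ` A) \<le> open_content ((+) a ` V)"
    using V by (intro haar_outer_le open_translation_group) auto
  also have "\<dots> \<le> open_content V"
    unfolding open_content_def[of "(+) a ` V"]
  proof (rule SUP_least, clarify)
    fix K assume K: "compact K" "K \<subseteq> (+) a ` V"
    have "(+) (- a) ` K \<subseteq> V"
      using K(2) by (auto simp: translation_vimage)
    then show "ennreal (content K) \<le> open_content V"
      using open_content_upper[OF compact_translation_group[OF K(1), of "- a"]] K(1)
      by (simp add: content_translation)
  qed
  finally show "haar_outer ((+) a ` A) \<le> open_content V" .
qed

lemma haar_outer_translation: "haar_outer ((+) a ` A) = haar_outer A"
  using haar_outer_translation_le[of a A] haar_outer_translation_le[of "- a" "(+) a ` A"]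
  by (simp add: translation_translation)

lemma haar_outer_countably_subadditive:
  fixes A :: "nat \<Rightarrow> 'g set"
  shows "haar_outer (\<Union>i. A i) \<le> (\<Sum>i. haar_outer (A i))"
proof (rule ennreal_le_epsilon)
  fix e :: real assume fin: "(\<Sum>i. haar_outer (A i)) < top" and e: "0 < e"
  have "\<exists>V. open V \<and> A i \<subseteq> V \<and> open_content V \<le> haar_outer (A i) + ennreal (e * (1/2)^Suc i)" for i
  proof -
    have "haar_outer (A i) \<noteq> top"
      using fin by (metis ennreal_suminf_lessD less_irrefl)
    then have "haar_outer (A i) < haar_outer (A i) + ennreal (e * (1/2)^Suc i)"
      using e ennreal_add_left_cancel_less[of "haar_outer (A i)" 0 "ennreal (e * (1/2)^Suc i)"]
      by (simp add: less_top)
    from this[unfolded haar_outer_def[of "A i"] INF_less_iff, folded haar_outer_def]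
    show ?thesis by (auto intro: less_imp_le)
  qed
  then obtain V where V: "\<And>i. open (V i)" "\<And>i. A i \<subseteq> V i"
    "\<And>i. open_content (V i) \<le> haar_outer (A i) + ennreal (e * (1/2)^Suc i)" by metis
  have "haar_outer (\<Union>i. A i) \<le> open_content (\<Union>i. V i)"
    using V by (intro haar_outer_le) auto
  also have "\<dots> \<le> (\<Sum>i. open_content (V i))" by (rule open_content_UN[OF V(1)])
  also have "\<dots> \<le> (\<Sum>i. haar_outer (A i) + ennreal (e * (1/2)^Suc i))"
    using V by (intro suminf_le) auto
  also have "\<dots> = (\<Sum>i. haar_outer (A i)) + (\<Sum>i. ennreal (e * (1/2)^Suc i))"
    by (intro suminf_add[symmetric]) auto
  also have "(\<Sum>i. ennreal (e * (1/2)^Suc i)) = ennreal e"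
  proof -
    have "(\<lambda>i. e * (1/2)^Suc i) sums (e * 1)" by (intro sums_mult power_half_series)
    then show ?thesis using e by (intro suminf_ennreal_eq) auto
  qed
  finally show "haar_outer (\<Union>i. A i) \<le> (\<Sum>i. haar_outer (A i)) + ennreal e" .
qed

lemma haar_outer_empty: "haar_outer {} = 0"
  by (simp add: haar_outer_open open_content_def content_empty)

lemma haar_outer_measure_space: "outer_measure_space UNIV haar_outer"
  unfolding outer_measure_space_def positive_def increasing_def countably_subadditive_def
  using haar_outer_empty haar_outer_mono haar_outer_countably_subadditive by auto

text \<open>
  Exhaust \<open>W \<inter> V\<close> by compact sets \<open>K\<close>, and the open set
  \<open>W - K\<close>, which contains \<open>W - V\<close>, by compact sets \<open>L\<close>.
  Then \<open>K\<close> and \<open>L\<close> are disjoint compact subsets of \<open>W\<close>.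
\<close>

lemma open_additive:
  assumes "open V" "open W"
  shows "haar_outer (W \<inter> V) + haar_outer (W - V) \<le> open_content W"
proof -
  have "haar_outer (W \<inter> V) = (SUP K\<in>{K. compact K \<and> K \<subseteq> W \<inter> V}. ennreal (content K))"
    by (simp only: haar_outer_open open_Int assms open_content_def)
  also have "\<dots> + haar_outer (W - V) = (SUP K\<in>{K. compact K \<and> K \<subseteq> W \<inter> V}. ennreal (content K) + haar_outer (W - V))"
    by (rule ennreal_SUP_add_left[symmetric]) (auto intro: exI[of _ "{}"])
  also have "\<dots> \<le> open_content W"
  proof (rule SUP_least, clarify)
    fix K assume K: "compact K" "K \<subseteq> W \<inter> V"
    have WK: "open (W - K)" using assms K by (intro open_Diff compact_imp_closed)
    have "haar_outer (W - V) \<le> open_content (W - K)"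
      using K by (intro haar_outer_le WK) auto
    then have "ennreal (content K) + haar_outer (W - V) \<le> ennreal (content K) + open_content (W - K)"
      by (rule add_left_mono)
    also have "\<dots> = (SUP L\<in>{L. compact L \<and> L \<subseteq> W - K}. ennreal (content K) + ennreal (content L))"
      unfolding open_content_def by (rule ennreal_SUP_add_right) (auto intro: exI[of _ "{}"])
    also have "\<dots> \<le> open_content W"
    proof (rule SUP_least, clarify)
      fix L assume L: "compact L" "L \<subseteq> W - K"
      have "content K + content L \<le> content (K \<union> L)"
        using K L by (intro content_Un_disjoint) auto
      then have "ennreal (content K) + ennreal (content L) \<le> ennreal (content (K \<union> L))"
        using K L by (simp add: content_nonneg ennreal_leI flip: ennreal_plus)
      also have "\<dots> \<le> open_content W"
        using K L by (intro open_content_upper compact_Un) auto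
      finally show "ennreal (content K) + ennreal (content L) \<le> open_content W" .
    qed
    finally show "ennreal (content K) + haar_outer (W - V) \<le> open_content W" .
  qed
  finally show ?thesis .
qed

text \<open>
  Caratheodory's criterion against arbitrary sets reduces to \<open>open_additive\<close>,
  because the outer measure is determined by open sets.
\<close>

lemma open_measurable:
  assumes "open V"
  shows "V \<in> lambda_system UNIV UNIV haar_outer"
proof -
  interpret sigma_algebra UNIV "UNIV :: 'g set set" using sigma_algebra_Pow[of UNIV] by simp
  have "haar_outer (A \<inter> V) + haar_outer (A - V) = haar_outer A" for A
  proof (rule antisym)
    show "haar_outer (A \<inter> V) + haar_outer (A - V) \<le> haar_outer A"
      unfolding haar_outer_def[of A]
    proof (rule INF_greatest, clarify)
      fix W assume W: "open W" "A \<subseteq> W"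
      have "haar_outer (A \<inter> V) + haar_outer (A - V) \<le> haar_outer (W \<inter> V) + haar_outer (W - V)"
        using W by (intro add_mono haar_outer_mono) auto
      also have "\<dots> \<le> open_content W" by (rule open_additive[OF assms W(1)])
      finally show "haar_outer (A \<inter> V) + haar_outer (A - V) \<le> open_content W" .
    qed
    have "subadditive UNIV haar_outer"
      using haar_outer_measure_space unfolding outer_measure_space_def
      by (intro countably_subadditive_subadditive) auto
    from subadditiveD[OF this, of "A \<inter> V" "A - V"]
    show "haar_outer A \<le> haar_outer (A \<inter> V) + haar_outer (A - V)"
      by (auto simp: Int_Diff_Un)
  qed
  then show ?thesis by (auto simp: lambda_system_eq)
qed

lemma haar_measure_space: "measure_space UNIV (sets borel) haar_outer"
proof (rule measure_down)
  interpret sigma_algebra UNIV "UNIV :: 'g set set" using sigma_algebra_Pow[of UNIV] by simp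
  show ms: "measure_space UNIV (lambda_system UNIV UNIV haar_outer) haar_outer"
    by (rule caratheodory_lemma[OF haar_outer_measure_space])
  show "sigma_algebra UNIV (sets (borel :: 'g measure))"
    using sets.sigma_algebra_axioms[of "borel :: 'g measure"] by simp
  from ms have "sigma_algebra UNIV (lambda_system UNIV UNIV haar_outer)"
    by (simp add: measure_space_def)
  then show "sets borel \<subseteq> lambda_system UNIV UNIV haar_outer"
    using sigma_algebra.sigma_sets_subset[of UNIV "lambda_system UNIV UNIV haar_outer" "Collect open"]
    by (simp add: borel_def open_measurable subset_iff)
qed

lemma sets_haar: "sets haar = sets borel"
  unfolding haar_def using sets.sigma_sets_eq[of borel]
  by (subst sets_measure_of) auto

lemma emeasure_haar: "A \<in> sets borel \<Longrightarrow> emeasure haar A = haar_outer A"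
  unfolding haar_def
  using haar_measure_space by (intro emeasure_measure_of_sigma) (auto simp: measure_space_def)

lemma emeasure_haar_translation:
  assumes "A \<in> sets borel"
  shows "emeasure haar ((+) a ` A) = emeasure haar A"
proof -
  have "(+) (- a) \<in> borel_measurable borel"
    by (intro borel_measurable_continuous_onI continuous_intros)
  then have "(+) a ` A \<in> sets borel"
    unfolding translation_vimage using assms measurable_sets_borel by blast
  then show ?thesis using assms by (simp add: emeasure_haar haar_outer_translation)
qed

text \<open>
  A finite union of translates of \<open>K0\<close> is a compact neighbourhood of
  \<open>K\<close>, and its content bounds the measure of its interior.
\<close>

lemma emeasure_haar_compact:
  assumes "compact K"
  shows "emeasure haar K < \<infinity>"
proof -
  obtain F where F: "finite F" "K \<subseteq> (\<Union>x\<in>F. (+) x ` interior K0)"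
    using cov_witness[OF assms open_interior K0(2)] by metis
  let ?L = "\<Union>x\<in>F. (+) x ` K0"
  have "K \<subseteq> interior ?L"
  proof (rule order_trans[OF F(2)], rule interior_maximal)
    show "open (\<Union>x\<in>F. (+) x ` interior K0)" by (intro open_UN ballI open_translation_group) auto
  qed (use interior_subset in blast)
  moreover have "compact ?L" using F K0 by (intro compact_UN compact_translation_group) auto
  ultimately have "haar_outer K \<le> open_content (interior ?L)" by (intro haar_outer_le) auto
  also have "\<dots> \<le> ennreal (content ?L)"
    unfolding open_content_def
  proof (rule SUP_least, clarify)
    fix K' assume K': "compact K'" "K' \<subseteq> interior ?L"
    have "K' \<subseteq> ?L" by (rule order_trans[OF K'(2) interior_subset])
    then show "ennreal (content K') \<le> ennreal (content ?L)"
      by (rule ennreal_leI[OF content_mono[OF _ K'(1) \<open>compact ?L\<close>]])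
  qed
  finally show ?thesis
    using assms by (simp add: emeasure_haar borel_compact order_le_less_trans)
qed

text \<open>
  Otherwise \<open>K0\<close>, of content 1, would be covered by finitely many null sets.
\<close>

lemma emeasure_haar_open_pos:
  assumes "open V" "0 \<in> V"
  shows "0 < emeasure haar V"
proof (rule ccontr)
  assume "\<not> 0 < emeasure haar V"
  then have V0: "emeasure haar V = 0" by simp
  obtain F where F: "finite F" "K0 \<subseteq> (\<Union>x\<in>F. (+) x ` V)"
    using cov_witness[OF K0(1) assms] by metis
  have tr: "(+) x ` V \<in> sets haar" for x
    using open_translation_group[OF assms(1), of x] by (simp add: sets_haar)
  have "1 = ennreal (content K0)" by (simp add: content_K0)
  also have "\<dots> \<le> open_content (\<Union>x\<in>F. (+) x ` V)"
    by (rule open_content_upper[OF K0(1) F(2)])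
  also have "\<dots> = emeasure haar (\<Union>x\<in>F. (+) x ` V)"
  proof -
    have "open (\<Union>x\<in>F. (+) x ` V)" using assms by (intro open_UN ballI open_translation_group)
    then show ?thesis by (simp add: emeasure_haar haar_outer_open)
  qed
  also have "\<dots> \<le> (\<Sum>x\<in>F. emeasure haar ((+) x ` V))"
    using F tr by (intro emeasure_subadditive_finite) auto
  also have "\<dots> = 0"
    using V0 assms by (simp add: emeasure_haar_translation)
  finally show False by simp
qed

lemma emeasure_haar_outer_regular:
  assumes "A \<in> sets borel"
  shows "emeasure haar A = (INF V\<in>{V. open V \<and> A \<subseteq> V}. emeasure haar V)"
  using assms by (auto simp: emeasure_haar haar_outer_def[of A] haar_outer_open intro!: INF_cong)

lemma open_supset_translates:
  fixes C :: "'g set"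
  assumes "compact C" "open W" "C \<subseteq> W"
  obtains N where "open N" "0 \<in> N" "\<forall>u\<in>N. \<forall>c\<in>C. u + c \<in> W"
proof -
  define good where "good c A D \<longleftrightarrow> open A \<and> (0::'g) \<in> A \<and> open D \<and> c \<in> D \<and> (\<forall>u\<in>A. \<forall>d\<in>D. u + d \<in> W)" for c A D
  have "\<exists>A D. good c A D" if "c \<in> C" for c
  proof -
    have "((\<lambda>p. fst p + snd p) \<longlongrightarrow> 0 + c) (nhds (0 :: 'g) \<times>\<^sub>F nhds c)"
      by (intro tendsto_add filterlim_fst filterlim_snd)
    then have "eventually (\<lambda>p. fst p + snd p \<in> W) (nhds (0 :: 'g) \<times>\<^sub>F nhds c)"
      using assms that by (auto simp: tendsto_def)
    then obtain P Q where P: "eventually P (nhds (0::'g))" and Q: "eventually Q (nhds c)"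
      and PQ: "\<And>x y. P x \<Longrightarrow> Q y \<Longrightarrow> x + y \<in> W"
      by (auto simp: eventually_prod_filter)
    obtain S where "open S" "0 \<in> S" "\<forall>x\<in>S. P x" using P unfolding eventually_nhds by blast
    moreover obtain T where "open T" "c \<in> T" "\<forall>x\<in>T. Q x" using Q unfolding eventually_nhds by blast
    ultimately have "good c S T" using PQ by (auto simp: good_def)
    then show ?thesis by blast
  qed
  then obtain A D where AD: "\<And>c. c \<in> C \<Longrightarrow> good c (A c) (D c)" by metis
  have D: "open (D c)" if "c \<in> C" for c using AD[OF that] by (simp add: good_def)
  have cover: "C \<subseteq> (\<Union>c\<in>C. D c)" using AD by (auto simp: good_def)
  obtain X where X: "X \<subseteq> C" "finite X" "C \<subseteq> (\<Union>c\<in>X. D c)"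
    by (rule compactE_image[OF assms(1) D cover])
  show ?thesis
  proof (rule that[of "\<Inter>c\<in>X. A c"])
    show "open (\<Inter>c\<in>X. A c)" using X AD by (intro open_INT) (auto simp: good_def)
    show "0 \<in> (\<Inter>c\<in>X. A c)" using X AD by (auto simp: good_def)
    show "\<forall>u\<in>\<Inter>c\<in>X. A c. \<forall>c\<in>C. u + c \<in> W"
    proof (intro ballI)
      fix u c assume u: "u \<in> (\<Inter>c\<in>X. A c)" and c: "c \<in> C"
      obtain d where d: "d \<in> X" "c \<in> D d" using X(3) c by blast
      then have "good d (A d) (D d)" using X(1) AD by blast
      then show "u + c \<in> W" using u d by (auto simp: good_def)
    qed
  qed
qed

lemma distr_haar_translation: "distr haar haar ((+) a) = haar"
proof (rule measure_eqI)
  have m: "(+) a \<in> measurable haar haar" for a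
    unfolding measurable_cong_sets[OF sets_haar sets_haar]
    by (intro borel_measurable_continuous_onI continuous_intros)
  fix A assume A: "A \<in> sets (distr haar haar ((+) a))"
  then have "emeasure (distr haar haar ((+) a)) A = emeasure haar ((+) (- (- a)) -` A \<inter> space haar)"
    using m by (simp add: emeasure_distr)
  also have "space haar = UNIV" using sets_eq_imp_space_eq[OF sets_haar] by simp
  finally show "emeasure (distr haar haar ((+) a)) A = emeasure haar A"
    using A emeasure_haar_translation[of A "- a"]
    by (simp add: translation_vimage sets_haar)
qed simp

text \<open>
  Let \<open>W\<close> be an open set around \<open>C\<close> of only slightly larger measure.
  For \<open>u\<close> near 0 the translate \<open>u + C\<close> stays in \<open>W\<close>.
  Both \<open>C\<close> and \<open>u + C\<close> then fill \<open>W\<close> up to a set of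
  small measure, so they differ by little.
\<close>

lemma left_continuous_uniform:
  assumes C: "compact C" "emeasure haar C > 0"
  shows "left_continuous_prob (uniform_measure haar C)"
  unfolding left_continuous_prob_def
proof (intro conjI allI impI)
  let ?r = "uniform_measure haar C"
  have Cs[measurable]: "C \<in> sets haar" using C by (simp add: sets_haar borel_compact)
  have fin: "emeasure haar C < \<infinity>" by (rule emeasure_haar_compact[OF C(1)])
  show "prob_space ?r" using C fin by (intro prob_space_uniform_measure) auto
  show "sets ?r = sets borel" by (simp add: sets_haar)
  fix e :: real assume e: "e > 0"
  define c where "c = measure haar C"
  have c2: "emeasure haar C = ennreal c"
    unfolding c_def using fin by (intro emeasure_eq_ennreal_measure) simp
  then have "c > 0" using C(2) by simp
  note c = this c2
  \<comment> \<open>The slack: the two integrals differ by at most \<open>2 * (measure haar W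
  - c)\<close>, and this is to be at most \<open>e * c\<close>.\<close>
  have "emeasure haar C < ennreal (c + e * c / 2)"
    unfolding c(2) using c e by (intro ennreal_lessI add_pos_pos) auto
  then obtain W where W: "open W" "C \<subseteq> W" "emeasure haar W < ennreal (c + e * c / 2)"
    using emeasure_haar_outer_regular[of C] Cs unfolding sets_haar by (auto simp: INF_less_iff)
  have Ws[measurable]: "W \<in> sets haar" using W by (simp add: sets_haar)
  have W_fin: "emeasure haar W < \<infinity>" using W(3) by (rule order_less_trans) simp
  have W_le: "measure haar W \<le> c + e * c / 2"
    using W(3) c e unfolding measure_def by (intro enn2real_leI) auto
  obtain N where N: "open N" "0 \<in> N" "\<forall>u\<in>N. \<forall>c\<in>C. u + c \<in> W"
    by (rule open_supset_translates[OF C(1) W(1,2)])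
  have "\<bar>(\<integral>h. \<phi> (u + h) \<partial>?r) - (\<integral>h. \<phi> h \<partial>?r)\<bar> \<le> e"
    if u: "u \<in> N" and \<phi>: "\<phi> \<in> borel_measurable borel" "\<forall>x. \<bar>\<phi> x\<bar> \<le> 1" for u and \<phi> :: "'g \<Rightarrow> real"
  proof -
    have m[measurable]: "(+) a \<in> measurable haar haar" for a
      unfolding measurable_cong_sets[OF sets_haar sets_haar]
      by (intro borel_measurable_continuous_onI continuous_intros)
    have \<phi>m[measurable]: "\<phi> \<in> borel_measurable haar"
      using \<phi>(1) by (simp add: measurable_cong_sets[OF sets_haar refl])
    have int: "integral\<^sup>L ?r f = (\<integral>h. indicator C h * f h \<partial>haar) / c"
      if [measurable]: "f \<in> borel_measurable haar" for f :: "'g \<Rightarrow> real"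
    proof -
      have "?r = density haar (\<lambda>x. ennreal (indicator C x / c))"
        unfolding uniform_measure_def c(2) using c
        by (intro density_cong) (auto simp: divide_ennreal indicator_def ennreal_1[symmetric] simp del: ennreal_1)
      then have "integral\<^sup>L ?r f = (\<integral>h. (indicator C h / c) *\<^sub>R f h \<partial>haar)"
        using c by (simp add: integral_density)
      then show ?thesis by simp
    qed
    let ?D = "(\<lambda>k. - u + k) -` C"
    have Ds[measurable]: "?D \<in> sets haar"
      using measurable_sets[OF m Cs, of "- u"] sets_eq_imp_space_eq[OF sets_haar] by simp
    have D: "?D = (+) u ` C" by (simp add: translation_vimage)
    have DW: "?D \<subseteq> W" unfolding D using N u by auto
    have mD: "measure haar ?D = c"
      unfolding D c_def measure_def using Cs by (simp add: emeasure_haar_translation sets_haar)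
    have "(\<integral>h. indicator C h * \<phi> (u + h) \<partial>haar) = (\<integral>h. indicator ?D (u + h) * \<phi> (u + h) \<partial>haar)"
      by (intro Bochner_Integration.integral_cong) (auto simp: indicator_def add.assoc[symmetric])
    also have "\<dots> = (\<integral>k. indicator ?D k * \<phi> k \<partial>distr haar haar ((+) u))"
      by (subst integral_distr) auto
    finally have tr: "(\<integral>h. indicator C h * \<phi> (u + h) \<partial>haar) = (\<integral>k. indicator ?D k * \<phi> k \<partial>haar)"
      by (simp add: distr_haar_translation)
    have sub_fin: "emeasure haar A < \<infinity>" if "A \<subseteq> W" for A
      using emeasure_mono[OF that Ws] W_fin by (rule order_le_less_trans)
    have ii: "integrable haar (\<lambda>k. indicator A k :: real)" "integrable haar (\<lambda>k. indicator A k * \<phi> k)"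
      if [measurable]: "A \<in> sets haar" and "A \<subseteq> W" for A
    proof -
      show i: "integrable haar (\<lambda>k. indicator A k :: real)"
        using sub_fin[OF that(2)] by (intro integrable_real_indicator) auto
      show "integrable haar (\<lambda>k. indicator A k * \<phi> k)"
        by (rule Bochner_Integration.integrable_bound[OF i]) (use \<phi> in \<open>auto simp: indicator_def\<close>)
    qed
    have "\<bar>(\<integral>k. indicator ?D k * \<phi> k \<partial>haar) - (\<integral>k. indicator C k * \<phi> k \<partial>haar)\<bar>
        = \<bar>\<integral>k. indicator ?D k * \<phi> k - indicator C k * \<phi> k \<partial>haar\<bar>"
      using ii[OF Ds DW] ii[OF Cs W(2)] by simp
    also have "\<dots> \<le> (\<integral>k. (indicator W k - indicator ?D k) + (indicator W k - indicator C k) \<partial>haar)"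
    proof (rule order_trans[OF integral_abs_bound integral_mono])
      show "integrable haar (\<lambda>k. \<bar>indicator ?D k * \<phi> k - indicator C k * \<phi> k\<bar>)"
        using ii[OF Ds DW] ii[OF Cs W(2)] by simp
      show "integrable haar (\<lambda>k. (indicator W k - indicator ?D k) + (indicator W k - indicator C k) :: real)"
        using ii[OF Ds DW] ii[OF Cs W(2)] ii[OF Ws order_refl] by simp
      show "\<bar>indicator ?D k * \<phi> k - indicator C k * \<phi> k\<bar>
          \<le> (indicator W k - indicator ?D k) + (indicator W k - indicator C k)" for k
        using \<phi>(2)[rule_format, of k] DW W(2) by (auto simp: indicator_def)
    qed
    also have "\<dots> = 2 * measure haar W - 2 * c"
      using ii[OF Ds DW] ii[OF Cs W(2)] ii[OF Ws order_refl] mD by (simp add: c_def)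
    also have "\<dots> \<le> e * c" using W_le by simp
    finally have "\<bar>(\<integral>k. indicator ?D k * \<phi> k \<partial>haar) - (\<integral>k. indicator C k * \<phi> k \<partial>haar)\<bar> \<le> e * c" .
    then have "\<bar>(\<integral>k. indicator ?D k * \<phi> k \<partial>haar) - (\<integral>k. indicator C k * \<phi> k \<partial>haar)\<bar> / c \<le> e"
      using c by (simp add: divide_le_eq)
    moreover have "(\<integral>h. \<phi> (u + h) \<partial>?r) = (\<integral>k. indicator ?D k * \<phi> k \<partial>haar) / c"
      by (subst int) (auto simp: tr)
    moreover have "(\<integral>h. \<phi> h \<partial>?r) = (\<integral>k. indicator C k * \<phi> k \<partial>haar) / c"
      by (rule int) simp
    ultimately show ?thesis using c by (simp add: diff_divide_distrib[symmetric] abs_divide)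
  qed
  then show "\<exists>N. open N \<and> 0 \<in> N \<and> (\<forall>u\<in>N. shift_close ?r e u)"
    using N(1,2) unfolding shift_close_def by blast
qed

end

text \<open>
  The normalised restriction of a Haar measure to a compact neighbourhood of 0 inside
  \<open>V\<close>. First countability is what allows the covering sets of
  \<open>haar_content\<close> to be indexed by natural numbers.
\<close>

lemma ex_left_continuous_prob:
  fixes V :: "'g::{topological_group_add, first_countable_topology, t2_space} set"
  assumes lc: "locally_compact_space (euclidean :: 'g topology)" and V: "open V" "0 \<in> V"
  obtains \<rho> where "left_continuous_prob \<rho>" "AE h in \<rho>. h \<in> V"
proof -
  obtain N L0 where L0: "open N" "compact L0" "(0::'g) \<in> N" "N \<subseteq> L0"
  proof -
    have "\<forall>x::'g. \<exists>U. open U \<and> (\<exists>K. compact K \<and> x \<in> U \<and> U \<subseteq> K)"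
      using lc by (simp add: locally_compact_space_def)
    from this[rule_format, of 0] show ?thesis using that by blast
  qed
  then have L0': "0 \<in> interior L0" by (meson interior_maximal subsetD)
  obtain B :: "nat \<Rightarrow> 'g set" where B: "\<And>i. open (B i)" "\<And>i. 0 \<in> B i"
    "\<And>S. open S \<Longrightarrow> 0 \<in> S \<Longrightarrow> eventually (\<lambda>i. B i \<subseteq> S) sequentially"
    by (rule countable_basis_at_decseq[of 0]) blast
  obtain \<U> :: "nat filter" where U: "\<U> \<le> sequentially" "ultra \<U>"
    using ultra_refines[of sequentially] by auto
  interpret haar_content L0 B \<U>
    by unfold_locales (use L0 L0' B U in \<open>auto intro: filter_leD\<close>)
  obtain W C where W: "open W" "compact C" "0 \<in> W" "W \<subseteq> C" "C \<subseteq> V"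
    by (rule compact_nbhd_inside[OF L0(2) L0' V])
  have "emeasure haar W \<le> emeasure haar C"
    using W by (intro emeasure_mono) (auto simp: sets_haar borel_compact)
  then have "0 < emeasure haar C" using emeasure_haar_open_pos[OF W(1,3)] by simp
  then have "left_continuous_prob (uniform_measure haar C)"
    using W by (intro left_continuous_uniform)
  moreover have "AE h in uniform_measure haar C. h \<in> V"
    using W by (intro AE_uniform_measureI) (auto simp: sets_haar borel_compact)
  ultimately show ?thesis by (rule that)
qed

section \<open>Separation of convex sets and the dual of \<open>L\<^sup>1\<close>\<close>

text \<open>
  The separation theorem is applied to families of functions indexed by group elements, in the
  subspace of those whose members at finitely many given elements are integrable.
\<close>

instantiation "fun" :: (type, real_vector) real_vector
begin
definition scaleR_fun :: "real \<Rightarrow> ('a \<Rightarrow> 'b) \<Rightarrow> 'a \<Rightarrow> 'b" where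
  "scaleR_fun c f = (\<lambda>x. c *\<^sub>R f x)"
instance
  by standard (auto simp: scaleR_fun_def fun_eq_iff scaleR_add_right scaleR_add_left)
end

text \<open>
  Positive homogeneity is required as an inequality only, which is easier to verify for
  infima; equality follows by applying it to \<open>1 / c\<close>.
\<close>

definition sublinear_on :: "'v::real_vector set \<Rightarrow> ('v \<Rightarrow> real) \<Rightarrow> bool" where
  "sublinear_on V q \<longleftrightarrow> (\<forall>u\<in>V. \<forall>v\<in>V. q (u + v) \<le> q u + q v) \<and> (\<forall>c>0. \<forall>v\<in>V. q (c *\<^sub>R v) \<le> c * q v)"

lemma sublinear_onD:
  assumes V: "subspace V" and q: "sublinear_on V q"
  shows "u \<in> V \<Longrightarrow> v \<in> V \<Longrightarrow> q (u + v) \<le> q u + q v"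
    and "v \<in> V \<Longrightarrow> 0 \<le> c \<Longrightarrow> q (c *\<^sub>R v) = c * q v"
    and "v \<in> V \<Longrightarrow> - q (- v) \<le> q v"
proof -
  show add: "q (u + v) \<le> q u + q v" if "u \<in> V" "v \<in> V" for u v
    using q that by (auto simp: sublinear_on_def)
  have le: "q (c *\<^sub>R v) \<le> c * q v" if "v \<in> V" "0 < c" for c v
    using q that by (auto simp: sublinear_on_def)
  have zero: "q 0 = 0"
    using add[of 0 0] le[of 0 "1/2"] subspace_0[OF V] by simp
  show hom: "q (c *\<^sub>R v) = c * q v" if "v \<in> V" "0 \<le> c" for c v
  proof (cases "c = 0")
    case False
    have "q ((1 / c) *\<^sub>R (c *\<^sub>R v)) \<le> (1 / c) * q (c *\<^sub>R v)"
      using False that by (intro le subspace_scale V) auto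
    then have "c * q v \<le> q (c *\<^sub>R v)" using False that by (simp add: field_simps)
    then show ?thesis using le[of v c] False that by simp
  qed (simp add: zero)
  show "- q (- v) \<le> q v" if "v \<in> V"
    using add[of v "- v"] subspace_neg[OF V that] that zero by simp
qed

text \<open>
  Below \<open>p\<close> there is a minimal sublinear function \<open>q\<close>, by Zorn's
  lemma, and it is linear: for fixed \<open>v\<close> the function \<open>x \<mapsto> INF
  t\<ge>0. q (x + t v) - t q v\<close> is sublinear and below \<open>q\<close>, hence equal to
  \<open>q\<close>, and \<open>t = 1\<close> gives \<open>q x + q v \<le> q (x + v)\<close>.
\<close>

theorem Hahn_Banach_sublinear:
  fixes p :: "'v::real_vector \<Rightarrow> real"
  assumes V: "subspace V" and p: "sublinear_on V p"
  obtains \<Lambda> where "\<And>u v. u \<in> V \<Longrightarrow> v \<in> V \<Longrightarrow> \<Lambda> (u + v) = \<Lambda> u + \<Lambda> v"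
    and "\<And>c v. v \<in> V \<Longrightarrow> \<Lambda> (c *\<^sub>R v) = c * \<Lambda> v" and "\<And>v. v \<in> V \<Longrightarrow> \<Lambda> v \<le> p v"
proof -
  \<comment> \<open>The functions are normalised to 0 outside \<open>V\<close>, so that the
  pointwise order of functions compares them on \<open>V\<close> only.\<close>
  define S where "S = {q. (\<forall>v. v \<notin> V \<longrightarrow> q v = 0) \<and> sublinear_on V q \<and> (\<forall>v\<in>V. q v \<le> p v)}"
  have S_low: "- p (- v) \<le> q v" if "q \<in> S" "v \<in> V" for q v
    using sublinear_onD(3)[OF V, of q v] that subspace_neg[OF V that(2)] unfolding S_def by force
  have "\<exists>m\<in>S. \<forall>a\<in>S. m \<ge> a \<longrightarrow> a = m"
  proof (rule predicate_Zorn)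
    show "partial_order_on S (relation_of (\<ge>) S)"
      by (rule partial_order_on_relation_ofI) auto
    fix C assume C: "C \<in> Chains (relation_of (\<ge>) S)"
    then have sub: "C \<subseteq> S" and tot: "\<And>a b. a \<in> C \<Longrightarrow> b \<in> C \<Longrightarrow> a \<le> b \<or> b \<le> a"
      by (auto simp: Chains_def relation_of_def)
    show "\<exists>u\<in>S. \<forall>a\<in>C. a \<ge> u"
    proof (cases "C = {}")
      case True
      have "(\<lambda>v. if v \<in> V then p v else 0) \<in> S"
        using p V by (auto simp: S_def sublinear_on_def subspace_add subspace_scale)
      then show ?thesis using True by auto
    next
      case False
      define u where "u v = (if v \<in> V then INF q\<in>C. q v else 0)" for v
      have bdd: "bdd_below ((\<lambda>q. q v) ` C)" if "v \<in> V" for v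
        using S_low that sub by (auto intro!: bdd_belowI[of _ "- p (- v)"])
      have u_le: "u v \<le> q v" if "q \<in> C" "v \<in> V" for q v
        using that by (auto simp: u_def intro: cINF_lower[OF bdd])
      have le_u: "b \<le> u v" if "v \<in> V" "\<And>q. q \<in> C \<Longrightarrow> b \<le> q v" for b v
        using that False by (auto simp: u_def intro: cINF_greatest)
      have add: "u (x + y) \<le> u x + u y" if xy: "x \<in> V" "y \<in> V" for x y
      proof -
        have "u (x + y) \<le> q x + q' y" if q: "q \<in> C" "q' \<in> C" for q q'
        proof -
          obtain r where r: "r \<in> C" "r \<le> q" "r \<le> q'" using tot[OF q] q by blast
          have "u (x + y) \<le> r (x + y)" using r xy V by (intro u_le) (auto intro: subspace_add)
          also have "\<dots> \<le> r x + r y"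
            using r sub xy by (intro sublinear_onD(1)[OF V]) (auto simp: S_def)
          also have "\<dots> \<le> q x + q' y" using r by (auto simp: le_fun_def intro: add_mono)
          finally show ?thesis .
        qed
        note two = this
        have "u (x + y) - q x \<le> u y" if "q \<in> C" for q
          using two[OF that] xy by (intro le_u) (auto simp: algebra_simps)
        then have "u (x + y) - u y \<le> u x"
          using xy by (intro le_u) (auto simp: algebra_simps)
        then show ?thesis by simp
      qed
      have scale: "u (c *\<^sub>R v) \<le> c * u v" if "0 < c" "v \<in> V" for c v
      proof -
        have "u (c *\<^sub>R v) / c \<le> u v"
        proof (rule le_u[OF that(2)])
          fix q assume q: "q \<in> C"
          have "u (c *\<^sub>R v) \<le> q (c *\<^sub>R v)" using that q V by (intro u_le subspace_scale)
          also have "\<dots> = c * q v"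
            using q sub that by (intro sublinear_onD(2)[OF V]) (auto simp: S_def)
          finally show "u (c *\<^sub>R v) / c \<le> q v" using that by (simp add: field_simps)
        qed
        then show ?thesis using that by (simp add: field_simps)
      qed
      obtain q0 where q0: "q0 \<in> C" using False by auto
      have "u v \<le> p v" if "v \<in> V" for v
        using u_le[OF q0 that] q0 sub that by (force simp: S_def)
      then have "u \<in> S" using add scale by (auto simp: S_def sublinear_on_def u_def)
      moreover have "u \<le> q" if "q \<in> C" for q
        using u_le[OF that] that sub by (auto simp: le_fun_def S_def u_def)
      ultimately show ?thesis by blast
    qed
  qed
  then obtain q where q: "q \<in> S" and min: "\<And>r. r \<in> S \<Longrightarrow> r \<le> q \<Longrightarrow> r = q" by auto
  have subl: "sublinear_on V q" using q by (simp add: S_def)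
  note q_add = sublinear_onD(1)[OF V subl] and q_hom = sublinear_onD(2)[OF V subl]
  have super: "q x + q v \<le> q (x + v)" if v: "v \<in> V" and x: "x \<in> V" for v x
  proof -
    define r where "r x = (if x \<in> V then INF t\<in>{0..}. q (x + t *\<^sub>R v) - t * q v else 0)" for x
    have tv: "t *\<^sub>R v \<in> V" for t using v V by (intro subspace_scale)
    have bdd: "bdd_below ((\<lambda>t. q (x + t *\<^sub>R v) - t * q v) ` {0..})" if x: "x \<in> V" for x
    proof (rule bdd_belowI2)
      fix t :: real assume t: "t \<in> {0..}"
      have "q (t *\<^sub>R v) = q ((x + t *\<^sub>R v) + (- x))" by simp
      also have "\<dots> \<le> q (x + t *\<^sub>R v) + q (- x)"
        using x tv V by (intro q_add subspace_add subspace_neg)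
      finally show "- q (- x) \<le> q (x + t *\<^sub>R v) - t * q v" using q_hom[OF v, of t] t by simp
    qed
    have r_le: "r x \<le> q (x + t *\<^sub>R v) - t * q v" if "x \<in> V" "0 \<le> t" for x t
      using that by (auto simp: r_def intro: cINF_lower[OF bdd])
    have le_r: "b \<le> r x" if "x \<in> V" "\<And>t. 0 \<le> t \<Longrightarrow> b \<le> q (x + t *\<^sub>R v) - t * q v" for b x
      using that by (auto simp: r_def intro: cINF_greatest)
    have add: "r (x + y) \<le> r x + r y" if xy: "x \<in> V" "y \<in> V" for x y
    proof -
      have "r (x + y) \<le> (q (x + s *\<^sub>R v) - s * q v) + (q (y + t *\<^sub>R v) - t * q v)"
        if st: "0 \<le> s" "0 \<le> t" for s t
      proof -
        have "r (x + y) \<le> q ((x + y) + (s + t) *\<^sub>R v) - (s + t) * q v"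
          using st xy V by (intro r_le subspace_add) auto
        also have "(x + y) + (s + t) *\<^sub>R v = (x + s *\<^sub>R v) + (y + t *\<^sub>R v)"
          by (simp add: algebra_simps)
        also have "q \<dots> \<le> q (x + s *\<^sub>R v) + q (y + t *\<^sub>R v)"
          using xy tv V by (intro q_add subspace_add)
        finally show ?thesis by (simp add: algebra_simps)
      qed
      note two = this
      have "r (x + y) - (q (x + s *\<^sub>R v) - s * q v) \<le> r y" if s: "0 \<le> s" for s
      proof (rule le_r[OF xy(2)])
        fix t :: real assume "0 \<le> t"
        from two[OF s this] show "r (x + y) - (q (x + s *\<^sub>R v) - s * q v) \<le> q (y + t *\<^sub>R v) - t * q v"
          by simp
      qed
      then have "r (x + y) - r y \<le> r x"
        using xy by (intro le_r) (auto simp: algebra_simps)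
      then show ?thesis by simp
    qed
    have scale: "r (c *\<^sub>R x) \<le> c * r x" if c: "0 < c" and x: "x \<in> V" for c x
    proof -
      have "r (c *\<^sub>R x) / c \<le> r x"
      proof (rule le_r[OF x])
        fix t :: real assume t: "0 \<le> t"
        have "r (c *\<^sub>R x) \<le> q (c *\<^sub>R x + (c * t) *\<^sub>R v) - (c * t) * q v"
          using c t x V by (intro r_le subspace_scale) auto
        also have "c *\<^sub>R x + (c * t) *\<^sub>R v = c *\<^sub>R (x + t *\<^sub>R v)" by (simp add: algebra_simps)
        also have "q \<dots> = c * q (x + t *\<^sub>R v)" using c x tv V by (intro q_hom subspace_add) auto
        finally show "r (c *\<^sub>R x) / c \<le> q (x + t *\<^sub>R v) - t * q v" using c by (simp add: field_simps)
      qed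
      then show ?thesis using c by (simp add: field_simps)
    qed
    have rq: "r y \<le> q y" if "y \<in> V" for y using r_le[OF that, of 0] by simp
    have "r \<in> S"
      using q add scale rq by (force simp: S_def sublinear_on_def r_def)
    moreover have "r \<le> q" using rq q by (auto simp: le_fun_def S_def r_def)
    ultimately have "r = q" by (rule min)
    then show ?thesis using r_le[OF x, of 1] by simp
  qed
  have addq: "q (u + v) = q u + q v" if "u \<in> V" "v \<in> V" for u v
    using super[OF that(2,1)] q_add[OF that] by simp
  have negq: "q (- v) = - q v" if "v \<in> V" for v
    using addq[OF that subspace_neg[OF V that]] q_hom[OF that, of 0] by simp
  have "q (c *\<^sub>R v) = c * q v" if v: "v \<in> V" for c v
  proof (cases "0 \<le> c")
    case False
    have "q (- ((- c) *\<^sub>R v)) = - q ((- c) *\<^sub>R v)" using v V by (intro negq subspace_scale)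
    then show ?thesis using q_hom[OF v, of "- c"] False by simp
  qed (use q_hom[OF v] in auto)
  with addq show ?thesis using q by (intro that[of q]) (auto simp: S_def)
qed

text \<open>
  Apply the Hahn-Banach theorem to the sublinear function \<open>p v = (INF t\<ge>0, c\<in>C.
  N (v + t c) - t e)\<close>. It is bounded below by \<open>- N\<close> because \<open>N \<ge>
  e\<close> on \<open>C\<close>, it lies below \<open>N\<close>, and \<open>p (- c) \<le> -
  e\<close>. Convexity of \<open>C\<close> enters in subadditivity, where two points of
  \<open>C\<close> are replaced by a weighted mean of them.
\<close>

theorem convex_separation:
  fixes N :: "'v::real_vector \<Rightarrow> real"
  assumes V: "subspace V" and C: "convex C" "C \<noteq> {}" "C \<subseteq> V" and e: "\<And>c. c \<in> C \<Longrightarrow> e \<le> N c"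
    and N_add: "\<And>u v. u \<in> V \<Longrightarrow> v \<in> V \<Longrightarrow> N (u + v) \<le> N u + N v"
    and N_scale: "\<And>c v. v \<in> V \<Longrightarrow> N (c *\<^sub>R v) = \<bar>c\<bar> * N v"
  obtains \<Lambda> where "\<And>u v. u \<in> V \<Longrightarrow> v \<in> V \<Longrightarrow> \<Lambda> (u + v) = \<Lambda> u + \<Lambda> v"
    and "\<And>c v. v \<in> V \<Longrightarrow> \<Lambda> (c *\<^sub>R v) = c * \<Lambda> v" and "\<And>v. v \<in> V \<Longrightarrow> \<bar>\<Lambda> v\<bar> \<le> N v"
    and "\<And>c. c \<in> C \<Longrightarrow> e \<le> \<Lambda> c"
proof -
  define p where "p v = (INF (t, c)\<in>{0..} \<times> C. N (v + t *\<^sub>R c) - t * e)" for v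
  have N_neg: "N (- v) = N v" if "v \<in> V" for v using N_scale[OF that, of "-1"] by simp
  have tc: "t *\<^sub>R c \<in> V" if "c \<in> C" for t c using that C V by (intro subspace_scale) auto
  have bdd: "bdd_below ((\<lambda>(t, c). N (v + t *\<^sub>R c) - t * e) ` ({0..} \<times> C))" if v: "v \<in> V" for v
  proof (rule bdd_belowI2)
    fix tc assume "tc \<in> {0::real..} \<times> C"
    then obtain t c where t: "0 \<le> (t::real)" "c \<in> C" and tc_eq: "tc = (t, c)" by auto
    have "t * e \<le> t * N c" using t e by (intro mult_left_mono) auto
    also have "\<dots> = N (t *\<^sub>R c)" using t C N_scale by auto
    also have "\<dots> = N ((v + t *\<^sub>R c) + (- v))" by simp
    also have "\<dots> \<le> N (v + t *\<^sub>R c) + N (- v)"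
      using v tc t V by (intro N_add subspace_add subspace_neg)
    finally show "- N v \<le> (case tc of (t, c) \<Rightarrow> N (v + t *\<^sub>R c) - t * e)"
      using N_neg[OF v] by (simp add: tc_eq)
  qed
  have p_le: "p v \<le> N (v + t *\<^sub>R c) - t * e" if "v \<in> V" "0 \<le> t" "c \<in> C" for v t c
    unfolding p_def using cINF_lower[OF bdd[OF that(1)], of "(t, c)"] that by simp
  have le_p: "b \<le> p v" if "\<And>t c. 0 \<le> t \<Longrightarrow> c \<in> C \<Longrightarrow> b \<le> N (v + t *\<^sub>R c) - t * e" for b v
    unfolding p_def using that C by (intro cINF_greatest) auto
  have p_N: "p v \<le> N v" if "v \<in> V" for v using p_le[OF that, of 0] C by auto
  have add: "p (x + y) \<le> p x + p y" if xy: "x \<in> V" "y \<in> V" for x y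
  proof -
    have "p (x + y) \<le> (N (x + s *\<^sub>R c) - s * e) + (N (y + t *\<^sub>R d) - t * e)"
      if st: "0 \<le> s" "0 \<le> t" "c \<in> C" "d \<in> C" for s t c d
    proof (cases "s + t = 0")
      case True
      then have "s = 0" "t = 0" using st by auto
      then show ?thesis using p_N[OF subspace_add[OF V xy]] N_add[OF xy] by simp
    next
      case False
      define w where "w = (s / (s + t)) *\<^sub>R c + (t / (s + t)) *\<^sub>R d"
      have w: "w \<in> C" unfolding w_def
        using C(1) st False by (intro convexD) (auto simp: add_divide_distrib[symmetric])
      have sw: "(s + t) *\<^sub>R w = s *\<^sub>R c + t *\<^sub>R d" unfolding w_def using False
        by (simp only: scaleR_add_right scaleR_scaleR) simp
      have "p (x + y) \<le> N ((x + y) + (s + t) *\<^sub>R w) - (s + t) * e"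
        using st w xy V by (intro p_le subspace_add) auto
      also have "(x + y) + (s + t) *\<^sub>R w = (x + s *\<^sub>R c) + (y + t *\<^sub>R d)" unfolding sw by (simp add: algebra_simps)
      also have "N \<dots> \<le> N (x + s *\<^sub>R c) + N (y + t *\<^sub>R d)"
        using xy tc st V by (intro N_add subspace_add)
      finally show ?thesis by (simp add: algebra_simps)
    qed
    note two = this
    have "p (x + y) - (N (x + s *\<^sub>R c) - s * e) \<le> p y" if s: "0 \<le> s" "c \<in> C" for s c
    proof (rule le_p)
      fix t :: real and d assume t: "0 \<le> t" "d \<in> C"
      from two[OF s(1) t(1) s(2) t(2)]
      show "p (x + y) - (N (x + s *\<^sub>R c) - s * e) \<le> N (y + t *\<^sub>R d) - t * e" by simp
    qed
    then have "p (x + y) - p y \<le> p x" by (intro le_p) (auto simp: algebra_simps)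
    then show ?thesis by simp
  qed
  have scale: "p (a *\<^sub>R v) \<le> a * p v" if a: "0 < a" and v: "v \<in> V" for a v
  proof -
    have "p (a *\<^sub>R v) / a \<le> p v"
    proof (rule le_p)
      fix t :: real and c assume t: "0 \<le> t" "c \<in> C"
      have "p (a *\<^sub>R v) \<le> N (a *\<^sub>R v + (a * t) *\<^sub>R c) - (a * t) * e"
        using a t v V by (intro p_le subspace_scale) auto
      also have "a *\<^sub>R v + (a * t) *\<^sub>R c = a *\<^sub>R (v + t *\<^sub>R c)" by (simp add: algebra_simps)
      also have "N \<dots> = a * N (v + t *\<^sub>R c)" using a v tc t V by (subst N_scale) (auto intro: subspace_add)
      finally show "p (a *\<^sub>R v) / a \<le> N (v + t *\<^sub>R c) - t * e" using a by (simp add: field_simps)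
    qed
    then show ?thesis using a by (simp add: field_simps)
  qed
  have "sublinear_on V p" using add scale by (auto simp: sublinear_on_def)
  from Hahn_Banach_sublinear[OF V this] obtain \<Lambda> where L: "\<And>u v. u \<in> V \<Longrightarrow> v \<in> V \<Longrightarrow> \<Lambda> (u + v) = \<Lambda> u + \<Lambda> v"
    "\<And>c v. v \<in> V \<Longrightarrow> \<Lambda> (c *\<^sub>R v) = c * \<Lambda> v" "\<And>v. v \<in> V \<Longrightarrow> \<Lambda> v \<le> p v" by blast
  have L_neg: "\<Lambda> (- v) = - \<Lambda> v" if "v \<in> V" for v using L(2)[OF that, of "-1"] by simp
  show ?thesis
  proof (rule that[OF L(1,2)])
    fix v assume v: "v \<in> V"
    have "\<Lambda> v \<le> N v" "\<Lambda> (- v) \<le> N (- v)"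
      using L(3) p_N v subspace_neg[OF V v] by (meson order_trans)+
    then show "\<bar>\<Lambda> v\<bar> \<le> N v" using L_neg[OF v] N_neg[OF v] by auto
  next
    fix c assume c: "c \<in> C"
    then have cV: "c \<in> V" using C by auto
    have "N (0 :: 'v) = 0" using N_scale[OF cV, of 0] by simp
    then have "p (- c) \<le> - e" using p_le[OF subspace_neg[OF V cV], of 1 c] c by simp
    then show "e \<le> \<Lambda> c" using L(3)[OF subspace_neg[OF V cV]] L_neg[OF cV] by simp
  qed auto
qed

text \<open>
  With a strictly positive integrable weight \<open>w\<close>, the functional becomes one on
  the integrable functions of the finite measure \<open>N = w M\<close>. Adding the integral
  makes it positive: the set function \<open>k A = \<Lambda> (w 1\<^sub>A) + N A\<close> lies
  between 0 and \<open>2 N A\<close>, so it is a measure with a density \<open>h\<close>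
  between 0 and 2. Then \<open>h - 1\<close> represents \<open>\<Lambda>\<close>, first on
  indicator functions and then, by continuity, on all integrable functions.
\<close>

theorem L1_dual:
  fixes \<Lambda> :: "('x \<Rightarrow> real) \<Rightarrow> real"
  assumes M: "sigma_finite_measure M"
    and add: "\<And>f g. integrable M f \<Longrightarrow> integrable M g \<Longrightarrow> \<Lambda> (\<lambda>x. f x + g x) = \<Lambda> f + \<Lambda> g"
    and scale: "\<And>c f. integrable M f \<Longrightarrow> \<Lambda> (\<lambda>x. c * f x) = c * \<Lambda> f"
    and bound: "\<And>f. integrable M f \<Longrightarrow> \<bar>\<Lambda> f\<bar> \<le> (\<integral>x. \<bar>f x\<bar> \<partial>M)"
  obtains \<phi> where "\<phi> \<in> borel_measurable M" "\<And>x. \<bar>\<phi> x\<bar> \<le> 1"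
    "\<And>f. integrable M f \<Longrightarrow> \<Lambda> f = (\<integral>x. \<phi> x * f x \<partial>M)"
proof -
  interpret sigma_finite_measure M by fact
  obtain w :: "'x \<Rightarrow> real" where w[measurable]: "w \<in> borel_measurable M" and w_pos: "\<And>x. w x > 0"
    and w_int: "integrable M w"
    using obtain_positive_integrable_function by metis
  have diff: "\<Lambda> (\<lambda>x. f x - g x) = \<Lambda> f - \<Lambda> g" if "integrable M f" "integrable M g" for f g
    using add[of f "\<lambda>x. (-1) * g x"] scale[of g "-1"] that by simp
  define N where "N = density M (\<lambda>x. ennreal (w x))"
  have N_sets[measurable_cong]: "sets N = sets M" by (simp add: N_def)
  have N_space: "space N = space M" by (simp add: N_def)
  have emN: "emeasure N A = ennreal (\<integral>x. w x * indicator A x \<partial>M)" if [measurable]: "A \<in> sets M" for A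
    unfolding N_def using w_pos w_int
    by (subst emeasure_density)
       (auto simp: nn_integral_eq_integral integrable_real_mult_indicator less_imp_le
          simp flip: ennreal_indicator ennreal_mult' intro!: nn_integral_eq_integral)
  interpret N: finite_measure N
    by standard (simp add: emN N_space)
  have wA: "integrable M (\<lambda>x. w x * indicator A x)" if "A \<in> sets M" for A
    using w_int that by (rule integrable_real_mult_indicator[rotated])
  have mN: "measure N A = (\<integral>x. w x * indicator A x \<partial>M)" if "A \<in> sets M" for A
    using emN[OF that] w_pos by (simp add: measure_def less_imp_le)
  define k where "k A = \<Lambda> (\<lambda>x. w x * indicator A x) + measure N A" for A
  have L_bound: "\<bar>\<Lambda> (\<lambda>x. w x * indicator A x)\<bar> \<le> measure N A" if "A \<in> sets M" for A
    using bound[OF wA[OF that]] mN[OF that] w_pos by (simp add: abs_mult less_imp_le)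
  have k_pos: "0 \<le> k A" and k_le: "k A \<le> 2 * measure N A" if "A \<in> sets M" for A
    using L_bound[OF that] by (auto simp: k_def)
  have k_Un: "k (A \<union> B) = k A + k B" if AB: "A \<in> sets M" "B \<in> sets M" "A \<inter> B = {}" for A B
  proof -
    have "(\<lambda>x. w x * indicator (A \<union> B) x) = (\<lambda>x. w x * indicator A x + w x * indicator B x)"
      using AB(3) by (auto simp: indicator_def fun_eq_iff)
    then show ?thesis
      using AB add[OF wA[OF AB(1)] wA[OF AB(2)]] N.finite_measure_Union[of A B] by (simp add: k_def N_sets)
  qed
  define \<kappa> where "\<kappa> = measure_of (space M) (sets M) (\<lambda>A. ennreal (k A))"
  have k_empty: "k {} = 0" using k_pos[of "{}"] k_le[of "{}"] by simp
  have ca: "countably_additive (sets M) (\<lambda>A. ennreal (k A))"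
    unfolding countably_additive_def
  proof (intro allI impI)
    fix A :: "nat \<Rightarrow> 'x set" assume A: "range A \<subseteq> sets M" "disjoint_family A"
    have Am: "A i \<in> sets M" for i using A by auto
    have Um: "(\<Union>i. A i) \<in> sets M" "(\<Union>i<n. A i) \<in> sets M" for n using Am by auto
    have part: "k (\<Union>i<n. A i) = (\<Sum>i<n. k (A i))" for n
    proof (induction n)
      case (Suc n)
      have "(\<Union>i<n. A i) \<inter> A n = {}"
        using A(2) by (auto simp: disjoint_family_on_def) (metis disjoint_iff less_irrefl)
      then show ?case using Suc k_Un[of "\<Union>i<n. A i" "A n"] Am by (simp add: lessThan_Suc Un_commute)
    qed (simp add: k_empty)
    let ?U = "\<Union>i. A i"
    have rest: "k ?U - (\<Sum>i<n. k (A i)) = k (?U - (\<Union>i<n. A i))" for n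
    proof -
      have "(\<Union>i<n. A i) \<union> (?U - (\<Union>i<n. A i)) = ?U" by auto
      then show ?thesis using k_Un[of "\<Union>i<n. A i" "?U - (\<Union>i<n. A i)"] Um part[of n] by auto
    qed
    have Nrest: "measure N (?U - (\<Union>i<n. A i)) = measure N ?U - (\<Sum>i<n. measure N (A i))" for n
    proof -
      have "measure N (\<Union>i<n. A i) = (\<Sum>i<n. measure N (A i))"
        using A Am by (intro N.finite_measure_finite_Union)
          (auto simp: N_sets intro: disjoint_family_on_mono)
      then show ?thesis using Um by (subst N.finite_measure_Diff) (auto simp: N_sets)
    qed
    have "(\<lambda>i. measure N (A i)) sums measure N ?U"
      using A by (intro N.finite_measure_UNION) (auto simp: N_sets)
    then have "(\<lambda>n. measure N (?U - (\<Union>i<n. A i))) \<longlonglongrightarrow> 0"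
      unfolding Nrest sums_def by (auto intro: tendsto_eq_intros)
    then have lim2: "(\<lambda>n. 2 * measure N (?U - (\<Union>i<n. A i))) \<longlonglongrightarrow> 0"
      by (auto intro: tendsto_eq_intros)
    have "(\<lambda>n. k ?U - (\<Sum>i<n. k (A i))) \<longlonglongrightarrow> 0"
      unfolding rest
      by (rule tendsto_sandwich[OF _ _ tendsto_const lim2]) (use Um k_pos k_le in auto)
    then have "(\<lambda>n. k ?U - (k ?U - (\<Sum>i<n. k (A i)))) \<longlonglongrightarrow> k ?U - 0"
      by (intro tendsto_diff tendsto_const)
    then have "(\<lambda>i. k (A i)) sums k ?U" by (simp add: sums_def)
    then show "(\<Sum>i. ennreal (k (A i))) = ennreal (k ?U)"
      using k_pos[OF Am] by (intro suminf_ennreal_eq) auto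
  qed
  have em\<kappa>: "emeasure \<kappa> A = ennreal (k A)" if "A \<in> sets M" for A
    unfolding \<kappa>_def using that ca k_empty
    by (intro emeasure_measure_of_sigma sets.sigma_algebra_axioms) (auto simp: positive_def)
  have \<kappa>_sets: "sets \<kappa> = sets M" by (simp add: \<kappa>_def)
  have "\<exists>h \<in> borel_measurable N. density N h = \<kappa>"
  proof (rule N.Radon_Nikodym_finite_measure)
    show "finite_measure \<kappa>"
      by standard (use em\<kappa>[of "space M"] sets_eq_imp_space_eq[OF \<kappa>_sets] in simp)
    show "absolutely_continuous N \<kappa>"
      unfolding absolutely_continuous_def
    proof
      fix A assume A: "A \<in> null_sets N"
      then have "A \<in> sets M" "measure N A = 0" by (auto simp: null_sets_def N_sets measure_def)
      then show "A \<in> null_sets \<kappa>"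
        using k_pos[of A] k_le[of A] em\<kappa>[of A] by (auto simp: null_sets_def \<kappa>_sets)
    qed
  qed (simp add: \<kappa>_sets N_sets)
  then obtain h where h[measurable]: "h \<in> borel_measurable N" and h_dens: "density N h = \<kappa>" by auto
  have int_h: "(\<integral>\<^sup>+x. h x * indicator A x \<partial>N) = ennreal (k A)" if "A \<in> sets M" for A
    using em\<kappa>[OF that] that by (simp add: h_dens[symmetric] emeasure_density N_sets)
  have h2: "AE x in N. h x \<le> 2"
  proof -
    define B where "B = {x\<in>space N. 2 < h x}"
    have B[measurable]: "B \<in> sets N" unfolding B_def by measurable
    have fin: "(\<integral>\<^sup>+x. 2 * indicator B x \<partial>N) \<noteq> \<infinity>"
      by (simp add: nn_integral_cmult_indicator ennreal_mult_eq_top_iff)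
    have "(\<integral>\<^sup>+x. h x * indicator B x - 2 * indicator B x \<partial>N)
        = (\<integral>\<^sup>+x. h x * indicator B x \<partial>N) - (\<integral>\<^sup>+x. 2 * indicator B x \<partial>N)"
      using fin by (intro nn_integral_diff AE_I2) (auto simp: B_def indicator_def less_imp_le)
    also have "(\<integral>\<^sup>+x. 2 * indicator B x \<partial>N) = ennreal (2 * measure N B)"
      by (simp add: nn_integral_cmult_indicator N.emeasure_eq_measure ennreal_mult)
    also have "(\<integral>\<^sup>+x. h x * indicator B x \<partial>N) - ennreal (2 * measure N B) = 0"
      using int_h[of B] k_le[of B] B by (simp add: N_sets diff_eq_0_iff_ennreal ennreal_leI)
    finally have "AE x in N. h x * indicator B x - 2 * indicator B x = 0"
      by (subst (asm) nn_integral_0_iff_AE) auto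
    from this AE_space show ?thesis
    proof eventually_elim
      case (elim x)
      show ?case
      proof (cases "x \<in> B")
        case True
        then have "h x - 2 = 0" "2 < h x" using elim by (auto simp: B_def)
        then show ?thesis by (metis diff_eq_0_iff_ennreal not_le)
      qed (use elim in \<open>auto simp: B_def not_less\<close>)
    qed
  qed
  \<comment> \<open>The truncation makes the bound by 1 hold everywhere; almost everywhere it
  changes nothing.\<close>
  define \<phi> where "\<phi> x = max (-1) (min 1 (enn2real (h x) - 1))" for x
  have \<phi>_meas[measurable]: "\<phi> \<in> borel_measurable N" unfolding \<phi>_def[abs_def] by measurable
  have \<phi>_bd: "\<bar>\<phi> x\<bar> \<le> 1" for x
    using enn2real_nonneg[of "h x"] by (auto simp: \<phi>_def max_def min_def abs_le_iff)
  have \<phi>_eq: "AE x in N. \<phi> x = enn2real (h x) - 1"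
    using h2
  proof eventually_elim
    case (elim x)
    then have "enn2real (h x) \<le> 2" by (intro enn2real_leI) auto
    then show ?case by (auto simp: \<phi>_def)
  qed
  have \<phi>_int: "integrable N (\<lambda>x. \<phi> x * g x)" if "integrable N g" for g :: "'x \<Rightarrow> real"
    by (rule Bochner_Integration.integrable_bound[OF that])
       (use \<phi>_bd that in \<open>auto simp: abs_mult mult_left_le_one_le\<close>)
  have base: "\<Lambda> (\<lambda>x. w x * indicator A x) = (\<integral>x. \<phi> x * indicator A x \<partial>N)" if A: "A \<in> sets N" for A
  proof -
    have [measurable]: "A \<in> sets N" by fact
    have iA: "integrable N (\<lambda>x. indicator A x :: real)"
      by (intro integrable_real_indicator) (auto simp: N.emeasure_eq_measure)
    have "(\<integral>x. enn2real (h x) * indicator A x \<partial>N) = enn2real (\<integral>\<^sup>+x. ennreal (enn2real (h x) * indicator A x) \<partial>N)"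
      by (intro integral_eq_nn_integral) auto
    also have "(\<integral>\<^sup>+x. ennreal (enn2real (h x) * indicator A x) \<partial>N) = (\<integral>\<^sup>+x. h x * indicator A x \<partial>N)"
    proof (rule nn_integral_cong_AE, use h2 in eventually_elim)
      fix x assume "h x \<le> 2"
      then have "h x < top" by (rule order_le_less_trans) simp
      then show "ennreal (enn2real (h x) * indicator A x) = h x * indicator A x"
        by (simp add: indicator_def)
    qed
    finally have hA: "(\<integral>x. enn2real (h x) * indicator A x \<partial>N) = k A"
      using int_h k_pos A by (simp add: N_sets)
    have "(\<integral>x. enn2real (h x) * indicator A x \<partial>N) = (\<integral>x. \<phi> x * indicator A x + indicator A x \<partial>N)"
    proof (rule integral_cong_AE)
      show "AE x in N. enn2real (h x) * indicator A x = \<phi> x * indicator A x + indicator A x"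
        using \<phi>_eq by eventually_elim (simp add: left_diff_distrib)
    qed measurable
    also have "\<dots> = (\<integral>x. \<phi> x * indicator A x \<partial>N) + measure N A"
      using iA \<phi>_int[OF iA] A by simp
    finally show ?thesis using hA by (simp add: k_def)
  qed
  have wg: "integrable M (\<lambda>x. w x * g x) \<longleftrightarrow> integrable N g" if [measurable]: "g \<in> borel_measurable M" for g :: "'x \<Rightarrow> real"
    unfolding N_def by (subst integrable_density) (auto simp: w_pos less_imp_le)
  have wg_int: "(\<integral>x. w x * g x \<partial>M) = (\<integral>x. g x \<partial>N)" if [measurable]: "g \<in> borel_measurable M" for g :: "'x \<Rightarrow> real"
    unfolding N_def by (subst integral_density) (auto simp: w_pos less_imp_le)
  have meas: "g \<in> borel_measurable M" if "integrable N g" for g :: "'x \<Rightarrow> real"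
    using borel_measurable_integrable[OF that] by (simp add: measurable_cong_sets[OF N_sets refl])
  have main: "\<Lambda> (\<lambda>x. w x * g x) = (\<integral>x. \<phi> x * g x \<partial>N)" if "integrable N g" for g
    using that
  proof (induction g rule: integrable_induct)
    case (base A c)
    have "\<Lambda> (\<lambda>x. w x * (indicator A x *\<^sub>R c)) = \<Lambda> (\<lambda>x. c * (w x * indicator A x))"
      by (simp add: mult_ac)
    also have "\<dots> = c * \<Lambda> (\<lambda>x. w x * indicator A x)"
      using base by (intro scale wA) (simp add: N_sets)
    finally show ?case using base \<open>\<And>A. A \<in> sets N \<Longrightarrow> \<Lambda> (\<lambda>x. w x * indicator A x) = (\<integral>x. \<phi> x * indicator A x \<partial>N)\<close>[of A]
      by (simp add: mult_ac flip: integral_mult_right_zero)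
  next
    case (add f g)
    have "integrable M (\<lambda>x. w x * f x)" "integrable M (\<lambda>x. w x * g x)"
      using add by (simp_all add: wg meas)
    then show ?case
      using add \<open>\<And>f g. integrable M f \<Longrightarrow> integrable M g \<Longrightarrow> \<Lambda> (\<lambda>x. f x + g x) = \<Lambda> f + \<Lambda> g\<close>[of "\<lambda>x. w x * f x" "\<lambda>x. w x * g x"]
        \<phi>_int[of f] \<phi>_int[of g]
      by (simp add: distrib_left)
  next
    case (lim f s)
    have [measurable]: "f \<in> borel_measurable N" "s i \<in> borel_measurable N" for i
      using lim by auto
    have wf: "integrable M (\<lambda>x. w x * f x)" "integrable M (\<lambda>x. w x * s i x)" for i
      using lim by (simp_all add: wg meas)
    have "(\<lambda>i. \<integral>x. \<bar>s i x - f x\<bar> \<partial>N) \<longlonglongrightarrow> (\<integral>x. 0 \<partial>N)"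
    proof (rule integral_dominated_convergence[where w = "\<lambda>x. 3 * \<bar>f x\<bar>"])
      show "integrable N (\<lambda>x. 3 * \<bar>f x\<bar>)" using lim by auto
      show "AE x in N. (\<lambda>i. \<bar>s i x - f x\<bar>) \<longlonglongrightarrow> 0"
        using lim by (auto intro!: tendsto_rabs_zero LIM_zero)
      show "AE x in N. norm \<bar>s i x - f x\<bar> \<le> 3 * \<bar>f x\<bar>" for i
        using lim by (intro AE_I2) (fastforce intro: order_trans[OF abs_triangle_ineq4])
    qed auto
    then have z: "(\<lambda>i. \<integral>x. \<bar>s i x - f x\<bar> \<partial>N) \<longlonglongrightarrow> 0" by simp
    have "\<bar>\<Lambda> (\<lambda>x. w x * s i x) - \<Lambda> (\<lambda>x. w x * f x)\<bar> \<le> (\<integral>x. \<bar>s i x - f x\<bar> \<partial>N)" for i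
    proof -
      have "\<Lambda> (\<lambda>x. w x * s i x) - \<Lambda> (\<lambda>x. w x * f x) = \<Lambda> (\<lambda>x. w x * s i x - w x * f x)"
        using diff[OF wf(2,1)] by simp
      also have "\<bar>\<dots>\<bar> \<le> (\<integral>x. \<bar>w x * s i x - w x * f x\<bar> \<partial>M)"
        using wf by (intro bound) auto
      also have "\<dots> = (\<integral>x. w x * \<bar>s i x - f x\<bar> \<partial>M)"
        using w_pos by (intro Bochner_Integration.integral_cong)
          (auto simp: right_diff_distrib[symmetric] abs_mult less_imp_le)
      also have "\<dots> = (\<integral>x. \<bar>s i x - f x\<bar> \<partial>N)" using lim by (intro wg_int) (auto intro: meas)
      finally show ?thesis .
    qed
    then have "(\<lambda>i. \<Lambda> (\<lambda>x. w x * s i x) - \<Lambda> (\<lambda>x. w x * f x)) \<longlonglongrightarrow> 0"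
      by (intro Lim_null_comparison[OF _ z] always_eventually) auto
    then have l1: "(\<lambda>i. \<Lambda> (\<lambda>x. w x * s i x)) \<longlonglongrightarrow> \<Lambda> (\<lambda>x. w x * f x)" by (rule LIM_zero_cancel)
    have l2: "(\<lambda>i. \<integral>x. \<phi> x * s i x \<partial>N) \<longlonglongrightarrow> (\<integral>x. \<phi> x * f x \<partial>N)"
    proof (rule integral_dominated_convergence[where w = "\<lambda>x. 2 * \<bar>f x\<bar>"])
      show "integrable N (\<lambda>x. 2 * \<bar>f x\<bar>)" using lim by auto
      show "AE x in N. (\<lambda>i. \<phi> x * s i x) \<longlonglongrightarrow> \<phi> x * f x"
        using lim by (auto intro!: tendsto_mult)
      show "AE x in N. norm (\<phi> x * s i x) \<le> 2 * \<bar>f x\<bar>" for i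
      proof (intro AE_I2)
        fix x assume "x \<in> space N"
        then have "\<bar>s i x\<bar> \<le> 2 * \<bar>f x\<bar>" using lim by auto
        then show "norm (\<phi> x * s i x) \<le> 2 * \<bar>f x\<bar>"
          using mult_mono[OF \<phi>_bd[of x], of "\<bar>s i x\<bar>" "2 * \<bar>f x\<bar>"] by (simp add: abs_mult)
      qed
    qed auto
    show ?case using LIMSEQ_unique[OF l1] l2 lim.IH by simp
  qed
  show ?thesis
  proof (rule that[of \<phi>])
    show "\<phi> \<in> borel_measurable M"
      using \<phi>_meas by (simp add: measurable_cong_sets[OF N_sets refl])
    then have [measurable]: "\<phi> \<in> borel_measurable M" .
    show "\<bar>\<phi> x\<bar> \<le> 1" for x by (rule \<phi>_bd)
    fix f :: "'x \<Rightarrow> real" assume f: "integrable M f"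
    then have [measurable]: "f \<in> borel_measurable M" by auto
    have eq: "w x * (f x / w x) = f x" for x using w_pos[of x] by simp
    have eq': "(\<lambda>x. w x * (f x / w x)) = f" by (rule ext) (rule eq)
    have "integrable N (\<lambda>x. f x / w x)"
      by (subst wg[symmetric]) (simp_all only: eq' f, measurable)
    from main[OF this] have "\<Lambda> f = (\<integral>x. \<phi> x * (f x / w x) \<partial>N)" by (simp only: eq')
    also have "\<dots> = (\<integral>x. w x * (\<phi> x * (f x / w x)) \<partial>M)" by (rule wg_int[symmetric]) measurable
    also have "\<dots> = (\<integral>x. \<phi> x * f x \<partial>M)"
      using w_pos by (intro Bochner_Integration.integral_cong) (auto simp: less_imp_neq[symmetric])
    finally show "\<Lambda> f = (\<integral>x. \<phi> x * f x \<partial>M)" .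
  qed
qed

section \<open>Square-integrable functions\<close>

lemma borel_measurable_cnj [measurable (raw)]:
  "f \<in> borel_measurable M \<Longrightarrow> (\<lambda>x. cnj (f x)) \<in> borel_measurable M"
  by (rule measurable_compose[OF _ borel_measurable_continuous_onI]) (auto intro: continuous_intros)

text \<open>
  Linear algebra is carried out on functions, where sums and multiples are pointwise;
  \<open>ip\<close> is the inner product and \<open>sqn\<close> the square of the norm. The
  passage to classes is made afterwards.
\<close>

definition sq_int :: "'x measure \<Rightarrow> ('x \<Rightarrow> complex) set" where
  "sq_int M = {f \<in> borel_measurable M. integrable M (\<lambda>x. (norm (f x))\<^sup>2)}"

definition ip :: "'x measure \<Rightarrow> ('x \<Rightarrow> complex) \<Rightarrow> ('x \<Rightarrow> complex) \<Rightarrow> complex" where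
  "ip M f g = (\<integral>x. f x * cnj (g x) \<partial>M)"

definition sqn :: "'x measure \<Rightarrow> ('x \<Rightarrow> complex) \<Rightarrow> real" where
  "sqn M f = (\<integral>x. (norm (f x))\<^sup>2 \<partial>M)"

lemma sq_intD: "f \<in> sq_int M \<Longrightarrow> f \<in> borel_measurable M"
  "f \<in> sq_int M \<Longrightarrow> integrable M (\<lambda>x. (norm (f x))\<^sup>2)"
  by (auto simp: sq_int_def)

lemma norm_add_sq_le: "(norm (a + b :: complex))\<^sup>2 \<le> 2 * (norm a)\<^sup>2 + 2 * (norm b)\<^sup>2"
proof -
  have "(norm (a + b))\<^sup>2 \<le> (norm a + norm b)\<^sup>2" by (intro power_mono norm_triangle_ineq) auto
  also have "\<dots> \<le> 2 * (norm a)\<^sup>2 + 2 * (norm b)\<^sup>2"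
    using sum_squares_bound[of "norm a" "norm b"] by (simp add: power2_sum)
  finally show ?thesis .
qed

lemma sq_int_add:
  assumes "f \<in> sq_int M" "g \<in> sq_int M"
  shows "(\<lambda>x. f x + g x) \<in> sq_int M"
proof -
  note [measurable] = sq_intD(1)[OF assms(1)] sq_intD(1)[OF assms(2)]
  have "integrable M (\<lambda>x. 2 * (norm (f x))\<^sup>2 + 2 * (norm (g x))\<^sup>2)"
    using sq_intD(2)[OF assms(1)] sq_intD(2)[OF assms(2)] by simp
  then have "integrable M (\<lambda>x. (norm (f x + g x))\<^sup>2)"
    by (rule Bochner_Integration.integrable_bound) (use norm_add_sq_le in auto)
  then show ?thesis by (simp add: sq_int_def)
qed

lemma sq_int_scale: "f \<in> sq_int M \<Longrightarrow> (\<lambda>x. c * f x) \<in> sq_int M"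
  by (auto simp: sq_int_def norm_mult power_mult_distrib)

lemma sq_int_diff: "f \<in> sq_int M \<Longrightarrow> g \<in> sq_int M \<Longrightarrow> (\<lambda>x. f x - g x) \<in> sq_int M"
  using sq_int_add[of f M "\<lambda>x. (-1) * g x"] sq_int_scale[of g M "-1"] by simp

lemma sq_int_zero: "(\<lambda>x. 0) \<in> sq_int M"
  by (simp add: sq_int_def)

lemma sq_int_sum: "(\<And>i. i \<in> I \<Longrightarrow> f i \<in> sq_int M) \<Longrightarrow> (\<lambda>x. \<Sum>i\<in>I. f i x) \<in> sq_int M"
  by (induction I rule: infinite_finite_induct) (auto simp: sq_int_zero intro: sq_int_add)

lemma sq_int_bounded_mult:
  assumes [measurable]: "\<phi> \<in> borel_measurable M" and b: "AE x in M. norm (\<phi> x) \<le> C" and f: "f \<in> sq_int M"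
  shows "(\<lambda>x. \<phi> x * f x) \<in> sq_int M"
proof -
  note [measurable] = sq_intD(1)[OF f]
  have "integrable M (\<lambda>x. C\<^sup>2 * (norm (f x))\<^sup>2)" using f by (auto dest: sq_intD)
  then have "integrable M (\<lambda>x. (norm (\<phi> x * f x))\<^sup>2)"
  proof (rule Bochner_Integration.integrable_bound)
    show "AE x in M. norm ((norm (\<phi> x * f x))\<^sup>2) \<le> norm (C\<^sup>2 * (norm (f x))\<^sup>2)"
      using b by eventually_elim (auto simp: norm_mult power_mult_distrib intro!: mult_right_mono power_mono)
  qed measurable
  then show ?thesis by (simp add: sq_int_def)
qed

lemma ip_integrable:
  assumes "f \<in> sq_int M" "g \<in> sq_int M"
  shows "integrable M (\<lambda>x. f x * cnj (g x))"
proof -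
  note [measurable] = sq_intD(1)[OF assms(1)] sq_intD(1)[OF assms(2)]
  have "integrable M (\<lambda>x. (norm (f x))\<^sup>2 + (norm (g x))\<^sup>2)"
    using sq_intD(2)[OF assms(1)] sq_intD(2)[OF assms(2)] by simp
  then show ?thesis
  proof (rule Bochner_Integration.integrable_bound)
    have "norm (f x * cnj (g x)) \<le> norm ((norm (f x))\<^sup>2 + (norm (g x))\<^sup>2)" for x
    proof -
      have "0 \<le> norm (f x) * norm (g x)" by simp
      then have "norm (f x) * norm (g x) \<le> (norm (f x))\<^sup>2 + (norm (g x))\<^sup>2"
        using sum_squares_bound[of "norm (f x)" "norm (g x)"] by linarith
      then show ?thesis by (simp add: norm_mult)
    qed
    then show "AE x in M. norm (f x * cnj (g x)) \<le> norm ((norm (f x))\<^sup>2 + (norm (g x))\<^sup>2)" by simp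
  qed measurable
qed

lemma ip_add_left:
  "f \<in> sq_int M \<Longrightarrow> g \<in> sq_int M \<Longrightarrow> h \<in> sq_int M \<Longrightarrow> ip M (\<lambda>x. f x + g x) h = ip M f h + ip M g h"
  unfolding ip_def by (simp add: distrib_right ip_integrable)

lemma ip_scale_left: "ip M (\<lambda>x. c * f x) h = c * ip M f h"
  unfolding ip_def by (simp add: mult.assoc)

lemma ip_cnj: "ip M g f = cnj (ip M f g)"
  unfolding ip_def by (subst Bochner_Integration.integral_cnj[symmetric]) (simp add: mult.commute)

lemma ip_diff_left:
  "f \<in> sq_int M \<Longrightarrow> g \<in> sq_int M \<Longrightarrow> h \<in> sq_int M \<Longrightarrow> ip M (\<lambda>x. f x - g x) h = ip M f h - ip M g h"
  unfolding ip_def by (simp add: left_diff_distrib ip_integrable)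

lemma ip_sum_left:
  assumes "\<And>i. i \<in> I \<Longrightarrow> f i \<in> sq_int M" "h \<in> sq_int M"
  shows "ip M (\<lambda>x. \<Sum>i\<in>I. f i x) h = (\<Sum>i\<in>I. ip M (f i) h)"
  unfolding ip_def using assms by (simp add: sum_distrib_right ip_integrable)

lemma ip_add_right:
  "f \<in> sq_int M \<Longrightarrow> g \<in> sq_int M \<Longrightarrow> h \<in> sq_int M \<Longrightarrow> ip M h (\<lambda>x. f x + g x) = ip M h f + ip M h g"
  by (subst (1 2 3) ip_cnj) (simp add: ip_add_left)

lemma ip_diff_right:
  "f \<in> sq_int M \<Longrightarrow> g \<in> sq_int M \<Longrightarrow> h \<in> sq_int M \<Longrightarrow> ip M h (\<lambda>x. f x - g x) = ip M h f - ip M h g"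
  by (subst (1 2 3) ip_cnj) (simp add: ip_diff_left)

lemma ip_scale_right: "ip M h (\<lambda>x. c * f x) = cnj c * ip M h f"
  by (subst (1 2) ip_cnj) (simp add: ip_scale_left)

lemma ip_self: "ip M f f = complex_of_real (sqn M f)"
  unfolding ip_def sqn_def by (simp only: complex_norm_square[symmetric] integral_complex_of_real)

lemma sqn_nonneg: "0 \<le> sqn M f"
  unfolding sqn_def by simp

lemma ip_cong_AE:
  assumes [measurable]: "f \<in> borel_measurable M" "f' \<in> borel_measurable M" "g \<in> borel_measurable M" "g' \<in> borel_measurable M"
    and "AE x in M. f x = f' x" "AE x in M. g x = g' x"
  shows "ip M f g = ip M f' g'"
  unfolding ip_def
proof (rule integral_cong_AE)
  show "AE x in M. f x * cnj (g x) = f' x * cnj (g' x)"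
    using assms(5,6) by eventually_elim simp
qed measurable

lemma sqn_cong_AE:
  assumes [measurable]: "f \<in> borel_measurable M" "f' \<in> borel_measurable M" and "AE x in M. f x = f' x"
  shows "sqn M f = sqn M f'"
  unfolding sqn_def using assms(3) by (intro integral_cong_AE) auto

lemma sqn_eq_0_iff: "f \<in> sq_int M \<Longrightarrow> sqn M f = 0 \<longleftrightarrow> (AE x in M. f x = 0)"
  unfolding sqn_def by (subst integral_nonneg_eq_0_iff_AE) (auto dest: sq_intD)

lemma sqn_scale: "sqn M (\<lambda>x. c * f x) = (norm c)\<^sup>2 * sqn M f"
  by (simp add: sqn_def norm_mult power_mult_distrib)

lemma sqn_add:
  assumes "f \<in> sq_int M" "g \<in> sq_int M"
  shows "sqn M (\<lambda>x. f x + g x) = sqn M f + sqn M g + 2 * Re (ip M f g)"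
proof -
  have "complex_of_real (sqn M (\<lambda>x. f x + g x)) = ip M f f + ip M g g + (ip M f g + ip M g f)"
    unfolding ip_self[symmetric] using assms by (simp add: ip_add_left ip_add_right sq_int_add)
  also have "ip M f g + ip M g f = complex_of_real (2 * Re (ip M f g))"
    by (subst (2) ip_cnj) (simp add: complex_add_cnj)
  also have "ip M f f + ip M g g + complex_of_real (2 * Re (ip M f g))
      = complex_of_real (sqn M f + sqn M g + 2 * Re (ip M f g))"
    by (simp add: ip_self)
  finally show ?thesis by (simp only: of_real_eq_iff)
qed

lemma sqn_diff:
  assumes "f \<in> sq_int M" "g \<in> sq_int M"
  shows "sqn M (\<lambda>x. f x - g x) = sqn M f + sqn M g - 2 * Re (ip M f g)"
  using sqn_add[OF assms(1) sq_int_scale[OF assms(2), of "-1"]] sqn_scale[of M "-1" g]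
  by (simp add: ip_scale_right[of M f "-1" g, simplified])

lemma ip_Cauchy_Schwarz_sq:
  assumes f: "f \<in> sq_int M" and g: "g \<in> sq_int M"
  shows "(norm (ip M f g))\<^sup>2 \<le> sqn M f * sqn M g"
proof (cases "sqn M g = 0")
  case True
  then have "AE x in M. g x = 0" using sqn_eq_0_iff[OF g] by simp
  then have "ip M f g = ip M f (\<lambda>x. 0)"
    using f g by (intro ip_cong_AE) (auto dest: sq_intD)
  then show ?thesis using True by (simp add: ip_def)
next
  case False
  then have pos: "sqn M g > 0" using sqn_nonneg[of M g] by simp
  define c where "c = ip M f g / sqn M g"
  have "0 \<le> sqn M (\<lambda>x. f x - c * g x)" by (rule sqn_nonneg)
  also have "\<dots> = sqn M f + (norm c)\<^sup>2 * sqn M g - 2 * Re (cnj c * ip M f g)"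
    using f g by (simp add: sqn_diff sq_int_scale sqn_scale ip_scale_right)
  also have "(norm c)\<^sup>2 * sqn M g = (norm (ip M f g))\<^sup>2 / sqn M g"
    using pos by (simp add: c_def norm_divide power_divide power2_eq_square)
  also have "cnj c * ip M f g = complex_of_real ((norm (ip M f g))\<^sup>2 / sqn M g)"
    by (simp add: c_def mult.commute) (use complex_norm_square[of "ip M f g"] in simp)
  finally have "0 \<le> sqn M f - (norm (ip M f g))\<^sup>2 / sqn M g" by simp
  then show ?thesis using pos by (simp add: field_simps)
qed

lemma ip_Cauchy_Schwarz:
  assumes "f \<in> sq_int M" "g \<in> sq_int M"
  shows "norm (ip M f g) \<le> sqrt (sqn M f) * sqrt (sqn M g)"
  using real_le_rsqrt[OF ip_Cauchy_Schwarz_sq[OF assms]] by (simp add: real_sqrt_mult)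

lemma sqn_triangle:
  assumes "f \<in> sq_int M" "g \<in> sq_int M"
  shows "sqrt (sqn M (\<lambda>x. f x + g x)) \<le> sqrt (sqn M f) + sqrt (sqn M g)"
proof (rule real_le_lsqrt)
  have "Re (ip M f g) \<le> sqrt (sqn M f) * sqrt (sqn M g)"
    using complex_Re_le_cmod ip_Cauchy_Schwarz[OF assms] by (rule order_trans)
  then show "sqn M (\<lambda>x. f x + g x) \<le> (sqrt (sqn M f) + sqrt (sqn M g))\<^sup>2"
    using sqn_nonneg[of M f] sqn_nonneg[of M g] by (simp add: sqn_add[OF assms] power2_sum)
qed (auto simp: sqn_nonneg)

lemma sqn_nn_integral:
  assumes "f \<in> sq_int M"
  shows "(\<integral>\<^sup>+x. ennreal ((norm (f x))\<^sup>2) \<partial>M) = ennreal (sqn M f)"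
  unfolding sqn_def using assms by (intro nn_integral_eq_integral) (auto dest: sq_intD)

lemma quarter_power: "(1/4::real) ^ n = ((1/2) ^ n)\<^sup>2"
proof -
  have "((1/2::real) ^ n)\<^sup>2 = ((1/2)\<^sup>2) ^ n" by (simp only: power_mult[symmetric] mult.commute)
  also have "(1/2::real)\<^sup>2 = 1/4" by (simp add: power2_eq_square)
  finally show ?thesis by simp
qed

lemma summable_on_nonneg_le:
  fixes f g :: "'a \<Rightarrow> real"
  assumes "g summable_on A" "\<And>x. x \<in> A \<Longrightarrow> 0 \<le> f x" "\<And>x. x \<in> A \<Longrightarrow> f x \<le> g x"
  shows "f summable_on A"
proof -
  have g0: "0 \<le> g x" if "x \<in> A" for x using assms(2,3)[OF that] by simp
  have "sum f F \<le> infsum g A" if F: "F \<subseteq> A" "finite F" for F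
  proof -
    have "sum f F \<le> sum g F" using F assms(3) by (intro sum_mono) auto
    also have "\<dots> \<le> infsum g A" using F g0 by (intro finite_sum_le_infsum assms(1)) auto
    finally show ?thesis .
  qed
  then show ?thesis
    by (intro nonneg_bdd_above_summable_on bdd_aboveI[of _ "infsum g A"]) (auto simp: assms(2))
qed

lemma has_sum_finite_sum:
  fixes f :: "'j \<Rightarrow> 'a \<Rightarrow> real"
  assumes "finite J" "\<And>j. j \<in> J \<Longrightarrow> (f j has_sum s j) A"
  shows "((\<lambda>x. \<Sum>j\<in>J. f j x) has_sum (\<Sum>j\<in>J. s j)) A"
  using assms by (induction J rule: finite_induct) (auto intro: has_sum_add)

text \<open>
  Since \<open>\<Sum>n. 2\<^sup>n (d n)\<^sup>2\<close> has a finite integral, the increments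
  \<open>d n\<close> decrease geometrically almost everywhere, so the sequence converges
  pointwise; Fatou's lemma turns this into convergence in norm.
\<close>

theorem sq_int_complete:
  assumes p: "\<And>n. p n \<in> sq_int M" and cauchy: "\<And>n. sqn M (\<lambda>x. p (Suc n) x - p n x) \<le> (1/4) ^ n"
  obtains f where "f \<in> sq_int M" "(\<lambda>n. sqn M (\<lambda>x. p n x - f x)) \<longlonglongrightarrow> 0"
proof -
  note [measurable] = sq_intD(1)[OF p]
  define d where "d n x = norm (p (Suc n) x - p n x)" for n x
  have [measurable]: "d n \<in> borel_measurable M" for n unfolding d_def by measurable
  have "(\<integral>\<^sup>+x. (\<Sum>n. ennreal (2 ^ n * (d n x)\<^sup>2)) \<partial>M) = (\<Sum>n. \<integral>\<^sup>+x. ennreal (2 ^ n * (d n x)\<^sup>2) \<partial>M)"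
    by (rule nn_integral_suminf) measurable
  also have "\<dots> \<le> (\<Sum>n. ennreal ((1/2) ^ n))"
  proof (rule suminf_le)
    fix n
    have "(\<integral>\<^sup>+x. ennreal (2 ^ n * (d n x)\<^sup>2) \<partial>M) = ennreal (2 ^ n) * ennreal (sqn M (\<lambda>x. p (Suc n) x - p n x))"
      unfolding d_def by (simp add: ennreal_mult nn_integral_cmult sqn_nn_integral sq_int_diff p)
    also have "\<dots> \<le> ennreal (2 ^ n * (1/4) ^ n)"
      using cauchy[of n] sqn_nonneg 
      by (subst ennreal_mult[symmetric]) (auto simp: sqn_nonneg intro!: ennreal_leI mult_left_mono)
    also have "(2::real) ^ n * (1/4) ^ n = (1/2) ^ n" by (simp flip: power_mult_distrib)
    finally show "(\<integral>\<^sup>+x. ennreal (2 ^ n * (d n x)\<^sup>2) \<partial>M) \<le> ennreal ((1/2) ^ n)" .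
  qed auto
  also have "\<dots> < \<infinity>"
    by (subst suminf_ennreal2) (auto simp: summable_geometric)
  finally have "AE x in M. (\<Sum>n. ennreal (2 ^ n * (d n x)\<^sup>2)) \<noteq> \<infinity>"
    by (intro nn_integral_PInf_AE) auto
  then have conv: "AE x in M. convergent (\<lambda>n. p n x)"
  proof eventually_elim
    case (elim x)
    then have "summable (\<lambda>n. 2 ^ n * (d n x)\<^sup>2)"
      by (intro summable_suminf_not_top) auto
    then have "Bseq (\<lambda>n. 2 ^ n * (d n x)\<^sup>2)"
      by (intro convergent_imp_Bseq convergentI[OF summable_LIMSEQ_zero])
    then obtain K where K: "K > 0" "\<And>n. 2 ^ n * (d n x)\<^sup>2 \<le> K"
      by (force simp: Bseq_def abs_le_iff)
    have "d n x \<le> sqrt K * sqrt (1/2) ^ n" for n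
    proof -
      have "(d n x)\<^sup>2 \<le> K * (1/2) ^ n" using K(2)[of n] by (simp add: field_simps)
      then have "d n x \<le> sqrt (K * (1/2) ^ n)" by (rule real_le_rsqrt)
      then show ?thesis by (simp add: real_sqrt_mult real_sqrt_power)
    qed
    then have bd: "norm (p (Suc n) x - p n x) \<le> sqrt K * sqrt (1/2) ^ n" for n
      by (simp only: d_def)
    have "norm (sqrt (1/2)) < 1" by (simp add: real_less_lsqrt real_sqrt_divide)
    then have "summable (\<lambda>n. sqrt K * sqrt (1/2) ^ n)"
      by (intro summable_mult summable_geometric)
    from this bd have "summable (\<lambda>n. p (Suc n) x - p n x)"
      by (rule summable_comparison_test')
    then have "convergent (\<lambda>n. \<Sum>i<n. p (Suc i) x - p i x)"
      by (simp add: summable_iff_convergent)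
    then have "convergent (\<lambda>n. p n x - p 0 x)" using sum_lessThan_telescope[of "\<lambda>n. p n x"] by simp
    from convergent_add[OF this convergent_const[of "p 0 x"]] show ?case by simp
  qed
  define f where "f x = lim (\<lambda>n. p n x)" for x
  have [measurable]: "f \<in> borel_measurable M" unfolding f_def by measurable
  have lim: "AE x in M. (\<lambda>n. p n x) \<longlonglongrightarrow> f x"
    using conv by eventually_elim (simp add: f_def convergent_LIMSEQ_iff)
  have step: "sqrt (sqn M (\<lambda>x. p (Suc n) x - p n x)) \<le> (1/2) ^ n" for n
  proof -
    have "sqrt (sqn M (\<lambda>x. p (Suc n) x - p n x)) \<le> sqrt ((1/4) ^ n)"
      using cauchy by simp
    also have "(1/4::real) ^ n = ((1/2) ^ n)\<^sup>2" by (rule quarter_power)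
    finally show ?thesis by simp
  qed
  \<comment> \<open>The factor \<open>1 - (1/2)^m\<close> makes the geometric series close up
  under induction; afterwards it is dropped.\<close>
  have far: "sqrt (sqn M (\<lambda>x. p (n + m) x - p n x)) \<le> 2 * (1/2) ^ n * (1 - (1/2) ^ m)" for n m
  proof (induction m)
    case 0 then show ?case by (simp add: sqn_def)
  next
    case (Suc m)
    have "(\<lambda>x. p (n + Suc m) x - p n x) = (\<lambda>x. (p (Suc (n + m)) x - p (n + m) x) + (p (n + m) x - p n x))"
      by auto
    then have "sqrt (sqn M (\<lambda>x. p (n + Suc m) x - p n x))
        \<le> sqrt (sqn M (\<lambda>x. p (Suc (n + m)) x - p (n + m) x)) + sqrt (sqn M (\<lambda>x. p (n + m) x - p n x))"
      by (simp only:) (intro sqn_triangle sq_int_diff p)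
    also have "\<dots> \<le> (1/2) ^ (n + m) + 2 * (1/2) ^ n * (1 - (1/2) ^ m)"
      by (intro add_mono step Suc)
    finally show ?case by (simp add: algebra_simps power_add)
  qed
  have far2: "sqn M (\<lambda>x. p (n + m) x - p n x) \<le> 4 * (1/4) ^ n" for n m
  proof -
    have "2 * (1/2::real) ^ n * (1 - (1/2) ^ m) \<le> 2 * (1/2) ^ n * 1" by (rule mult_left_mono) auto
    then have "sqrt (sqn M (\<lambda>x. p (n + m) x - p n x)) \<le> 2 * (1/2) ^ n"
      using far[of n m] by linarith
    then have "sqn M (\<lambda>x. p (n + m) x - p n x) \<le> (2 * (1/2) ^ n)\<^sup>2"
      by (rule sqrt_le_D)
    then show ?thesis by (simp add: quarter_power power_mult_distrib)
  qed
  have lim_bd: "(\<integral>\<^sup>+x. ennreal ((norm (p n x - f x))\<^sup>2) \<partial>M) \<le> ennreal (4 * (1/4) ^ n)" for n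
  proof -
    have "(\<integral>\<^sup>+x. ennreal ((norm (p n x - f x))\<^sup>2) \<partial>M)
        = (\<integral>\<^sup>+x. liminf (\<lambda>m. ennreal ((norm (p (n + m) x - p n x))\<^sup>2)) \<partial>M)"
    proof (rule nn_integral_cong_AE, use lim in eventually_elim)
      case (elim x)
      then have "(\<lambda>m. p (n + m) x) \<longlonglongrightarrow> f x"
        using LIMSEQ_ignore_initial_segment[of "\<lambda>m. p m x" "f x" n] by (simp add: add.commute)
      then have "(\<lambda>m. ennreal ((norm (p (n + m) x - p n x))\<^sup>2)) \<longlonglongrightarrow> ennreal ((norm (f x - p n x))\<^sup>2)"
        by (intro tendsto_intros)
      from lim_imp_Liminf[OF _ this] show ?case
        by (simp add: norm_minus_commute[of "p n x" "f x"])
    qed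
    also have "\<dots> \<le> liminf (\<lambda>m. \<integral>\<^sup>+x. ennreal ((norm (p (n + m) x - p n x))\<^sup>2) \<partial>M)"
      by (rule nn_integral_liminf) measurable
    also have "\<dots> \<le> liminf (\<lambda>m. ennreal (4 * (1/4) ^ n))"
      by (intro Liminf_mono always_eventually allI)
         (simp add: sqn_nn_integral sq_int_diff p far2 ennreal_leI)
    finally show ?thesis by (simp add: Liminf_const)
  qed
  have sq: "(\<lambda>x. p n x - f x) \<in> sq_int M" for n
    using lim_bd[of n] by (auto simp: sq_int_def integrable_iff_bounded intro: order_le_less_trans)
  show ?thesis
  proof (rule that[of f])
    show "f \<in> sq_int M" using sq_int_diff[OF p[of 0] sq[of 0]] by simp
    have upper: "sqn M (\<lambda>x. p n x - f x) \<le> 4 * (1/4) ^ n" for n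
      using lim_bd[of n] by (simp add: sqn_nn_integral[OF sq])
    have lim4: "(\<lambda>n. 4 * (1/4::real) ^ n) \<longlonglongrightarrow> 0"
      using tendsto_mult[OF tendsto_const LIMSEQ_power_zero[of "1/4::real"], of 4] by simp
    show "(\<lambda>n. sqn M (\<lambda>x. p n x - f x)) \<longlonglongrightarrow> 0"
      by (rule tendsto_sandwich[OF _ _ tendsto_const lim4]) (simp_all add: sqn_nonneg upper)
  qed
qed

section \<open>Orthonormal bases and Hilbert-Schmidt sums\<close>

text \<open>
  The basis is a family of functions indexed by \<open>B\<close>, because later the indices
  are the basis vectors themselves, as classes, and \<open>e\<close> picks a function from
  each class.
\<close>

locale L2_orthonormal_basis =
  fixes M :: "'x measure" and B :: "'b set" and e :: "'b \<Rightarrow> 'x \<Rightarrow> complex"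
  assumes e_sq: "\<And>b. b \<in> B \<Longrightarrow> e b \<in> sq_int M"
    and e_ip: "\<And>b c. b \<in> B \<Longrightarrow> c \<in> B \<Longrightarrow> ip M (e b) (e c) = (if b = c then 1 else 0)"
    and total: "\<And>f. f \<in> sq_int M \<Longrightarrow> (\<And>b. b \<in> B \<Longrightarrow> ip M f (e b) = 0) \<Longrightarrow> sqn M f = 0"
begin

definition coef :: "('x \<Rightarrow> complex) \<Rightarrow> 'b \<Rightarrow> complex" where
  "coef f b = ip M f (e b)"

definition proj :: "'b set \<Rightarrow> ('x \<Rightarrow> complex) \<Rightarrow> 'x \<Rightarrow> complex" where
  "proj F f = (\<lambda>x. \<Sum>b\<in>F. coef f b * e b x)"

lemma proj_sq: "F \<subseteq> B \<Longrightarrow> proj F f \<in> sq_int M"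
  unfolding proj_def by (intro sq_int_sum sq_int_scale e_sq) auto

lemma ip_proj_left:
  assumes "F \<subseteq> B" "h \<in> sq_int M"
  shows "ip M (proj F f) h = (\<Sum>b\<in>F. coef f b * cnj (coef h b))"
proof -
  have "ip M (proj F f) h = (\<Sum>b\<in>F. coef f b * ip M (e b) h)"
    unfolding proj_def using assms e_sq
    by (subst ip_sum_left) (auto simp: ip_scale_left intro!: sq_int_scale)
  then show ?thesis by (simp add: coef_def ip_cnj[of M "e _" h])
qed

lemma coef_proj:
  assumes "finite F" "F \<subseteq> B" "b \<in> B"
  shows "coef (proj F f) b = (if b \<in> F then coef f b else 0)"
proof -
  have "coef (proj F f) b = (\<Sum>c\<in>F. coef f c * cnj (coef (e b) c))"
    unfolding coef_def[of "proj F f"] by (rule ip_proj_left[OF assms(2) e_sq[OF assms(3)]])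
  also have "\<dots> = (\<Sum>c\<in>F. if c = b then coef f c else 0)"
    using assms by (intro sum.cong) (auto simp: coef_def e_ip)
  finally show ?thesis using assms by simp
qed

lemma sqn_proj:
  assumes "finite F" "F \<subseteq> B"
  shows "sqn M (proj F f) = (\<Sum>b\<in>F. (norm (coef f b))\<^sup>2)"
proof -
  have "complex_of_real (sqn M (proj F f)) = (\<Sum>b\<in>F. coef f b * cnj (coef (proj F f) b))"
    unfolding ip_self[symmetric] by (rule ip_proj_left[OF assms(2) proj_sq[OF assms(2)]])
  also have "\<dots> = (\<Sum>b\<in>F. complex_of_real ((norm (coef f b))\<^sup>2))"
    using assms by (intro sum.cong) (auto simp: coef_proj subset_iff complex_norm_square simp del: of_real_power)
  finally show ?thesis by (simp only: of_real_sum[symmetric] of_real_eq_iff)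
qed

lemma sqn_diff_proj:
  assumes "finite F" "F \<subseteq> B" "f \<in> sq_int M"
  shows "sqn M (\<lambda>x. f x - proj F f x) = sqn M f - (\<Sum>b\<in>F. (norm (coef f b))\<^sup>2)"
proof -
  have "ip M f (proj F f) = cnj (\<Sum>b\<in>F. coef f b * cnj (coef f b))"
    by (subst ip_cnj) (simp add: ip_proj_left[OF assms(2,3)])
  also have "\<dots> = complex_of_real (\<Sum>b\<in>F. (norm (coef f b))\<^sup>2)"
    by (simp add: complex_norm_square mult.commute del: of_real_power)
  finally show ?thesis
    using assms by (simp add: sqn_diff proj_sq sqn_proj)
qed

lemma Bessel:
  assumes "finite F" "F \<subseteq> B" "f \<in> sq_int M"
  shows "(\<Sum>b\<in>F. (norm (coef f b))\<^sup>2) \<le> sqn M f"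
  using sqn_diff_proj[OF assms] sqn_nonneg[of M "\<lambda>x. f x - proj F f x"] by simp

text \<open>
  The partial sums over suitable finite sets \<open>F n\<close> form a Cauchy sequence of
  projections of \<open>f\<close>. Its limit has the same coefficients as \<open>f\<close>, so
  by totality it is \<open>f\<close>, and the norms of the projections converge to that of
  \<open>f\<close>.
\<close>

theorem Parseval:
  assumes f: "f \<in> sq_int M"
  shows "((\<lambda>b. (norm (coef f b))\<^sup>2) has_sum sqn M f) B"
proof -
  let ?s = "\<lambda>F. \<Sum>b\<in>F. (norm (coef f b))\<^sup>2"
  let ?\<F> = "{F. finite F \<and> F \<subseteq> B}"
  have bdd: "bdd_above (?s ` ?\<F>)" using Bessel[OF _ _ f] by (auto intro!: bdd_aboveI)
  define S where "S = (SUP F\<in>?\<F>. ?s F)"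
  have hs: "((\<lambda>b. (norm (coef f b))\<^sup>2) has_sum S) B"
    unfolding S_def using bdd by (intro nonneg_bdd_above_has_sum) (auto simp: conj_commute)
  have le_S: "?s F \<le> S" if "finite F" "F \<subseteq> B" for F
    unfolding S_def using that by (intro cSUP_upper bdd) auto
  have "\<exists>F. finite F \<and> F \<subseteq> B \<and> S - (1/4) ^ n < ?s F" for n
  proof -
    have "S - (1/4) ^ n < S" by simp
    then show ?thesis unfolding S_def by (subst (asm) less_cSUP_iff) (use bdd in auto)
  qed
  then obtain G where G: "\<And>n. finite (G n)" "\<And>n. G n \<subseteq> B" "\<And>n. S - (1/4) ^ n < ?s (G n)" by metis
  define F where "F n = (\<Union>k\<le>n. G k)" for n
  have F: "finite (F n)" "F n \<subseteq> B" "F n \<subseteq> F (Suc n)" for n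
    using G unfolding F_def by (auto simp: atMost_Suc)
  have F_big: "S - (1/4) ^ n < ?s (F n)" for n
    using G(3)[of n] sum_mono2[of "F n" "G n" "\<lambda>b. (norm (coef f b))\<^sup>2"] F by (force simp: F_def)
  \<comment> \<open>\<open>F n\<close> already accounts for all but \<open>(1/4)^n\<close> of
  the sum, so little is left outside it.\<close>
  have outside: "?s H \<le> (1/4) ^ n" if "finite H" "H \<subseteq> B" "H \<inter> F n = {}" for H n
    using le_S[of "H \<union> F n"] F_big[of n] F(1,2)[of n] that by (simp add: sum.union_disjoint)
  have "(\<lambda>x. proj (F (Suc n)) f x - proj (F n) f x) = proj (F (Suc n) - F n) f" for n
    using F[of n] F(1)[of "Suc n"] by (auto simp: proj_def sum_diff)
  note step = this
  have "sqn M (\<lambda>x. proj (F (Suc n)) f x - proj (F n) f x) \<le> (1/4) ^ n" for n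
  proof -
    have D: "finite (F (Suc n) - F n)" "F (Suc n) - F n \<subseteq> B" "(F (Suc n) - F n) \<inter> F n = {}"
      using F(1,2)[of "Suc n"] by auto
    show ?thesis using outside[OF D] by (simp add: step sqn_proj[OF D(1,2)])
  qed
  from sq_int_complete[OF proj_sq[OF F(2)] this]
  obtain p where p: "p \<in> sq_int M" and lim: "(\<lambda>n. sqn M (\<lambda>x. proj (F n) f x - p x)) \<longlonglongrightarrow> 0" by blast
  have lim': "(\<lambda>n. sqrt (sqn M (\<lambda>x. proj (F n) f x - p x))) \<longlonglongrightarrow> 0"
    using tendsto_real_sqrt[OF lim] by simp
  have "coef (\<lambda>x. f x - p x) b = 0" if b: "b \<in> B" for b
  proof -
    have "norm (coef (\<lambda>x. f x - p x) b) \<le> (1/2) ^ n + sqrt (sqn M (\<lambda>x. proj (F n) f x - p x))" for n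
    proof -
      have pr: "proj (F n) f \<in> sq_int M" using proj_sq[OF F(2)] .
      have "(\<lambda>x. f x - p x) = (\<lambda>x. (f x - proj (F n) f x) + (proj (F n) f x - p x))" by auto
      then have "coef (\<lambda>x. f x - p x) b
          = (coef f b - coef (proj (F n) f) b) + ip M (\<lambda>x. proj (F n) f x - p x) (e b)"
        using f p pr e_sq[OF b] by (simp add: coef_def ip_add_left ip_diff_left sq_int_diff)
      then have "norm (coef (\<lambda>x. f x - p x) b)
          \<le> norm (coef f b - coef (proj (F n) f) b) + norm (ip M (\<lambda>x. proj (F n) f x - p x) (e b))"
        by (simp add: norm_triangle_ineq)
      also have "norm (coef f b - coef (proj (F n) f) b) \<le> (1/2) ^ n"
      proof (cases "b \<in> F n")
        case True then show ?thesis using F b by (simp add: coef_proj)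
      next
        case False
        have "(norm (coef f b))\<^sup>2 \<le> ((1/2) ^ n)\<^sup>2"
          using outside[of "{b}" n] False b by (simp add: quarter_power)
        then have "norm (coef f b) \<le> (1/2) ^ n" by (rule power2_le_imp_le) simp
        then show ?thesis using False F b by (simp add: coef_proj)
      qed
      also have "norm (ip M (\<lambda>x. proj (F n) f x - p x) (e b)) \<le> sqrt (sqn M (\<lambda>x. proj (F n) f x - p x)) * sqrt (sqn M (e b))"
        using pr p e_sq[OF b] by (intro ip_Cauchy_Schwarz sq_int_diff)
      also have "sqn M (e b) = 1"
        using e_ip[OF b b] ip_self[of M "e b"] by simp
      finally show ?thesis by simp
    qed
    moreover have "(\<lambda>n. (1/2) ^ n + sqrt (sqn M (\<lambda>x. proj (F n) f x - p x))) \<longlonglongrightarrow> 0 + 0"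
      by (intro tendsto_add lim' LIMSEQ_power_zero) simp
    ultimately have "norm (coef (\<lambda>x. f x - p x) b) \<le> 0 + 0"
      by (intro LIMSEQ_le_const) auto
    then show ?thesis by simp
  qed
  then have z: "sqn M (\<lambda>x. f x - p x) = 0"
    using f p by (intro total sq_int_diff) (auto simp: coef_def)
  have "sqn M f - S \<le> sqn M (\<lambda>x. proj (F n) f x - p x)" for n
  proof -
    have pr: "proj (F n) f \<in> sq_int M" using proj_sq[OF F(2)] .
    have "(\<lambda>x. f x - proj (F n) f x) = (\<lambda>x. (f x - p x) + (p x - proj (F n) f x))" by auto
    then have "sqrt (sqn M (\<lambda>x. f x - proj (F n) f x)) \<le> sqrt (sqn M (\<lambda>x. f x - p x)) + sqrt (sqn M (\<lambda>x. p x - proj (F n) f x))"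
      using f p pr by (simp only:) (intro sqn_triangle sq_int_diff)
    moreover have "sqn M (\<lambda>x. p x - proj (F n) f x) = sqn M (\<lambda>x. proj (F n) f x - p x)"
      by (simp add: sqn_def norm_minus_commute)
    ultimately have "sqn M (\<lambda>x. f x - proj (F n) f x) \<le> sqn M (\<lambda>x. proj (F n) f x - p x)"
      using z by simp
    then show ?thesis using sqn_diff_proj[OF F(1,2) f, of n] le_S[OF F(1,2), of n] by simp
  qed
  then have "sqn M f - S \<le> 0" by (intro LIMSEQ_le_const[OF lim]) auto
  moreover have "S \<le> sqn M f"
    using Bessel[OF _ _ f] by (intro has_sum_le_finite_sums[OF hs])
  ultimately show ?thesis using hs by simp
qed

lemma proj_approx:
  assumes f: "f \<in> sq_int M" and "0 < \<epsilon>"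
  obtains F where "finite F" "F \<subseteq> B" "sqrt (sqn M (\<lambda>x. f x - proj F f x)) < \<epsilon>"
proof -
  have "\<exists>F. finite F \<and> F \<subseteq> B \<and> sqn M f - \<epsilon>\<^sup>2 < (\<Sum>b\<in>F. (norm (coef f b))\<^sup>2)"
  proof (rule ccontr)
    assume "\<not> ?thesis"
    then have "sqn M f \<le> sqn M f - \<epsilon>\<^sup>2"
      by (intro has_sum_le_finite_sums[OF Parseval[OF f]]) (auto simp: not_less)
    then show False using assms(2) by simp
  qed
  then obtain F where F: "finite F" "F \<subseteq> B" "sqn M f - \<epsilon>\<^sup>2 < (\<Sum>b\<in>F. (norm (coef f b))\<^sup>2)" by blast
  then have "sqn M (\<lambda>x. f x - proj F f x) < \<epsilon>\<^sup>2" using sqn_diff_proj[OF F(1,2) f] by simp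
  then have "sqrt (sqn M (\<lambda>x. f x - proj F f x)) < \<epsilon>" using assms(2) by (intro real_less_lsqrt) auto
  with F show ?thesis by (intro that)
qed

end

text \<open>
  Bounded linear maps of \<open>L\<^sup>2\<close>, described on functions; linearity can
  therefore only be asked for up to null sets.
\<close>

definition bounded_op :: "'x measure \<Rightarrow> (('x \<Rightarrow> complex) \<Rightarrow> 'x \<Rightarrow> complex) \<Rightarrow> bool" where
  "bounded_op M R \<longleftrightarrow>
     (\<forall>f\<in>sq_int M. R f \<in> sq_int M) \<and>
     (\<forall>f\<in>sq_int M. \<forall>g\<in>sq_int M. AE x in M. R (\<lambda>x. f x + g x) x = R f x + R g x) \<and>
     (\<forall>c. \<forall>f\<in>sq_int M. AE x in M. R (\<lambda>x. c * f x) x = c * R f x) \<and>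
     (\<exists>C\<ge>0. \<forall>f\<in>sq_int M. sqrt (sqn M (R f)) \<le> C * sqrt (sqn M f))"

lemma bounded_opD:
  assumes "bounded_op M R"
  shows "f \<in> sq_int M \<Longrightarrow> R f \<in> sq_int M"
    and "f \<in> sq_int M \<Longrightarrow> g \<in> sq_int M \<Longrightarrow> AE x in M. R (\<lambda>x. f x + g x) x = R f x + R g x"
    and "f \<in> sq_int M \<Longrightarrow> AE x in M. R (\<lambda>x. c * f x) x = c * R f x"
  using assms by (auto simp: bounded_op_def)

lemma bounded_op_sum:
  assumes R: "bounded_op M R" and "finite F" and v: "\<And>b. b \<in> F \<Longrightarrow> v b \<in> sq_int M"
  shows "AE x in M. R (\<lambda>x. \<Sum>b\<in>F. c b * v b x) x = (\<Sum>b\<in>F. c b * R (v b) x)"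
  using assms(2) v
proof (induction F rule: finite_induct)
  case empty
  from bounded_opD(3)[OF R sq_int_zero, of 0] show ?case by simp
next
  case (insert b F)
  have vb: "v b \<in> sq_int M" and vF: "\<And>i. i \<in> F \<Longrightarrow> v i \<in> sq_int M" using insert.prems by auto
  have "(\<lambda>x. \<Sum>b\<in>F. c b * v b x) \<in> sq_int M" using vF by (intro sq_int_sum sq_int_scale)
  note sum_sq = this
  have IH: "AE x in M. R (\<lambda>x. \<Sum>b\<in>F. c b * v b x) x = (\<Sum>b\<in>F. c b * R (v b) x)"
    by (rule insert.IH) (rule vF)
  from bounded_opD(2)[OF R sq_int_scale[OF vb, of "c b"] sum_sq] bounded_opD(3)[OF R vb, of "c b"] IH
  show ?case
  proof eventually_elim
    case (elim x)
    then show ?case using insert(1,2) by simp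
  qed
qed

lemma ip_cong_AE_left:
  assumes "f \<in> sq_int M" "f' \<in> sq_int M" "h \<in> sq_int M" "AE x in M. f x = f' x"
  shows "ip M f h = ip M f' h"
  using assms(4) by (intro ip_cong_AE sq_intD(1) assms(1-3)) auto

context L2_orthonormal_basis
begin

text \<open>
  In terms of the adjoint, the left-hand side is the sum of \<open>\<bar>\<langle>v\<^sub>j,
  R\<^sup>* h\<rangle>\<bar>\<^sup>2\<close> and \<open>X\<close> is the square of the norm of
  \<open>R\<^sup>* h\<close>, so this is Bessel's inequality. The proof avoids the adjoint: it
  expands the vector \<open>w = \<Sum>j. cnj \<langle>R v\<^sub>j, h\<rangle>
  v\<^sub>j\<close> in the basis \<open>e\<close> and applies the Cauchy-Schwarz inequality to
  \<open>\<langle>R w, h\<rangle>\<close>.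
\<close>

lemma orthonormal_coefficient_bound:
  assumes R: "bounded_op M R" and h: "h \<in> sq_int M"
    and J: "finite J" "\<And>j. j \<in> J \<Longrightarrow> v j \<in> sq_int M"
      "\<And>i j. i \<in> J \<Longrightarrow> j \<in> J \<Longrightarrow> ip M (v i) (v j) = (if i = j then 1 else 0)"
    and X: "((\<lambda>b. (norm (ip M (R (e b)) h))\<^sup>2) has_sum X) B"
  shows "(\<Sum>j\<in>J. (norm (ip M (R (v j)) h))\<^sup>2) \<le> X"
proof -
  have Rsq: "R f \<in> sq_int M" if "f \<in> sq_int M" for f using R that by (auto simp: bounded_op_def)
  obtain C where C: "C \<ge> 0" "\<And>f. f \<in> sq_int M \<Longrightarrow> sqrt (sqn M (R f)) \<le> C * sqrt (sqn M f)"
    using R by (auto simp: bounded_op_def)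
  define s where "s = (\<Sum>j\<in>J. (norm (ip M (R (v j)) h))\<^sup>2)"
  define c where "c j = cnj (ip M (R (v j)) h)" for j
  define w where "w = (\<lambda>x. \<Sum>j\<in>J. c j * v j x)"
  have w: "w \<in> sq_int M" unfolding w_def using J by (intro sq_int_sum sq_int_scale)
  have s0: "0 \<le> s" unfolding s_def by (intro sum_nonneg) auto
  have X0: "0 \<le> X" by (rule has_sum_nonneg[OF X]) auto
  have w_norm: "sqn M w = s"
  proof -
    have "complex_of_real (sqn M w) = (\<Sum>j\<in>J. c j * ip M (v j) w)"
      unfolding ip_self[symmetric] w_def[of] using J w[unfolded w_def]
      by (subst ip_sum_left) (auto simp: ip_scale_left intro: sq_int_scale)
    also have "\<dots> = (\<Sum>j\<in>J. c j * cnj (c j))"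
    proof (intro sum.cong refl)
      fix j assume j: "j \<in> J"
      have "ip M w (v j) = (\<Sum>i\<in>J. c i * ip M (v i) (v j))"
        unfolding w_def using J j by (subst ip_sum_left) (auto simp: ip_scale_left intro: sq_int_scale)
      also have "\<dots> = (\<Sum>i\<in>J. if i = j then c i else 0)" using J j by (intro sum.cong) auto
      also have "\<dots> = c j" using J j by simp
      finally show "c j * ip M (v j) w = c j * cnj (c j)" by (subst ip_cnj) simp
    qed
    also have "\<dots> = complex_of_real s"
      by (simp add: s_def c_def complex_norm_square mult.commute del: of_real_power)
    finally show ?thesis by (simp only: of_real_eq_iff)
  qed
  have Rw: "ip M (R w) h = complex_of_real s"
  proof -
    have "ip M (R w) h = ip M (\<lambda>x. \<Sum>j\<in>J. c j * R (v j) x) h"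
      using bounded_op_sum[OF R J(1,2), where c = c] unfolding w_def
      by (intro ip_cong_AE_left sq_int_sum sq_int_scale h Rsq J(2) w[unfolded w_def])
    also have "\<dots> = (\<Sum>j\<in>J. c j * ip M (R (v j)) h)"
      using J h by (subst ip_sum_left) (auto simp: ip_scale_left intro!: sq_int_scale Rsq)
    finally show ?thesis by (simp add: s_def c_def complex_norm_square mult.commute del: of_real_power)
  qed
  \<comment> \<open>The expansion of \<open>w\<close> is cut off at a finite set
  \<open>F\<close>; the error term comes from the rest.\<close>
  have est: "s \<le> sqrt s * sqrt X + C * \<epsilon> * sqrt (sqn M h)" if \<epsilon>: "0 < \<epsilon>" for \<epsilon>
  proof -
    obtain F where F: "finite F" "F \<subseteq> B" "sqrt (sqn M (\<lambda>x. w x - proj F w x)) < \<epsilon>"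
      by (rule proj_approx[OF w \<epsilon>])
    have pr: "proj F w \<in> sq_int M" by (rule proj_sq[OF F(2)])
    have eF: "b \<in> F \<Longrightarrow> e b \<in> sq_int M" for b using e_sq F by auto
    define d where "d = (\<lambda>x. w x - proj F w x)"
    have d: "d \<in> sq_int M" unfolding d_def by (rule sq_int_diff[OF w pr])
    have "AE x in M. R (\<lambda>x. d x + proj F w x) x = R d x + R (proj F w) x"
      using R d pr unfolding bounded_op_def by blast
    moreover have "(\<lambda>x. d x + proj F w x) = w" by (simp add: d_def)
    ultimately have "AE x in M. R w x = R d x + R (proj F w) x" by simp
    then have "ip M (R w) h = ip M (\<lambda>x. R d x + R (proj F w) x) h"
      by (intro ip_cong_AE_left sq_int_add Rsq w d pr h)
    moreover have "s = norm (ip M (R w) h)" using Rw s0 by simp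
    ultimately have "s \<le> norm (ip M (R d) h) + norm (ip M (R (proj F w)) h)"
      using norm_triangle_ineq[of "ip M (R d) h" "ip M (R (proj F w)) h"] ip_add_left[OF Rsq[OF d] Rsq[OF pr] h]
      by simp
    moreover have "norm (ip M (R d) h) \<le> C * \<epsilon> * sqrt (sqn M h)"
    proof -
      have "norm (ip M (R d) h) \<le> sqrt (sqn M (R d)) * sqrt (sqn M h)"
        by (rule ip_Cauchy_Schwarz[OF Rsq[OF d] h])
      also have "\<dots> \<le> (C * sqrt (sqn M d)) * sqrt (sqn M h)"
        by (intro mult_right_mono C d) (simp add: sqn_nonneg)
      also have "\<dots> \<le> (C * \<epsilon>) * sqrt (sqn M h)"
        using F(3) C(1) by (intro mult_right_mono mult_left_mono) (auto simp: d_def sqn_nonneg)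
      finally show ?thesis .
    qed
    moreover have "norm (ip M (R (proj F w)) h) \<le> sqrt s * sqrt X"
    proof -
      have Re: "R (e b) \<in> sq_int M" if "b \<in> F" for b using Rsq[OF eF[OF that]] .
      have "ip M (R (proj F w)) h = ip M (\<lambda>x. \<Sum>b\<in>F. coef w b * R (e b) x) h"
        using bounded_op_sum[OF R F(1) eF, where c = "coef w"] unfolding proj_def
        by (intro ip_cong_AE_left sq_int_sum sq_int_scale h Re Rsq[OF pr, unfolded proj_def])
      also have "\<dots> = (\<Sum>b\<in>F. coef w b * ip M (R (e b)) h)"
        using sq_int_scale[OF Re] h by (subst ip_sum_left) (auto simp: ip_scale_left)
      finally have "norm (ip M (R (proj F w)) h) \<le> (\<Sum>b\<in>F. norm (coef w b) * norm (ip M (R (e b)) h))"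
        by (simp only: norm_mult[symmetric]) (rule norm_sum)
      also have "\<dots> \<le> sqrt ((\<Sum>b\<in>F. (norm (coef w b))\<^sup>2) * (\<Sum>b\<in>F. (norm (ip M (R (e b)) h))\<^sup>2))"
        by (rule real_le_rsqrt[OF Cauchy_Schwarz_ineq_sum])
      also have "\<dots> \<le> sqrt (s * X)"
        using Bessel[OF F(1,2) w] w_norm finite_sum_le_has_sum[OF X F(1,2)] s0
        by (intro real_sqrt_le_mono mult_mono) (auto intro: sum_nonneg)
      finally show ?thesis by (simp add: real_sqrt_mult)
    qed
    ultimately show ?thesis by simp
  qed
  have "s \<le> sqrt s * sqrt X"
  proof (rule field_le_epsilon)
    fix r :: real assume r: "0 < r"
    define \<epsilon> where "\<epsilon> = r / (C * sqrt (sqn M h) + 1)"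
    have den: "0 < C * sqrt (sqn M h) + 1" using C(1) sqn_nonneg[of M h] by (simp add: add_nonneg_pos)
    have "C * \<epsilon> * sqrt (sqn M h) = r * (C * sqrt (sqn M h) / (C * sqrt (sqn M h) + 1))"
      by (simp add: \<epsilon>_def)
    also have "\<dots> \<le> r * 1" using r den by (intro mult_left_mono) auto
    finally show "s \<le> sqrt s * sqrt X + r"
      using est[of \<epsilon>] r den by (simp add: \<epsilon>_def)
  qed
  then have "s \<le> X"
  proof (cases "s = 0")
    case False
    then have "sqrt s * sqrt s \<le> sqrt s * sqrt X" using \<open>s \<le> sqrt s * sqrt X\<close> s0 by simp
    moreover have "0 < sqrt s" using False s0 by simp
    ultimately have "sqrt s \<le> sqrt X" by (rule mult_left_le_imp_le)
    then show ?thesis by simp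
  qed (use X0 in simp)
  then show ?thesis by (simp add: s_def)
qed

text \<open>
  Half of the independence of the Hilbert-Schmidt norm of the basis: expand each \<open>R
  v\<^sub>j\<close> by Parseval's identity, exchange the sums, bound the sum over
  \<open>j\<close> for every single basis vector by
  \<open>orthonormal_coefficient_bound\<close>, and exchange the sums back.
\<close>

theorem Hilbert_Schmidt_orthonormal_le:
  assumes R: "bounded_op M R"
    and J: "finite J" "\<And>j. j \<in> J \<Longrightarrow> v j \<in> sq_int M"
      "\<And>i j. i \<in> J \<Longrightarrow> j \<in> J \<Longrightarrow> ip M (v i) (v j) = (if i = j then 1 else 0)"
    and S: "((\<lambda>b. sqn M (R (e b))) has_sum S) B"
  shows "(\<Sum>j\<in>J. sqn M (R (v j))) \<le> S"
proof -
  have Rsq: "R f \<in> sq_int M" if "f \<in> sq_int M" for f using R that by (auto simp: bounded_op_def)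
  have "((\<lambda>c. \<Sum>j\<in>J. (norm (coef (R (v j)) c))\<^sup>2) has_sum (\<Sum>j\<in>J. sqn M (R (v j)))) B"
    using J by (intro has_sum_finite_sum Parseval Rsq)
  then show ?thesis
  proof (rule has_sum_le_finite_sums)
    fix G assume G: "finite G" "G \<subseteq> B"
    have summ: "(\<lambda>b. (norm (coef (R (e b)) c))\<^sup>2) summable_on B" if "c \<in> G" for c
    proof (rule summable_on_nonneg_le[OF has_sum_imp_summable[OF S]])
      fix b assume b: "b \<in> B"
      show "(norm (coef (R (e b)) c))\<^sup>2 \<le> sqn M (R (e b))"
        using Bessel[of "{c}" "R (e b)"] that G Rsq e_sq[OF b] by auto
    qed auto
    have "(\<Sum>c\<in>G. \<Sum>j\<in>J. (norm (coef (R (v j)) c))\<^sup>2) \<le> (\<Sum>c\<in>G. infsum (\<lambda>b. (norm (coef (R (e b)) c))\<^sup>2) B)"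
    proof (rule sum_mono)
      fix c assume c: "c \<in> G"
      show "(\<Sum>j\<in>J. (norm (coef (R (v j)) c))\<^sup>2) \<le> infsum (\<lambda>b. (norm (coef (R (e b)) c))\<^sup>2) B"
        unfolding coef_def using summ[OF c, unfolded coef_def] G c e_sq
        by (intro orthonormal_coefficient_bound[OF R _ J] has_sum_infsum) auto
    qed
    also have "\<dots> \<le> S"
    proof (rule has_sum_mono[OF has_sum_finite_sum[OF G(1)] S])
      show "((\<lambda>b. (norm (coef (R (e b)) c))\<^sup>2) has_sum infsum (\<lambda>b. (norm (coef (R (e b)) c))\<^sup>2) B) B"
        if "c \<in> G" for c using summ[OF that] by (rule has_sum_infsum)
      show "(\<Sum>c\<in>G. (norm (coef (R (e b)) c))\<^sup>2) \<le> sqn M (R (e b))" if "b \<in> B" for b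
        using G that by (intro Bessel Rsq e_sq)
    qed
    finally show "(\<Sum>c\<in>G. \<Sum>j\<in>J. (norm (coef (R (v j)) c))\<^sup>2) \<le> S"
      by simp
  qed
qed

end

section \<open>Classes of square-integrable functions\<close>

lemma ae_classD:
  assumes "h \<in> ae_class M f"
  shows "h \<in> borel_measurable M" "AE x in M. h x = f x"
  using assms by (simp_all add: ae_class_def)

lemma ae_class_eq:
  assumes "f \<in> borel_measurable M" "g \<in> borel_measurable M"
  shows "ae_class M f = ae_class M g \<longleftrightarrow> (AE x in M. f x = g x)"
proof
  assume "ae_class M f = ae_class M g"
  moreover have "f \<in> ae_class M f" using assms by (simp add: ae_class_def)
  ultimately show "AE x in M. f x = g x" by (simp add: ae_class_def)
next
  assume eq: "AE x in M. f x = g x"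
  show "ae_class M f = ae_class M g"
    unfolding ae_class_def
  proof (intro Collect_cong conj_cong refl iffI)
    fix h show "AE x in M. h x = g x" if "AE x in M. h x = f x"
      using that eq by eventually_elim simp
    show "AE x in M. h x = f x" if "AE x in M. h x = g x"
      using that eq by eventually_elim simp
  qed
qed

lemma ae_class_cong:
  "f \<in> borel_measurable M \<Longrightarrow> g \<in> borel_measurable M \<Longrightarrow> (AE x in M. f x = g x) \<Longrightarrow> ae_class M f = ae_class M g"
  by (simp add: ae_class_eq)

lemma rep_ae_class:
  assumes "f \<in> borel_measurable M"
  shows "rep (ae_class M f) \<in> borel_measurable M" "AE x in M. rep (ae_class M f) x = f x"
proof -
  have "f \<in> ae_class M f" using assms by (simp add: ae_class_def)
  then have "rep (ae_class M f) \<in> ae_class M f" unfolding rep_def by (rule someI[of "\<lambda>h. h \<in> ae_class M f"])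
  then show "rep (ae_class M f) \<in> borel_measurable M" "AE x in M. rep (ae_class M f) x = f x"
    by (rule ae_classD)+
qed

lemma ae_class_rep: "f \<in> borel_measurable M \<Longrightarrow> ae_class M (rep (ae_class M f)) = ae_class M f"
  by (intro ae_class_cong rep_ae_class)

lemma sq_int_cong_AE:
  assumes "f \<in> sq_int M" "g \<in> borel_measurable M" "AE x in M. g x = f x"
  shows "g \<in> sq_int M"
proof -
  note [measurable] = sq_intD(1)[OF assms(1)] assms(2)
  have "integrable M (\<lambda>x. (norm (g x))\<^sup>2) \<longleftrightarrow> integrable M (\<lambda>x. (norm (f x))\<^sup>2)"
    using assms(3) by (intro integrable_cong_AE) auto
  then show ?thesis using assms by (simp add: sq_int_def)
qed

lemma vectors_L2: "vectors (L2 M) = ae_class M ` sq_int M"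
  by (auto simp: L2_def sq_int_def)

lemma ae_class_in_L2: "f \<in> sq_int M \<Longrightarrow> ae_class M f \<in> vectors (L2 M)"
  by (auto simp: vectors_L2)

lemma rep_sq_int: "f \<in> sq_int M \<Longrightarrow> rep (ae_class M f) \<in> sq_int M"
  by (rule sq_int_cong_AE[OF _ rep_ae_class[OF sq_intD(1)]])

lemma L2_vectorD:
  assumes "A \<in> vectors (L2 M)"
  shows "rep A \<in> sq_int M" "ae_class M (rep A) = A"
  using assms by (auto simp: vectors_L2 rep_sq_int ae_class_rep sq_intD)

lemma vinner_L2: "vinner (L2 M) A B = ip M (rep A) (rep B)"
  by (simp add: L2_def ip_def)

lemma vnorm_L2: "vnorm (L2 M) A = sqrt (sqn M (rep A))"
  by (simp add: vnorm_def vinner_L2 ip_self)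

lemma ip_rep:
  "f \<in> sq_int M \<Longrightarrow> g \<in> sq_int M \<Longrightarrow> ip M (rep (ae_class M f)) (rep (ae_class M g)) = ip M f g"
  by (intro ip_cong_AE rep_ae_class sq_intD(1))

lemma sqn_rep: "f \<in> sq_int M \<Longrightarrow> sqn M (rep (ae_class M f)) = sqn M f"
  by (intro sqn_cong_AE rep_ae_class sq_intD(1))

lemma vadd_L2:
  assumes "f \<in> sq_int M" "g \<in> sq_int M"
  shows "vadd (L2 M) (ae_class M f) (ae_class M g) = ae_class M (\<lambda>x. f x + g x)"
proof -
  note [measurable] = sq_intD(1)[OF assms(1)] sq_intD(1)[OF assms(2)]
    sq_intD(1)[OF rep_sq_int[OF assms(1)]] sq_intD(1)[OF rep_sq_int[OF assms(2)]]
  from rep_ae_class(2)[OF sq_intD(1)[OF assms(1)]] rep_ae_class(2)[OF sq_intD(1)[OF assms(2)]]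
  have "AE x in M. rep (ae_class M f) x + rep (ae_class M g) x = f x + g x"
    by eventually_elim (simp only:)
  then show ?thesis unfolding L2_def by (simp add: ae_class_eq)
qed

lemma vscale_L2:
  assumes "f \<in> sq_int M"
  shows "vscale (L2 M) c (ae_class M f) = ae_class M (\<lambda>x. c * f x)"
proof -
  note [measurable] = sq_intD(1)[OF assms] sq_intD(1)[OF rep_sq_int[OF assms]]
  have "AE x in M. c * rep (ae_class M f) x = c * f x"
    using rep_ae_class(2)[OF sq_intD(1)[OF assms]] by eventually_elim (simp only:)
  then show ?thesis unfolding L2_def by (simp add: ae_class_eq)
qed

lemma vadd_in_L2: "A \<in> vectors (L2 M) \<Longrightarrow> C \<in> vectors (L2 M) \<Longrightarrow> vadd (L2 M) A C \<in> vectors (L2 M)"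
  by (auto simp: vectors_L2 vadd_L2 intro: sq_int_add)

lemma vscale_in_L2: "A \<in> vectors (L2 M) \<Longrightarrow> vscale (L2 M) c A \<in> vectors (L2 M)"
  by (auto simp: vectors_L2 vscale_L2 intro: sq_int_scale)

lemma rep_vadd_L2:
  assumes "A \<in> vectors (L2 M)" "C \<in> vectors (L2 M)"
  shows "AE x in M. rep (vadd (L2 M) A C) x = rep A x + rep C x"
  using rep_ae_class(2)[OF sq_intD(1)[OF sq_int_add[OF L2_vectorD(1)[OF assms(1)] L2_vectorD(1)[OF assms(2)]]]]
  by (simp add: L2_def)

lemma rep_vscale_L2:
  assumes "A \<in> vectors (L2 M)"
  shows "AE x in M. rep (vscale (L2 M) c A) x = c * rep A x"
  using rep_ae_class(2)[OF sq_intD(1)[OF sq_int_scale[OF L2_vectorD(1)[OF assms]]]]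
  by (simp add: L2_def)

lemma vdiff_L2:
  assumes "f \<in> sq_int M" "g \<in> sq_int M"
  shows "vdiff (L2 M) (ae_class M f) (ae_class M g) = ae_class M (\<lambda>x. f x - g x)"
  using vadd_L2[OF assms(1) sq_int_scale[OF assms(2), of "-1"]] assms
  by (simp add: vdiff_def vscale_L2)

lemma vdiff_L2_reps:
  assumes "A \<in> vectors (L2 M)" "C \<in> vectors (L2 M)"
  shows "vdiff (L2 M) A C = ae_class M (\<lambda>x. rep A x - rep C x)"
  using vdiff_L2[OF L2_vectorD(1)[OF assms(1)] L2_vectorD(1)[OF assms(2)]] L2_vectorD(2) assms by metis

text \<open>
  A maximal orthonormal set is total, since a nonzero vector orthogonal to it could be
  normalised and added.
\<close>

lemma orthonormal_basis_L2_exists: "\<exists>B. orthonormal_basis (L2 M) B"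
proof -
  let ?ip = "vinner (L2 M)"
  define \<O> where "\<O> = {B. B \<subseteq> vectors (L2 M) \<and> (\<forall>e\<in>B. \<forall>f\<in>B. ?ip e f = (if e = f then 1 else 0))}"
  have "\<exists>B\<in>\<O>. \<forall>X\<in>\<O>. B \<subseteq> X \<longrightarrow> X = B"
  proof (rule Zorn_Lemma2, intro ballI)
    fix C assume C: "C \<in> chains \<O>"
    have CO: "X \<in> \<O>" if "X \<in> C" for X using chainsD2[OF C] that by (rule subsetD)
    have "\<Union>C \<in> \<O>"
      unfolding \<O>_def
    proof (intro CollectI conjI ballI)
      show "\<Union>C \<subseteq> vectors (L2 M)" using CO by (intro Union_least) (simp add: \<O>_def)
      fix e f assume ef: "e \<in> \<Union>C" "f \<in> \<Union>C"
      obtain X where X: "X \<in> C" "e \<in> X" using ef(1) by (rule UnionE)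
      obtain Y where Y: "Y \<in> C" "f \<in> Y" using ef(2) by (rule UnionE)
      note XY = X(1) Y(1) X(2) Y(2)
      have "X \<subseteq> Y \<or> Y \<subseteq> X" using chainsD[OF C XY(1,2)] .
      then obtain Z where Z: "Z \<in> C" "e \<in> Z" "f \<in> Z" using XY by (metis subsetD)
      have "Z \<in> \<O>" by (rule CO[OF Z(1)])
      then show "?ip e f = (if e = f then 1 else 0)"
        using Z(2,3) by (simp add: \<O>_def)
    qed
    then show "\<exists>U\<in>\<O>. \<forall>X\<in>C. X \<subseteq> U" by blast
  qed
  then obtain B where B: "B \<in> \<O>" and max: "\<And>X. X \<in> \<O> \<Longrightarrow> B \<subseteq> X \<Longrightarrow> X = B" by blast
  have "?ip v v = 0" if v: "v \<in> vectors (L2 M)" and orth: "\<forall>e\<in>B. ?ip v e = 0" for v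
  proof (rule ccontr)
    assume nz: "?ip v v \<noteq> 0"
    have rv: "rep v \<in> sq_int M" using L2_vectorD[OF v] by simp
    define s where "s = sqn M (rep v)"
    have s: "s > 0" using nz sqn_nonneg[of M "rep v"] by (auto simp: s_def vinner_L2 ip_self)
    define c where "c = complex_of_real (1 / sqrt s)"
    define u where "u = ae_class M (\<lambda>x. c * rep v x)"
    have cu: "(\<lambda>x. c * rep v x) \<in> sq_int M" by (rule sq_int_scale[OF rv])
    have u: "u \<in> vectors (L2 M)" unfolding u_def by (rule ae_class_in_L2[OF cu])
    have uB: "?ip u e = 0" "?ip e u = 0" if e: "e \<in> B" for e
    proof -
      have eL: "e \<in> vectors (L2 M)" using e B by (auto simp: \<O>_def)
      have "?ip u e = ip M (rep u) (rep (ae_class M (rep e)))"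
        by (simp add: vinner_L2 L2_vectorD(2)[OF eL])
      also have "\<dots> = c * ip M (rep v) (rep e)"
        unfolding u_def using ip_rep[OF cu L2_vectorD(1)[OF eL]] by (simp add: ip_scale_left)
      also have "\<dots> = 0" using orth e by (simp add: vinner_L2)
      finally show "?ip u e = 0" .
      then show "?ip e u = 0" unfolding vinner_L2 by (subst ip_cnj) simp
    qed
    have uu: "?ip u u = 1"
    proof -
      have "?ip u u = complex_of_real ((norm c)\<^sup>2 * s)"
        unfolding vinner_L2 ip_self u_def sqn_rep[OF cu] by (simp add: sqn_scale s_def)
      also have "(norm c)\<^sup>2 * s = 1" using s by (simp add: c_def norm_divide power_divide)
      finally show ?thesis by simp
    qed
    have "insert u B \<in> \<O>" using B u uB uu by (auto simp: \<O>_def)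
    then have "insert u B = B" using max by blast
    then have "u \<in> B" by blast
    then show False using uB(1)[of u] uu by simp
  qed
  then have "orthonormal_basis (L2 M) B"
    using B by (auto simp: orthonormal_basis_def \<O>_def)
  then show ?thesis ..
qed

lemma L2_orthonormal_basis_some_basis: "L2_orthonormal_basis M (some_basis (L2 M)) rep"
proof -
  have "orthonormal_basis (L2 M) (some_basis (L2 M))"
    unfolding some_basis_def using orthonormal_basis_L2_exists by (rule someI_ex)
  then have sub: "some_basis (L2 M) \<subseteq> vectors (L2 M)"
    and on: "\<And>e f. e \<in> some_basis (L2 M) \<Longrightarrow> f \<in> some_basis (L2 M) \<Longrightarrow> vinner (L2 M) e f = (if e = f then 1 else 0)"
    and tot: "\<And>v. v \<in> vectors (L2 M) \<Longrightarrow> (\<forall>e\<in>some_basis (L2 M). vinner (L2 M) v e = 0) \<Longrightarrow> vinner (L2 M) v v = 0"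
    by (auto simp: orthonormal_basis_def)
  show ?thesis
  proof
    fix b assume b: "b \<in> some_basis (L2 M)"
    then show "rep b \<in> sq_int M" using sub L2_vectorD(1) by blast
    fix c assume c: "c \<in> some_basis (L2 M)"
    then show "ip M (rep b) (rep c) = (if b = c then 1 else 0)" using on[OF b c] by (simp add: vinner_L2)
  next
    fix f assume f: "f \<in> sq_int M" and orth: "\<And>b. b \<in> some_basis (L2 M) \<Longrightarrow> ip M f (rep b) = 0"
    have "vinner (L2 M) (ae_class M f) (ae_class M f) = 0"
    proof (rule tot[OF ae_class_in_L2[OF f]], intro ballI)
      fix b assume b: "b \<in> some_basis (L2 M)"
      then have bL: "b \<in> vectors (L2 M)" using sub by auto
      show "vinner (L2 M) (ae_class M f) b = 0"
        using ip_rep[OF f L2_vectorD(1)[OF bL]] orth[OF b] by (simp add: vinner_L2 L2_vectorD(2)[OF bL])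
    qed
    then show "sqn M f = 0" by (simp add: vinner_L2 ip_self sqn_rep[OF f])
  qed
qed

lemma some_basis_subset_L2: "some_basis (L2 M) \<subseteq> vectors (L2 M)"
  using someI_ex[OF orthonormal_basis_L2_exists[of M]] unfolding some_basis_def[symmetric]
  by (simp add: orthonormal_basis_def)

section \<open>Quasi-invariant actions\<close>

locale quasi_invariant_action =
  fixes M :: "'x measure"
    and act :: "'g::{topological_group_add, second_countable_topology, t2_space} \<Rightarrow> 'x \<Rightarrow> 'x"
  assumes sf: "sigma_finite_measure M"
    and ma: "measurable_action M act"
    and qi: "quasi_invariant M act"
begin

sublocale sigma_finite_measure M by (rule sf)

lemma act_joint [measurable]: "(\<lambda>(g, x). act g x) \<in> borel \<Otimes>\<^sub>M M \<rightarrow>\<^sub>M M"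
  using ma by (simp add: measurable_action_def)

lemma act_measurable [measurable]: "act g \<in> M \<rightarrow>\<^sub>M M"
  using measurable_compose[OF measurable_Pair1'[of g borel M] act_joint] by simp

lemma act_space: "x \<in> space M \<Longrightarrow> act g x \<in> space M"
  using act_measurable by (rule measurable_space)

lemma act_add: "x \<in> space M \<Longrightarrow> act (g + h) x = act g (act h x)"
  using ma by (simp add: measurable_action_def)

lemma act_minus: "x \<in> space M \<Longrightarrow> act g (act (- g) x) = x" "x \<in> space M \<Longrightarrow> act (- g) (act g x) = x"
  using act_add[of x g "- g"] act_add[of x "- g" g] ma by (simp_all add: measurable_action_def)

lemma AE_act:
  assumes "AE x in M. P x"
  shows "AE x in M. P (act g x)"
proof -
  obtain N where N: "N \<in> null_sets M" "{x\<in>space M. \<not> P x} \<subseteq> N"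
    using assms by (auto simp: eventually_ae_filter)
  then have "N \<in> null_sets (distr M M (act g))" using qi by (simp add: quasi_invariant_def)
  then have "act g -` N \<inter> space M \<in> null_sets M"
    by (simp add: null_sets_distr_iff)
  then show ?thesis
    by (rule AE_I') (use N act_space in auto)
qed

lemma distr_ac: "absolutely_continuous M (distr M M (act g))"
  using qi by (simp add: quasi_invariant_def absolutely_continuous_def)

text \<open>
  Translates of sets of finite measure have finite image measure. Sigma-finiteness makes the
  Radon-Nikodym derivative finite almost everywhere, so that the representation loses nothing
  when it reads the derivative as a real number.
\<close>

lemma sigma_finite_distr: "sigma_finite_measure (distr M M (act g))"
proof -
  obtain A :: "nat \<Rightarrow> 'x set" where A: "range A \<subseteq> sets M" "(\<Union>i. A i) = space M" "\<And>i. emeasure M (A i) \<noteq> \<infinity>"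
    using sigma_finite by auto
  define C where "C i = act (- g) -` A i \<inter> space M" for i
  have Am: "A i \<in> sets M" for i using A by auto
  have C: "C i \<in> sets M" for i unfolding C_def using Am by measurable
  have "act g -` C i \<inter> space M = A i" for i
    using sets.sets_into_space[OF Am[of i]] by (auto simp: C_def act_minus act_space)
  then have "emeasure (distr M M (act g)) (C i) \<noteq> \<infinity>" for i
    using C A(3) by (simp add: emeasure_distr)
  moreover have "x \<in> (\<Union>i. C i)" if x: "x \<in> space M" for x
  proof -
    have "act (- g) x \<in> (\<Union>i. A i)" unfolding A(2) by (rule act_space[OF x])
    then show ?thesis using x by (auto simp: C_def)
  qed
  then have "(\<Union>i. C i) = space M" by (auto simp: C_def)
  ultimately show ?thesis
    using C by (intro sigma_finite_measure.intro exI[of _ "range C"] conjI ballI) (auto simp del: emeasure_distr)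
qed

text \<open>
  The derivative \<open>d\<nu>(g\<inverse>x)/d\<nu>(x)\<close>.
\<close>

definition jac :: "'g \<Rightarrow> 'x \<Rightarrow> real" where
  "jac g x = enn2real (RN_deriv M (distr M M (act g)) x)"

lemma jac_measurable [measurable]: "jac g \<in> borel_measurable M"
  unfolding jac_def[abs_def] by measurable

lemma jac_nonneg: "0 \<le> jac g x"
  by (simp add: jac_def)

lemma density_jac: "density M (\<lambda>x. ennreal (jac g x)) = distr M M (act g)"
proof -
  have "AE x in M. RN_deriv M (distr M M (act g)) x \<noteq> \<infinity>"
    by (rule RN_deriv_finite[OF sigma_finite_distr distr_ac]) simp
  then have "AE x in M. ennreal (jac g x) = RN_deriv M (distr M M (act g)) x"
    by eventually_elim (simp add: jac_def less_top)
  then have "density M (\<lambda>x. ennreal (jac g x)) = density M (RN_deriv M (distr M M (act g)))"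
    by (intro density_cong) auto
  also have "\<dots> = distr M M (act g)" by (rule density_RN_deriv[OF distr_ac]) simp
  finally show ?thesis .
qed

lemma nn_integral_jac:
  assumes [measurable]: "F \<in> borel_measurable M"
  shows "(\<integral>\<^sup>+x. ennreal (jac g x) * F x \<partial>M) = (\<integral>\<^sup>+x. F (act g x) \<partial>M)"
  using nn_integral_density[of "\<lambda>x. ennreal (jac g x)" M F] by (simp add: density_jac nn_integral_distr)

lemma integrable_jac:
  fixes F :: "'x \<Rightarrow> 'b::{banach, second_countable_topology}"
  assumes [measurable]: "F \<in> borel_measurable M"
  shows "integrable M (\<lambda>x. jac g x *\<^sub>R F x) \<longleftrightarrow> integrable M (\<lambda>x. F (act g x))"
  using integrable_density[of F M "jac g"] by (simp add: density_jac integrable_distr_eq jac_nonneg)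

lemma integral_jac:
  fixes F :: "'x \<Rightarrow> 'b::{banach, second_countable_topology}"
  assumes [measurable]: "F \<in> borel_measurable M"
  shows "(\<integral>x. jac g x *\<^sub>R F x \<partial>M) = (\<integral>x. F (act g x) \<partial>M)"
  using integral_density[of F M "jac g"] by (simp add: density_jac integral_distr jac_nonneg)

lemma integral_jac_translate:
  fixes F :: "'x \<Rightarrow> 'b::{banach, second_countable_topology}"
  assumes [measurable]: "F \<in> borel_measurable M"
  shows "(\<integral>x. jac g x *\<^sub>R F (act (- g) x) \<partial>M) = (\<integral>x. F x \<partial>M)"
    and "integrable M (\<lambda>x. jac g x *\<^sub>R F (act (- g) x)) \<longleftrightarrow> integrable M F"
proof -
  show "(\<integral>x. jac g x *\<^sub>R F (act (- g) x) \<partial>M) = (\<integral>x. F x \<partial>M)"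
    by (subst integral_jac) (auto simp: act_minus intro!: Bochner_Integration.integral_cong)
  show "integrable M (\<lambda>x. jac g x *\<^sub>R F (act (- g) x)) \<longleftrightarrow> integrable M F"
    by (subst integrable_jac) (auto simp: act_minus intro!: Bochner_Integration.integrable_cong)
qed

text \<open>
  The representation on functions instead of classes.
\<close>

definition Lam :: "'g \<Rightarrow> ('x \<Rightarrow> complex) \<Rightarrow> 'x \<Rightarrow> complex" where
  "Lam g f = (\<lambda>x. complex_of_real (sqrt (jac g x)) * f (act (- g) x))"

lemma Lam_measurable:
  assumes [measurable]: "f \<in> borel_measurable M"
  shows "Lam g f \<in> borel_measurable M"
  unfolding Lam_def by measurable

lemma Lam_mult_cnj: "Lam g f x * cnj (Lam g h x) = jac g x *\<^sub>R (f (act (- g) x) * cnj (h (act (- g) x)))"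
proof -
  have "complex_of_real (sqrt (jac g x)) * complex_of_real (sqrt (jac g x)) = complex_of_real (jac g x)"
    by (simp only: of_real_mult[symmetric] real_sqrt_mult_self) (simp add: jac_nonneg)
  moreover have "Lam g f x * cnj (Lam g h x)
      = (complex_of_real (sqrt (jac g x)) * complex_of_real (sqrt (jac g x))) * (f (act (- g) x) * cnj (h (act (- g) x)))"
    by (simp only: Lam_def complex_cnj_mult complex_cnj_complex_of_real mult_ac)
  ultimately show ?thesis by (simp only: scaleR_conv_of_real)
qed

lemma norm_Lam_sq: "(norm (Lam g f x))\<^sup>2 = jac g x *\<^sub>R (norm (f (act (- g) x)))\<^sup>2"
  by (simp add: Lam_def norm_mult power_mult_distrib jac_nonneg)

lemma Lam_sq_int:
  assumes "f \<in> sq_int M"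
  shows "Lam g f \<in> sq_int M"
proof -
  note [measurable] = sq_intD(1)[OF assms]
  have "integrable M (\<lambda>x. jac g x *\<^sub>R (norm (f (act (- g) x)))\<^sup>2)"
    using assms by (subst integral_jac_translate(2)) (auto dest: sq_intD(2))
  then have "integrable M (\<lambda>x. (norm (Lam g f x))\<^sup>2)" by (simp only: norm_Lam_sq)
  then show ?thesis using Lam_measurable[OF sq_intD(1)[OF assms]] by (simp add: sq_int_def)
qed

lemma ip_Lam:
  assumes "f \<in> sq_int M" "h \<in> sq_int M"
  shows "ip M (Lam g f) (Lam g h) = ip M f h"
proof -
  note [measurable] = sq_intD(1)[OF assms(1)] sq_intD(1)[OF assms(2)]
  show ?thesis unfolding ip_def Lam_mult_cnj by (rule integral_jac_translate(1)) measurable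
qed

lemma sqn_weighted_Lam:
  fixes w :: "'x \<Rightarrow> real"
  assumes [measurable]: "f \<in> borel_measurable M" "w \<in> borel_measurable M"
  shows "(\<integral>x. w (act (- g) x) * (norm (Lam g f x))\<^sup>2 \<partial>M) = (\<integral>x. w x * (norm (f x))\<^sup>2 \<partial>M)"
  using integral_jac_translate(1)[of "\<lambda>x. w x * (norm (f x))\<^sup>2" g]
  by (simp add: norm_Lam_sq mult.left_commute)

lemma sqn_Lam:
  "f \<in> sq_int M \<Longrightarrow> sqn M (Lam g f) = sqn M f"
  using sqn_weighted_Lam[of f "\<lambda>x. 1" g] by (simp add: sqn_def sq_intD)

lemma Lam_cong_AE:
  assumes "AE x in M. f x = h x"
  shows "AE x in M. Lam g f x = Lam g h x"
  using AE_act[OF assms, of "- g"] by eventually_elim (simp add: Lam_def)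

text \<open>
  The chain rule for the maps of \<open>g\<close> and \<open>- g\<close>: both sides are
  densities of \<open>M\<close> with respect to itself, and densities are unique.
\<close>

lemma jac_cocycle: "AE x in M. jac g x * jac (- g) (act (- g) x) = 1"
proof -
  have "density M (\<lambda>x. ennreal (jac g x * jac (- g) (act (- g) x))) = density M (\<lambda>x. 1)"
  proof (rule measure_eqI)
    fix A assume "A \<in> sets (density M (\<lambda>x. ennreal (jac g x * jac (- g) (act (- g) x))))"
    then have A[measurable]: "A \<in> sets M" by simp
    have "emeasure (density M (\<lambda>x. ennreal (jac g x * jac (- g) (act (- g) x)))) A
        = (\<integral>\<^sup>+x. ennreal (jac g x) * (ennreal (jac (- g) (act (- g) x)) * indicator A x) \<partial>M)"
      by (simp add: emeasure_density ennreal_mult jac_nonneg mult.assoc)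
    also have "\<dots> = (\<integral>\<^sup>+x. ennreal (jac (- g) (act (- g) (act g x))) * indicator A (act g x) \<partial>M)"
      by (rule nn_integral_jac) measurable
    also have "\<dots> = (\<integral>\<^sup>+x. ennreal (jac (- g) x) * indicator A (act g x) \<partial>M)"
      by (intro nn_integral_cong) (simp add: act_minus)
    also have "\<dots> = (\<integral>\<^sup>+x. indicator A (act g (act (- g) x)) \<partial>M)"
      by (rule nn_integral_jac) measurable
    also have "\<dots> = (\<integral>\<^sup>+x. indicator A x \<partial>M)"
      by (intro nn_integral_cong) (simp add: act_minus)
    finally show "emeasure (density M (\<lambda>x. ennreal (jac g x * jac (- g) (act (- g) x)))) A = emeasure (density M (\<lambda>x. 1)) A"
      by (simp add: emeasure_density)
  qed simp
  then have "AE x in M. ennreal (jac g x * jac (- g) (act (- g) x)) = 1"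
    by (subst (asm) density_unique_iff) auto
  then show ?thesis
    by eventually_elim (simp add: ennreal_eq_1)
qed

lemma Lam_inverse: "AE x in M. Lam g (Lam (- g) f) x = f x"
  using jac_cocycle[of g] AE_space
proof eventually_elim
  case (elim x)
  have "Lam g (Lam (- g) f) x = complex_of_real (sqrt (jac g x) * sqrt (jac (- g) (act (- g) x))) * f x"
    using elim(2) by (simp add: Lam_def act_minus)
  also have "sqrt (jac g x) * sqrt (jac (- g) (act (- g) x)) = 1"
    using elim(1) by (simp add: real_sqrt_mult[symmetric])
  finally show ?case by simp
qed

lemma ip_Lam_adjoint:
  assumes f: "f \<in> sq_int M" and h: "h \<in> sq_int M"
  shows "ip M (Lam (- g) f) h = ip M f (Lam g h)"
proof -
  have "ip M (Lam (- g) f) h = ip M (Lam g (Lam (- g) f)) (Lam g h)"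
    by (rule ip_Lam[symmetric]) (intro Lam_sq_int f, rule h)
  also have "\<dots> = ip M f (Lam g h)"
    by (intro ip_cong_AE_left Lam_sq_int f h Lam_inverse)
  finally show ?thesis .
qed

lemma lambda_rep_eq: "lambda_rep M act g A = ae_class M (Lam g (rep A))"
  by (simp add: lambda_rep_def Lam_def jac_def)

lemma lambda_rep_class:
  assumes "f \<in> sq_int M"
  shows "lambda_rep M act g (ae_class M f) = ae_class M (Lam g f)"
  unfolding lambda_rep_eq
  by (intro ae_class_cong Lam_measurable sq_intD(1)[OF rep_sq_int[OF assms]] sq_intD(1)[OF assms]
      Lam_cong_AE rep_ae_class(2))

lemma lambda_rep_in_L2: "A \<in> vectors (L2 M) \<Longrightarrow> lambda_rep M act g A \<in> vectors (L2 M)"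
  unfolding lambda_rep_eq by (intro ae_class_in_L2 Lam_sq_int L2_vectorD)

lemma rep_lambda_rep:
  "A \<in> vectors (L2 M) \<Longrightarrow> AE x in M. rep (lambda_rep M act g A) x = Lam g (rep A) x"
  unfolding lambda_rep_eq by (intro rep_ae_class(2) Lam_measurable sq_intD(1) L2_vectorD)

section \<open>From almost invariant vectors to Hilbert-Schmidt operators\<close>

abbreviation basis :: "('x \<Rightarrow> complex) set set" where
  "basis \<equiv> some_basis (L2 M)"

sublocale B: L2_orthonormal_basis M basis rep
  by (rule L2_orthonormal_basis_some_basis)

lemma basis_L2: "e \<in> basis \<Longrightarrow> e \<in> vectors (L2 M)"
  using some_basis_subset_L2 by blast

lemma HS_norm_has_sum:
  assumes "((\<lambda>e. sqn M (rep (T e))) has_sum s) basis"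
  shows "vnorm (HS (L2 M)) T = sqrt s"
proof -
  have "((\<lambda>e. vinner (L2 M) (T e) (T e)) has_sum complex_of_real s) basis"
    unfolding vinner_L2 ip_self using assms by (simp add: has_sum_of_real_iff)
  then have "vinner (HS (L2 M)) T T = complex_of_real s"
    by (simp add: HS_def infsumI)
  then show ?thesis by (simp add: vnorm_def)
qed

lemma vectors_HS:
  "T \<in> vectors (HS (L2 M)) \<longleftrightarrow> T \<in> bounded_operators (L2 M) \<and> (\<lambda>e. sqn M (rep (T e))) summable_on basis"
proof -
  have "(\<lambda>e. (vnorm (L2 M) (T e))\<^sup>2) = (\<lambda>e. sqn M (rep (T e)))"
    by (simp add: vnorm_L2 sqn_nonneg)
  then show ?thesis by (simp add: HS_def)
qed

lemma HS_norm_diff: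
  assumes S: "\<And>e. e \<in> basis \<Longrightarrow> S e \<in> vectors (L2 M)" and T: "\<And>e. e \<in> basis \<Longrightarrow> T e \<in> vectors (L2 M)"
    and s: "((\<lambda>e. sqn M (\<lambda>x. rep (S e) x - rep (T e) x)) has_sum s) basis"
  shows "vnorm (HS (L2 M)) (vdiff (HS (L2 M)) S T) = sqrt s"
proof (rule HS_norm_has_sum)
  have "sqn M (rep (vdiff (HS (L2 M)) S T e)) = sqn M (\<lambda>x. rep (S e) x - rep (T e) x)" if e: "e \<in> basis" for e
  proof -
    have "vdiff (HS (L2 M)) S T e = vdiff (L2 M) (S e) (T e)"
      using basis_L2[OF e] by (simp add: vdiff_def HS_def)
    also have "\<dots> = ae_class M (\<lambda>x. rep (S e) x - rep (T e) x)"
      by (rule vdiff_L2_reps[OF S[OF e] T[OF e]])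
    finally show ?thesis
      using sqn_rep[OF sq_int_diff[OF L2_vectorD(1)[OF S[OF e]] L2_vectorD(1)[OF T[OF e]]]] by simp
  qed
  then show "((\<lambda>e. sqn M (rep (vdiff (HS (L2 M)) S T e))) has_sum s) basis"
    using has_sum_cong[of basis "\<lambda>e. sqn M (rep (vdiff (HS (L2 M)) S T e))"] s by simp
qed

text \<open>
  The operator \<open>v \<mapsto> \<langle>v, z\<rangle> z\<close>, which stands for the
  tensor of \<open>z\<close> with its conjugate.
\<close>

definition rank1 :: "('x \<Rightarrow> complex) \<Rightarrow> ('x \<Rightarrow> complex) set \<Rightarrow> ('x \<Rightarrow> complex) set" where
  "rank1 z = (\<lambda>v\<in>vectors (L2 M). ae_class M (\<lambda>x. ip M (rep v) z * z x))"

lemma rank1_apply: "v \<in> vectors (L2 M) \<Longrightarrow> rank1 z v = ae_class M (\<lambda>x. ip M (rep v) z * z x)"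
  by (simp add: rank1_def)

lemma rank1_bounded:
  assumes z: "z \<in> sq_int M"
  shows "rank1 z \<in> bounded_operators (L2 M)"
  unfolding bounded_operators_def
proof (intro CollectI conjI ballI allI)
  have cz: "(\<lambda>x. c * z x) \<in> sq_int M" for c by (rule sq_int_scale[OF z])
  show "rank1 z \<in> vectors (L2 M) \<rightarrow>\<^sub>E vectors (L2 M)"
    unfolding rank1_def by (intro restrict_PiE_iff[THEN iffD2] ballI ae_class_in_L2 cz)
  fix v assume v: "v \<in> vectors (L2 M)"
  {
    fix w assume w: "w \<in> vectors (L2 M)"
    have "ip M (rep (vadd (L2 M) v w)) z = ip M (\<lambda>x. rep v x + rep w x) z"
      by (intro ip_cong_AE_left L2_vectorD(1) vadd_in_L2 v w sq_int_add z rep_vadd_L2)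
    also have "\<dots> = ip M (rep v) z + ip M (rep w) z"
      by (intro ip_add_left L2_vectorD(1) v w z)
    finally show "rank1 z (vadd (L2 M) v w) = vadd (L2 M) (rank1 z v) (rank1 z w)"
      by (simp add: rank1_apply v w vadd_in_L2 vadd_L2[OF cz cz] distrib_right)
  }
  {
    fix c
    have "ip M (rep (vscale (L2 M) c v)) z = ip M (\<lambda>x. c * rep v x) z"
      by (intro ip_cong_AE_left L2_vectorD(1) vscale_in_L2 v sq_int_scale z rep_vscale_L2)
    then show "rank1 z (vscale (L2 M) c v) = vscale (L2 M) c (rank1 z v)"
      by (simp add: rank1_apply v vscale_in_L2 vscale_L2[OF cz] ip_scale_left mult.assoc)
  }
next
  have cz: "(\<lambda>x. c * z x) \<in> sq_int M" for c by (rule sq_int_scale[OF z])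
  have "vnorm (L2 M) (rank1 z v) \<le> sqn M z * vnorm (L2 M) v" if v: "v \<in> vectors (L2 M)" for v
  proof -
    have "vnorm (L2 M) (rank1 z v) = norm (ip M (rep v) z) * sqrt (sqn M z)"
      by (simp add: vnorm_L2 rank1_apply[OF v] sqn_rep[OF cz] sqn_scale real_sqrt_mult)
    also have "\<dots> \<le> (sqrt (sqn M (rep v)) * sqrt (sqn M z)) * sqrt (sqn M z)"
      by (intro mult_right_mono ip_Cauchy_Schwarz L2_vectorD(1) v z) (simp add: sqn_nonneg)
    also have "\<dots> = sqn M z * vnorm (L2 M) v" by (simp add: vnorm_L2 sqn_nonneg mult.assoc)
    finally show ?thesis .
  qed
  then show "\<exists>C. \<forall>v\<in>vectors (L2 M). vnorm (L2 M) (rank1 z v) \<le> C * vnorm (L2 M) v" by blast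
qed

lemma coef_has_sum:
  assumes "z \<in> sq_int M"
  shows "((\<lambda>e. (norm (ip M (rep e) z))\<^sup>2) has_sum sqn M z) basis"
  using B.Parseval[OF assms] unfolding B.coef_def by (subst ip_cnj) simp

lemma rank1_HS:
  assumes z: "z \<in> sq_int M"
  shows "((\<lambda>e. sqn M (rep (rank1 z e))) has_sum (sqn M z)\<^sup>2) basis"
proof -
  have "sqn M (rep (rank1 z e)) = sqn M z * (norm (ip M (rep e) z))\<^sup>2" if "e \<in> basis" for e
    unfolding rank1_apply[OF basis_L2[OF that]] sqn_rep[OF sq_int_scale[OF z]] sqn_scale by (rule mult.commute)
  then show ?thesis
    using has_sum_cmult_right[OF coef_has_sum[OF z], of "sqn M z"]
      has_sum_cong[of basis "\<lambda>e. sqn M (rep (rank1 z e))" "\<lambda>e. sqn M z * (norm (ip M (rep e) z))\<^sup>2"]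
    by (simp add: power2_eq_square)
qed

lemma rank1_in_HS: "z \<in> sq_int M \<Longrightarrow> rank1 z \<in> vectors (HS (L2 M))"
  unfolding vectors_HS using rank1_bounded rank1_HS by (blast intro: has_sum_imp_summable)

lemma tensor_conj_rank1:
  assumes z: "z \<in> sq_int M"
  shows "tensor_conj (L2 M) (lambda_rep M act) g (rank1 z) = rank1 (Lam g z)"
proof -
  have "lambda_rep M act g (rank1 z (lambda_rep M act (- g) v)) = ae_class M (\<lambda>x. ip M (rep v) (Lam g z) * Lam g z x)"
    if v: "v \<in> vectors (L2 M)" for v
  proof -
    have rv: "rep v \<in> sq_int M" by (rule L2_vectorD(1)[OF v])
    let ?c = "ip M (rep (lambda_rep M act (- g) v)) z"
    have "?c = ip M (Lam (- g) (rep v)) z"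
      by (intro ip_cong_AE_left L2_vectorD(1) lambda_rep_in_L2 v Lam_sq_int rv z rep_lambda_rep)
    also have "\<dots> = ip M (rep v) (Lam g z)" by (rule ip_Lam_adjoint[OF rv z])
    finally have c: "?c = ip M (rep v) (Lam g z)" .
    have "Lam g (\<lambda>x. c * z x) = (\<lambda>x. c * Lam g z x)" for c by (auto simp: Lam_def)
    then show ?thesis
      using lambda_rep_class[OF sq_int_scale[OF z], of g ?c]
      by (simp add: rank1_apply lambda_rep_in_L2[OF v] c)
  qed
  then show ?thesis
    unfolding tensor_conj_def rank1_def[of "Lam g z"] by (intro restrict_ext)
qed

text \<open>
  For unit vectors \<open>y\<close> and \<open>z\<close> with \<open>\<delta> = \<parallel>y -
  z\<parallel>\<^sup>2\<close>, the difference \<open>\<langle>e, y\<rangle> y - \<langle>e,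
  z\<rangle> z\<close> is \<open>\<langle>e, y\<rangle> (y - z) + \<langle>e, y - z\<rangle>
  z\<close>. Summed over the basis, its square norm is at most \<open>2 \<delta> + 2
  \<delta>\<close> by Parseval's identity. So a vector that is invariant up to
  \<open>\<epsilon> / 2\<close> gives an operator that is invariant up to
  \<open>\<epsilon>\<close>.
\<close>

theorem almost_invariant_tensor:
  assumes "almost_has_invariant_vectors (L2 M) (lambda_rep M act)"
  shows "almost_has_invariant_vectors (HS (L2 M)) (tensor_conj (L2 M) (lambda_rep M act))"
  unfolding almost_has_invariant_vectors_def
proof (intro allI impI, elim conjE)
  fix K :: "'g set" and \<epsilon> :: real assume K: "compact K" and \<epsilon>: "0 < \<epsilon>"
  have "\<exists>\<xi>\<in>vectors (L2 M). vnorm (L2 M) \<xi> = 1 \<and>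
      (\<forall>g\<in>K. vnorm (L2 M) (vdiff (L2 M) (lambda_rep M act g \<xi>) \<xi>) < \<epsilon> / 2)"
    using K \<epsilon> by (intro assms[unfolded almost_has_invariant_vectors_def, rule_format]) simp
  then obtain \<xi> where \<xi>: "\<xi> \<in> vectors (L2 M)" "vnorm (L2 M) \<xi> = 1"
    "\<And>g. g \<in> K \<Longrightarrow> vnorm (L2 M) (vdiff (L2 M) (lambda_rep M act g \<xi>) \<xi>) < \<epsilon> / 2" by blast
  define z where "z = rep \<xi>"
  have z: "z \<in> sq_int M" unfolding z_def by (rule L2_vectorD(1)[OF \<xi>(1)])
  have \<xi>_eq: "\<xi> = ae_class M z" unfolding z_def by (rule L2_vectorD(2)[OF \<xi>(1), symmetric])
  have z1: "sqn M z = 1" using \<xi>(2) by (simp add: vnorm_L2 z_def)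
  have close: "sqn M (\<lambda>x. Lam g z x - z x) < (\<epsilon> / 2)\<^sup>2" if g: "g \<in> K" for g
  proof -
    have d: "(\<lambda>x. Lam g z x - z x) \<in> sq_int M" by (intro sq_int_diff Lam_sq_int z)
    have "vdiff (L2 M) (lambda_rep M act g \<xi>) \<xi> = ae_class M (\<lambda>x. Lam g z x - z x)"
      unfolding \<xi>_eq lambda_rep_class[OF z] by (rule vdiff_L2[OF Lam_sq_int[OF z] z])
    then have "sqrt (sqn M (\<lambda>x. Lam g z x - z x)) < \<epsilon> / 2"
      using \<xi>(3)[OF g] by (simp add: vnorm_L2 sqn_rep[OF d])
    then show ?thesis using \<epsilon> sqn_nonneg real_sqrt_less_iff[of _ "(\<epsilon>/2)\<^sup>2"] by simp
  qed
  show "\<exists>T\<in>vectors (HS (L2 M)). vnorm (HS (L2 M)) T = 1 \<and>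
      (\<forall>g\<in>K. vnorm (HS (L2 M)) (vdiff (HS (L2 M)) (tensor_conj (L2 M) (lambda_rep M act) g T) T) < \<epsilon>)"
  proof (intro bexI conjI ballI)
    show "rank1 z \<in> vectors (HS (L2 M))" by (rule rank1_in_HS[OF z])
    show "vnorm (HS (L2 M)) (rank1 z) = 1" using HS_norm_has_sum[OF rank1_HS[OF z]] z1 by simp
    fix g assume g: "g \<in> K"
    define y where "y = Lam g z"
    have y: "y \<in> sq_int M" unfolding y_def by (rule Lam_sq_int[OF z])
    have y1: "sqn M y = 1" unfolding y_def by (simp add: sqn_Lam[OF z] z1)
    define \<delta> where "\<delta> = sqn M (\<lambda>x. y x - z x)"
    have yz: "(\<lambda>x. y x - z x) \<in> sq_int M" by (rule sq_int_diff[OF y z])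
    define D where "D e = sqn M (\<lambda>x. rep (rank1 y e) x - rep (rank1 z e) x)" for e
    \<comment> \<open>The bound for the summand \<open>D e\<close> that comes from
    \<open>\<parallel>a + b\<parallel>\<^sup>2 \<le> 2 \<parallel>a\<parallel>\<^sup>2 + 2
    \<parallel>b\<parallel>\<^sup>2\<close> applied to the decomposition above.\<close>
    define E where "E e = (2 * \<delta>) * (norm (ip M (rep e) y))\<^sup>2 + 2 * (norm (ip M (rep e) (\<lambda>x. y x - z x)))\<^sup>2" for e
    have DE: "D e \<le> E e" if e: "e \<in> basis" for e
    proof -
      have eL: "e \<in> vectors (L2 M)" by (rule basis_L2[OF e])
      have re: "rep e \<in> sq_int M" by (rule L2_vectorD(1)[OF eL])
      let ?a = "ip M (rep e) y" and ?b = "ip M (rep e) z"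
      have sy: "(\<lambda>x. ?a * y x) \<in> sq_int M" and sz: "(\<lambda>x. ?b * z x) \<in> sq_int M"
        by (intro sq_int_scale y z)+
      have p: "(\<lambda>x. ?a * (y x - z x)) \<in> sq_int M" by (rule sq_int_scale[OF yz])
      have q: "(\<lambda>x. (?a - ?b) * z x) \<in> sq_int M" by (rule sq_int_scale[OF z])
      have "D e = sqn M (\<lambda>x. ?a * y x - ?b * z x)"
        unfolding D_def rank1_apply[OF eL]
      proof (rule sqn_cong_AE)
        show "AE x in M. rep (ae_class M (\<lambda>x. ?a * y x)) x - rep (ae_class M (\<lambda>x. ?b * z x)) x = ?a * y x - ?b * z x"
          using rep_ae_class(2)[OF sq_intD(1)[OF sy]] rep_ae_class(2)[OF sq_intD(1)[OF sz]]
          by eventually_elim (simp only:)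
      qed (intro sq_intD(1) sq_int_diff rep_sq_int sy sz)+
      also have "(\<lambda>x. ?a * y x - ?b * z x) = (\<lambda>x. ?a * (y x - z x) + (?a - ?b) * z x)"
        by (simp add: algebra_simps)
      also have "sqn M \<dots> \<le> 2 * sqn M (\<lambda>x. ?a * (y x - z x)) + 2 * sqn M (\<lambda>x. (?a - ?b) * z x)"
      proof -
        have "sqn M (\<lambda>x. ?a * (y x - z x) + (?a - ?b) * z x)
            \<le> (\<integral>x. 2 * (norm (?a * (y x - z x)))\<^sup>2 + 2 * (norm ((?a - ?b) * z x))\<^sup>2 \<partial>M)"
          unfolding sqn_def using sq_intD(2)[OF sq_int_add[OF p q]] sq_intD(2)[OF p] sq_intD(2)[OF q]
          by (intro integral_mono norm_add_sq_le) auto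
        also have "\<dots> = 2 * sqn M (\<lambda>x. ?a * (y x - z x)) + 2 * sqn M (\<lambda>x. (?a - ?b) * z x)"
          unfolding sqn_def using sq_intD(2)[OF p] sq_intD(2)[OF q]
          by (subst Bochner_Integration.integral_add) simp_all
        finally show ?thesis .
      qed
      also have "\<dots> = E e"
        unfolding sqn_scale z1 E_def \<delta>_def ip_diff_right[OF y z re] by simp
      finally show ?thesis .
    qed
    have Esum: "(E has_sum ((2 * \<delta>) * sqn M y + 2 * \<delta>)) basis"
      unfolding E_def \<delta>_def by (intro has_sum_add has_sum_cmult_right coef_has_sum y yz)
    have Dsum: "(D has_sum infsum D basis) basis"
      by (intro has_sum_infsum summable_on_nonneg_le[OF has_sum_imp_summable[OF Esum]] DE)
         (simp add: D_def sqn_nonneg)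
    have "infsum D basis \<le> 4 * \<delta>" using has_sum_mono[OF Dsum Esum DE] y1 by simp
    also have "\<dots> < \<epsilon>\<^sup>2" using close[OF g] by (simp add: \<delta>_def y_def power_divide)
    finally have "sqrt (infsum D basis) < \<epsilon>" using \<epsilon> by (intro real_less_lsqrt) auto
    moreover have "vnorm (HS (L2 M)) (vdiff (HS (L2 M)) (rank1 y) (rank1 z)) = sqrt (infsum D basis)"
    proof (rule HS_norm_diff)
      fix e assume "e \<in> basis"
      then have eL: "e \<in> vectors (L2 M)" by (rule basis_L2)
      show "rank1 y e \<in> vectors (L2 M)" "rank1 z e \<in> vectors (L2 M)"
        unfolding rank1_apply[OF eL] by (intro ae_class_in_L2 sq_int_scale y z)+
    qed (use Dsum in \<open>simp add: D_def[abs_def]\<close>)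
    ultimately show "vnorm (HS (L2 M)) (vdiff (HS (L2 M)) (tensor_conj (L2 M) (lambda_rep M act) g (rank1 z)) (rank1 z)) < \<epsilon>"
      by (simp add: tensor_conj_rank1[OF z] y_def)
  qed
qed

section \<open>From Hilbert-Schmidt operators to an invariant mean\<close>

lemma bounded_operatorsD:
  assumes "T \<in> bounded_operators (L2 M)"
  shows "v \<in> vectors (L2 M) \<Longrightarrow> T v \<in> vectors (L2 M)"
    and "v \<in> vectors (L2 M) \<Longrightarrow> w \<in> vectors (L2 M) \<Longrightarrow> T (vadd (L2 M) v w) = vadd (L2 M) (T v) (T w)"
    and "v \<in> vectors (L2 M) \<Longrightarrow> T (vscale (L2 M) c v) = vscale (L2 M) c (T v)"
    and "\<exists>C\<ge>0. \<forall>v\<in>vectors (L2 M). vnorm (L2 M) (T v) \<le> C * vnorm (L2 M) v"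
proof -
  show "v \<in> vectors (L2 M) \<Longrightarrow> T v \<in> vectors (L2 M)"
    "v \<in> vectors (L2 M) \<Longrightarrow> w \<in> vectors (L2 M) \<Longrightarrow> T (vadd (L2 M) v w) = vadd (L2 M) (T v) (T w)"
    "v \<in> vectors (L2 M) \<Longrightarrow> T (vscale (L2 M) c v) = vscale (L2 M) c (T v)"
    using assms by (auto simp: bounded_operators_def)
  obtain C where C: "\<forall>v\<in>vectors (L2 M). vnorm (L2 M) (T v) \<le> C * vnorm (L2 M) v"
    using assms unfolding bounded_operators_def by blast
  have "vnorm (L2 M) (T v) \<le> \<bar>C\<bar> * vnorm (L2 M) v" if "v \<in> vectors (L2 M)" for v
  proof -
    have "C * vnorm (L2 M) v \<le> \<bar>C\<bar> * vnorm (L2 M) v"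
      by (intro mult_right_mono) (simp_all add: vnorm_L2 sqn_nonneg)
    then show ?thesis using bspec[OF C that] by simp
  qed
  then show "\<exists>C\<ge>0. \<forall>v\<in>vectors (L2 M). vnorm (L2 M) (T v) \<le> C * vnorm (L2 M) v"
    using abs_ge_zero by blast
qed

text \<open>
  Its Hilbert-Schmidt sum is \<open>Tr(w T T\<^sup>*)\<close>, so that statements on
  Hilbert-Schmidt sums become statements on the mean of \<open>T\<close>.
\<close>

definition weighted_op :: "('x \<Rightarrow> real) \<Rightarrow> (('x \<Rightarrow> complex) set \<Rightarrow> ('x \<Rightarrow> complex) set) \<Rightarrow> ('x \<Rightarrow> complex) \<Rightarrow> 'x \<Rightarrow> complex" where
  "weighted_op w T f = (\<lambda>x. complex_of_real (sqrt (w x)) * rep (T (ae_class M f)) x)"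

lemma weighted_op_bounded:
  assumes T: "T \<in> bounded_operators (L2 M)" and w[measurable]: "w \<in> borel_measurable M"
    and wb: "\<And>x. 0 \<le> w x" "\<And>x. w x \<le> C"
  shows "bounded_op M (weighted_op w T)"
  unfolding bounded_op_def
proof (intro conjI ballI allI)
  note TD = bounded_operatorsD[OF T]
  have sw_bd: "norm (complex_of_real (sqrt (w x))) \<le> sqrt C" for x
    using wb[of x] by simp
  have Tf: "rep (T (ae_class M f)) \<in> sq_int M" if "f \<in> sq_int M" for f
    using that by (intro L2_vectorD(1) TD(1) ae_class_in_L2)
  show sq: "weighted_op w T f \<in> sq_int M" if "f \<in> sq_int M" for f
    unfolding weighted_op_def using sw_bd
    by (intro sq_int_bounded_mult[where C = "sqrt C"] Tf that) auto
  show "AE x in M. weighted_op w T (\<lambda>x. f x + g x) x = weighted_op w T f x + weighted_op w T g x"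
    if f: "f \<in> sq_int M" and g: "g \<in> sq_int M" for f g
  proof -
    have "T (ae_class M (\<lambda>x. f x + g x)) = vadd (L2 M) (T (ae_class M f)) (T (ae_class M g))"
      unfolding vadd_L2[OF f g, symmetric] by (intro TD(2) ae_class_in_L2 f g)
    then show ?thesis
      using rep_vadd_L2[OF TD(1)[OF ae_class_in_L2[OF f]] TD(1)[OF ae_class_in_L2[OF g]]]
      unfolding weighted_op_def by (auto simp: distrib_left elim!: eventually_mono)
  qed
  show "AE x in M. weighted_op w T (\<lambda>x. c * f x) x = c * weighted_op w T f x"
    if f: "f \<in> sq_int M" for c f
  proof -
    have "T (ae_class M (\<lambda>x. c * f x)) = vscale (L2 M) c (T (ae_class M f))"
      unfolding vscale_L2[OF f, symmetric] by (intro TD(3) ae_class_in_L2 f)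
    then show ?thesis
      using rep_vscale_L2[OF TD(1)[OF ae_class_in_L2[OF f]], of c]
      unfolding weighted_op_def by (auto simp: mult_ac elim!: eventually_mono)
  qed
  obtain K where K: "K \<ge> 0" "\<And>v. v \<in> vectors (L2 M) \<Longrightarrow> vnorm (L2 M) (T v) \<le> K * vnorm (L2 M) v"
    using TD(4) by blast
  have C0: "0 \<le> C" using wb order_trans by blast
  have "sqrt (sqn M (weighted_op w T f)) \<le> (sqrt C * K) * sqrt (sqn M f)" if f: "f \<in> sq_int M" for f
  proof -
    have "sqn M (weighted_op w T f) \<le> (\<integral>x. C * (norm (rep (T (ae_class M f)) x))\<^sup>2 \<partial>M)"
      unfolding sqn_def
    proof (rule integral_mono)
      show "integrable M (\<lambda>x. (norm (weighted_op w T f x))\<^sup>2)" by (rule sq_intD(2)[OF sq[OF f]])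
      show "integrable M (\<lambda>x. C * (norm (rep (T (ae_class M f)) x))\<^sup>2)" using sq_intD(2)[OF Tf[OF f]] by simp
      show "(norm (weighted_op w T f x))\<^sup>2 \<le> C * (norm (rep (T (ae_class M f)) x))\<^sup>2" for x
        using wb[of x] by (simp add: weighted_op_def norm_mult power_mult_distrib mult_right_mono)
    qed
    also have "\<dots> = C * sqn M (rep (T (ae_class M f)))" by (simp add: sqn_def)
    finally have "sqrt (sqn M (weighted_op w T f)) \<le> sqrt (C * sqn M (rep (T (ae_class M f))))"
      by (rule real_sqrt_le_mono)
    also have "\<dots> = sqrt C * vnorm (L2 M) (T (ae_class M f))" by (simp add: real_sqrt_mult vnorm_L2)
    also have "\<dots> \<le> sqrt C * (K * vnorm (L2 M) (ae_class M f))"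
      using C0 by (intro mult_left_mono K ae_class_in_L2 f) auto
    finally show ?thesis by (simp add: vnorm_L2 sqn_rep[OF f] mult.assoc)
  qed
  then show "\<exists>C\<ge>0. \<forall>f\<in>sq_int M. sqrt (sqn M (weighted_op w T f)) \<le> C * sqrt (sqn M f)"
    using C0 K(1) by (intro exI[of _ "sqrt C * K"]) auto
qed

text \<open>
  The functional \<open>\<phi> \<mapsto> Tr(\<phi> T T\<^sup>*)\<close>, where
  \<open>\<phi>\<close> acts by multiplication.
\<close>

definition diag :: "(('x \<Rightarrow> complex) set \<Rightarrow> ('x \<Rightarrow> complex) set) \<Rightarrow> ('x \<Rightarrow> complex) \<Rightarrow> complex" where
  "diag T \<phi> = (\<Sum>\<^sub>\<infinity>e\<in>basis. \<integral>x. \<phi> x * complex_of_real ((norm (rep (T e) x))\<^sup>2) \<partial>M)"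

text \<open>
  The unit sphere of the space of Hilbert-Schmidt operators.
\<close>

definition unit_HS :: "(('x \<Rightarrow> complex) set \<Rightarrow> ('x \<Rightarrow> complex) set) \<Rightarrow> bool" where
  "unit_HS T \<longleftrightarrow> T \<in> bounded_operators (L2 M) \<and> ((\<lambda>e. sqn M (rep (T e))) has_sum 1) basis"

lemma unit_HS_iff: "unit_HS T \<longleftrightarrow> T \<in> vectors (HS (L2 M)) \<and> vnorm (HS (L2 M)) T = 1"
proof
  assume "unit_HS T"
  then show "T \<in> vectors (HS (L2 M)) \<and> vnorm (HS (L2 M)) T = 1"
    using HS_norm_has_sum[of T 1] by (auto simp: unit_HS_def vectors_HS intro: has_sum_imp_summable)
next
  assume T: "T \<in> vectors (HS (L2 M)) \<and> vnorm (HS (L2 M)) T = 1"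
  then have s: "((\<lambda>e. sqn M (rep (T e))) has_sum infsum (\<lambda>e. sqn M (rep (T e))) basis) basis"
    by (auto simp: vectors_HS)
  from HS_norm_has_sum[OF s] T have "infsum (\<lambda>e. sqn M (rep (T e))) basis = 1" by simp
  with s T show "unit_HS T" by (simp add: unit_HS_def vectors_HS)
qed

lemma ess_boundedE:
  assumes "f \<in> ess_bounded M"
  obtains C where "f \<in> borel_measurable M" "0 \<le> C" "AE x in M. norm (f x) \<le> C"
proof -
  obtain C where C: "f \<in> borel_measurable M" "AE x in M. norm (f x) \<le> C"
    using assms by (auto simp: ess_bounded_def)
  have "AE x in M. norm (f x) \<le> \<bar>C\<bar>" using C(2) by eventually_elim simp
  with C(1) show ?thesis by (intro that[of "\<bar>C\<bar>"]) auto
qed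

context
  fixes T assumes T: "unit_HS T"
begin

lemma T_bounded: "T \<in> bounded_operators (L2 M)"
  using T by (simp add: unit_HS_def)

lemma T_L2: "v \<in> vectors (L2 M) \<Longrightarrow> T v \<in> vectors (L2 M)"
  by (rule bounded_operatorsD(1)[OF T_bounded])

lemma T_sq: "e \<in> basis \<Longrightarrow> rep (T e) \<in> sq_int M"
  by (rule L2_vectorD(1)[OF T_L2[OF basis_L2]])

lemma diag_integrable:
  assumes "f \<in> ess_bounded M" "e \<in> basis"
  shows "integrable M (\<lambda>x. f x * complex_of_real ((norm (rep (T e) x))\<^sup>2))"
proof -
  obtain C where C: "f \<in> borel_measurable M" "0 \<le> C" "AE x in M. norm (f x) \<le> C"
    using assms(1) by (rule ess_boundedE)
  note [measurable] = C(1) sq_intD(1)[OF T_sq[OF assms(2)]]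
  have "integrable M (\<lambda>x. C * (norm (rep (T e) x))\<^sup>2)" using sq_intD(2)[OF T_sq[OF assms(2)]] by simp
  then show ?thesis
  proof (rule Bochner_Integration.integrable_bound)
    show "AE x in M. norm (f x * complex_of_real ((norm (rep (T e) x))\<^sup>2)) \<le> norm (C * (norm (rep (T e) x))\<^sup>2)"
      using C(3) by eventually_elim (simp add: norm_mult norm_power abs_mult C(2) mult_right_mono)
  qed measurable
qed

lemma diag_term_bound:
  assumes "f \<in> borel_measurable M" "AE x in M. norm (f x) \<le> C" "e \<in> basis"
  shows "norm (\<integral>x. f x * complex_of_real ((norm (rep (T e) x))\<^sup>2) \<partial>M) \<le> C * sqn M (rep (T e))"
proof -
  have fb: "f \<in> ess_bounded M" using assms by (auto simp: ess_bounded_def)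
  have 1: "norm (\<integral>x. f x * complex_of_real ((norm (rep (T e) x))\<^sup>2) \<partial>M)
      \<le> (\<integral>x. norm (f x * complex_of_real ((norm (rep (T e) x))\<^sup>2)) \<partial>M)"
    by (rule integral_norm_bound)
  have 2: "(\<integral>x. norm (f x * complex_of_real ((norm (rep (T e) x))\<^sup>2)) \<partial>M) \<le> (\<integral>x. C * (norm (rep (T e) x))\<^sup>2 \<partial>M)"
  proof (rule integral_mono_AE)
    show "integrable M (\<lambda>x. norm (f x * complex_of_real ((norm (rep (T e) x))\<^sup>2)))"
      using diag_integrable[OF fb assms(3)] by (rule integrable_norm)
    show "integrable M (\<lambda>x. C * (norm (rep (T e) x))\<^sup>2)" using sq_intD(2)[OF T_sq[OF assms(3)]] by simp
    show "AE x in M. norm (f x * complex_of_real ((norm (rep (T e) x))\<^sup>2)) \<le> C * (norm (rep (T e) x))\<^sup>2"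
      using assms(2) by eventually_elim (simp add: norm_mult norm_power mult_right_mono)
  qed
  have 3: "(\<integral>x. C * (norm (rep (T e) x))\<^sup>2 \<partial>M) = C * sqn M (rep (T e))"
    unfolding sqn_def by (rule integral_mult_right_zero)
  show ?thesis by (rule order_trans[OF 1 2[unfolded 3]])
qed

lemma diag_has_sum:
  assumes "f \<in> ess_bounded M"
  shows "((\<lambda>e. \<integral>x. f x * complex_of_real ((norm (rep (T e) x))\<^sup>2) \<partial>M) has_sum diag T f) basis"
proof -
  obtain C where C: "f \<in> borel_measurable M" "0 \<le> C" "AE x in M. norm (f x) \<le> C"
    using assms(1) by (rule ess_boundedE)
  have "(\<lambda>e. C * sqn M (rep (T e))) summable_on basis"
    using T by (intro summable_on_cmult_right) (auto simp: unit_HS_def intro: has_sum_imp_summable)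
  then have "(\<lambda>e. norm (\<integral>x. f x * complex_of_real ((norm (rep (T e) x))\<^sup>2) \<partial>M)) summable_on basis"
    by (rule summable_on_nonneg_le) (simp_all only: diag_term_bound[OF C(1,3)] norm_ge_zero)
  from has_sum_infsum[OF Infinite_Sum.abs_summable_summable[OF this]]
  show ?thesis unfolding diag_def .
qed

lemma diag_add:
  assumes "f \<in> ess_bounded M" "h \<in> ess_bounded M"
  shows "diag T (\<lambda>x. f x + h x) = diag T f + diag T h"
proof -
  have "((\<lambda>e. \<integral>x. (f x + h x) * complex_of_real ((norm (rep (T e) x))\<^sup>2) \<partial>M) has_sum (diag T f + diag T h)) basis"
    using has_sum_add[OF diag_has_sum[OF assms(1)] diag_has_sum[OF assms(2)]]
    by (rule has_sum_cong[THEN iffD1, rotated]) (simp add: distrib_right diag_integrable assms del: of_real_power)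
  then show ?thesis unfolding diag_def by (rule infsumI)
qed

lemma diag_scale: "diag T (\<lambda>x. c * f x) = c * diag T f"
  unfolding diag_def by (simp add: mult.assoc infsum_cmult_right')

lemma diag_cong_AE:
  assumes "f \<in> borel_measurable M" "h \<in> borel_measurable M" "AE x in M. f x = h x"
  shows "diag T f = diag T h"
  unfolding diag_def
proof (rule infsum_cong)
  fix e assume "e \<in> basis"
  note [measurable] = assms(1,2) sq_intD(1)[OF T_sq[OF this]]
  show "(\<integral>x. f x * complex_of_real ((norm (rep (T e) x))\<^sup>2) \<partial>M) = (\<integral>x. h x * complex_of_real ((norm (rep (T e) x))\<^sup>2) \<partial>M)"
    using assms(3) by (intro integral_cong_AE) (auto elim: eventually_mono)
qed

lemma diag_bound:
  assumes "f \<in> borel_measurable M" "AE x in M. norm (f x) \<le> C"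
  shows "norm (diag T f) \<le> C"
proof -
  have fb: "f \<in> ess_bounded M" using assms by (auto simp: ess_bounded_def)
  have 1: "((\<lambda>e. C * sqn M (rep (T e))) has_sum C * 1) basis"
    using T by (intro has_sum_cmult_right) (auto simp: unit_HS_def)
  have 2: "(\<lambda>e. norm (\<integral>x. f x * complex_of_real ((norm (rep (T e) x))\<^sup>2) \<partial>M)) summable_on basis"
    by (rule summable_on_nonneg_le[OF has_sum_imp_summable[OF 1]]) (simp_all only: diag_term_bound[OF assms] norm_ge_zero)
  have "norm (diag T f) \<le> infsum (\<lambda>e. norm (\<integral>x. f x * complex_of_real ((norm (rep (T e) x))\<^sup>2) \<partial>M)) basis"
    unfolding diag_def using 2 by (rule norm_infsum_bound)
  also have "\<dots> \<le> C * 1"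
    by (rule has_sum_mono[OF has_sum_infsum[OF 2] 1]) (rule diag_term_bound[OF assms])
  finally show ?thesis by simp
qed

text \<open>
  The restriction of \<open>diag\<close> to bounded nonnegative functions, where inequalities
  can be stated.
\<close>

definition rdiag :: "('x \<Rightarrow> real) \<Rightarrow> real" where
  "rdiag w = (\<Sum>\<^sub>\<infinity>e\<in>basis. \<integral>x. w x * (norm (rep (T e) x))\<^sup>2 \<partial>M)"

lemma rdiag_has_sum:
  assumes [measurable]: "w \<in> borel_measurable M" and w: "\<And>x. 0 \<le> w x" "\<And>x. w x \<le> C"
  shows "((\<lambda>e. \<integral>x. w x * (norm (rep (T e) x))\<^sup>2 \<partial>M) has_sum rdiag w) basis"
    and "diag T (\<lambda>x. complex_of_real (w x)) = complex_of_real (rdiag w)"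
proof -
  have fb: "(\<lambda>x. complex_of_real (w x)) \<in> ess_bounded M"
    using w by (auto simp: ess_bounded_def intro!: exI[of _ C])
  have eq: "(\<integral>x. complex_of_real (w x) * complex_of_real ((norm (rep (T e) x))\<^sup>2) \<partial>M)
      = complex_of_real (\<integral>x. w x * (norm (rep (T e) x))\<^sup>2 \<partial>M)" for e
    by (simp only: of_real_mult[symmetric] integral_complex_of_real)
  have hs: "((\<lambda>e. complex_of_real (\<integral>x. w x * (norm (rep (T e) x))\<^sup>2 \<partial>M)) has_sum diag T (\<lambda>x. complex_of_real (w x))) basis"
    using diag_has_sum[OF fb] by (simp only: eq)
  then have "(\<lambda>e. Re (complex_of_real (\<integral>x. w x * (norm (rep (T e) x))\<^sup>2 \<partial>M))) summable_on basis"
    by (intro summable_on_Re) (rule has_sum_imp_summable)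
  then show 1: "((\<lambda>e. \<integral>x. w x * (norm (rep (T e) x))\<^sup>2 \<partial>M) has_sum rdiag w) basis"
    unfolding rdiag_def by (intro has_sum_infsum) simp
  then have "((\<lambda>e. complex_of_real (\<integral>x. w x * (norm (rep (T e) x))\<^sup>2 \<partial>M)) has_sum complex_of_real (rdiag w)) basis"
    by (simp only: has_sum_of_real_iff)
  with hs show "diag T (\<lambda>x. complex_of_real (w x)) = complex_of_real (rdiag w)"
    by (rule has_sum_unique)
qed

lemma diag_pos:
  assumes f: "f \<in> ess_bounded M" and pos: "AE x in M. f x \<in> \<real>\<^sub>\<ge>\<^sub>0"
  shows "diag T f \<in> \<real>\<^sub>\<ge>\<^sub>0"
proof -
  obtain C where C: "f \<in> borel_measurable M" "0 \<le> C" "AE x in M. norm (f x) \<le> C"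
    using f by (rule ess_boundedE)
  note [measurable] = C(1)
  define w where "w x = max 0 (min C (Re (f x)))" for x
  have [measurable]: "w \<in> borel_measurable M" unfolding w_def[abs_def] by measurable
  have w: "0 \<le> w x" "w x \<le> C" for x using C(2) by (auto simp: w_def)
  have "AE x in M. f x = complex_of_real (w x)"
    using C(3) pos
  proof eventually_elim
    case (elim x)
    then obtain r where r: "f x = complex_of_real r" "0 \<le> r" by (auto elim: nonneg_Reals_cases)
    then show ?case using elim by (simp add: w_def)
  qed
  then have "diag T f = diag T (\<lambda>x. complex_of_real (w x))"
    by (intro diag_cong_AE) auto
  moreover have "0 \<le> rdiag w"
    using w by (intro has_sum_nonneg[OF rdiag_has_sum(1)[OF _ w]]) auto
  ultimately show ?thesis using rdiag_has_sum(2)[OF _ w] by simp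
qed

lemma diag_one: "diag T (\<lambda>x. 1) = 1"
proof -
  have "((\<lambda>e. complex_of_real (sqn M (rep (T e)))) has_sum complex_of_real 1) basis"
    using T unfolding has_sum_of_real_iff by (simp add: unit_HS_def)
  moreover have "(\<integral>x. 1 * complex_of_real ((norm (rep (T e) x))\<^sup>2) \<partial>M) = complex_of_real (sqn M (rep (T e)))" for e
    by (simp only: mult_1 integral_complex_of_real sqn_def)
  ultimately show ?thesis unfolding diag_def by (simp only:) (simp add: infsumI)
qed

lemma tensor_conj_apply:
  "e \<in> basis \<Longrightarrow> tensor_conj (L2 M) (lambda_rep M act) g T e = lambda_rep M act g (T (lambda_rep M act (- g) e))"
  by (simp add: tensor_conj_def basis_L2)

lemma tensor_conj_in_L2:
  "e \<in> basis \<Longrightarrow> tensor_conj (L2 M) (lambda_rep M act) g T e \<in> vectors (L2 M)"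
  unfolding tensor_conj_apply by (intro lambda_rep_in_L2 T_L2 basis_L2)

text \<open>
  The translated weight and the conjugated operator transform together: the summand for
  \<open>e\<close> is the weighted norm of \<open>T\<close> at \<open>\<lambda>(- g)
  e\<close>. The translates of the basis vectors are orthonormal again, so
  \<open>Hilbert_Schmidt_orthonormal_le\<close> applies.
\<close>

lemma rdiag_tensor_conj:
  assumes w[measurable]: "w \<in> borel_measurable M" and wb: "\<And>x. 0 \<le> w x" "\<And>x. w x \<le> C" and F: "finite F" "F \<subseteq> basis"
  shows "(\<Sum>e\<in>F. \<integral>x. w (act (- g) x) * (norm (rep (tensor_conj (L2 M) (lambda_rep M act) g T e) x))\<^sup>2 \<partial>M) \<le> rdiag w"
proof -
  have Tb: "T \<in> bounded_operators (L2 M)" using T by (simp add: unit_HS_def)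
  note TD = bounded_operatorsD[OF Tb]
  have weighted: "sqn M (weighted_op w T f) = (\<integral>x. w x * (norm (rep (T (ae_class M f)) x))\<^sup>2 \<partial>M)" for f
    using wb(1) by (simp add: sqn_def weighted_op_def norm_mult power_mult_distrib)
  have summand: "(\<integral>x. w (act (- g) x) * (norm (rep (tensor_conj (L2 M) (lambda_rep M act) g T e) x))\<^sup>2 \<partial>M)
      = sqn M (weighted_op w T (Lam (- g) (rep e)))" if e: "e \<in> basis" for e
  proof -
    have eL: "e \<in> vectors (L2 M)" by (rule basis_L2[OF e])
    define u where "u = T (lambda_rep M act (- g) e)"
    have u: "u \<in> vectors (L2 M)" unfolding u_def by (intro TD(1) lambda_rep_in_L2 eL)
    note [measurable] = sq_intD(1)[OF L2_vectorD(1)[OF u]] sq_intD(1)[OF L2_vectorD(1)[OF lambda_rep_in_L2[OF u]]]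
      Lam_measurable[OF sq_intD(1)[OF L2_vectorD(1)[OF u]]]
    have "(\<integral>x. w (act (- g) x) * (norm (rep (lambda_rep M act g u) x))\<^sup>2 \<partial>M)
        = (\<integral>x. w (act (- g) x) * (norm (Lam g (rep u) x))\<^sup>2 \<partial>M)"
    proof (rule integral_cong_AE)
      show "AE x in M. w (act (- g) x) * (norm (rep (lambda_rep M act g u) x))\<^sup>2
          = w (act (- g) x) * (norm (Lam g (rep u) x))\<^sup>2"
        using rep_lambda_rep[OF u, of g] by eventually_elim simp
    qed measurable
    also have "\<dots> = (\<integral>x. w x * (norm (rep u x))\<^sup>2 \<partial>M)"
      by (rule sqn_weighted_Lam) measurable
    also have "\<dots> = sqn M (weighted_op w T (Lam (- g) (rep e)))"
      unfolding weighted u_def lambda_rep_eq ..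
    finally show ?thesis by (simp add: tensor_conj_apply[OF e] u_def)
  qed
  have S: "((\<lambda>e. sqn M (weighted_op w T (rep e))) has_sum rdiag w) basis"
  proof -
    have "sqn M (weighted_op w T (rep e)) = (\<integral>x. w x * (norm (rep (T e) x))\<^sup>2 \<partial>M)" if "e \<in> basis" for e
      unfolding weighted L2_vectorD(2)[OF basis_L2[OF that]] ..
    then show ?thesis using rdiag_has_sum(1)[OF w wb] by (simp cong: has_sum_cong)
  qed
  have "(\<Sum>e\<in>F. sqn M (weighted_op w T (Lam (- g) (rep e)))) \<le> rdiag w"
    using F by (intro B.Hilbert_Schmidt_orthonormal_le[OF weighted_op_bounded[OF Tb w wb] _ _ _ S])
      (auto simp: ip_Lam B.e_sq B.e_ip subset_iff intro!: Lam_sq_int)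
  then show ?thesis using summand F by (simp add: subset_iff cong: sum.cong)
qed

text \<open>
  Compares \<open>T\<close> with its conjugate \<open>T'\<close> through the inequality
  \<open>\<bar>b\<bar>\<^sup>2 \<le> (1 + \<delta>) \<bar>a\<bar>\<^sup>2 + (1 + 1/\<delta>)
  \<bar>a - b\<bar>\<^sup>2\<close>. The sum of the second terms is of order
  \<open>\<delta>\<^sup>2 / \<delta> = \<delta>\<close>, and the mean of \<open>T'\<close> at
  the translated weight is bounded by \<open>rdiag_tensor_conj\<close>. Only an upper bound
  results; the lower one is obtained from \<open>- g\<close> in the limit.
\<close>

lemma rdiag_almost_invariant:
  assumes w[measurable]: "w \<in> borel_measurable M" and wb: "\<And>x. 0 \<le> w x" "\<And>x. w x \<le> C" and C: "0 \<le> C"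
    and \<delta>: "0 < \<delta>"
    and close: "vnorm (HS (L2 M)) (vdiff (HS (L2 M)) (tensor_conj (L2 M) (lambda_rep M act) g T) T) < \<delta>"
  shows "rdiag (\<lambda>x. w (act (- g) x)) \<le> rdiag w + C * (2 * \<delta> + \<delta>\<^sup>2)"
proof -
  define T' where "T' = tensor_conj (L2 M) (lambda_rep M act) g T"
  define w' where "w' x = w (act (- g) x)" for x
  have w'm[measurable]: "w' \<in> borel_measurable M" unfolding w'_def[abs_def] by measurable
  have w'b: "0 \<le> w' x" "w' x \<le> C" for x using wb by (auto simp: w'_def)
  have T'L: "T' e \<in> vectors (L2 M)" if "e \<in> basis" for e unfolding T'_def by (rule tensor_conj_in_L2[OF that])
  have T'sq: "rep (T' e) \<in> sq_int M" if "e \<in> basis" for e by (rule L2_vectorD(1)[OF T'L[OF that]])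
  have TL: "T e \<in> vectors (L2 M)" if "e \<in> basis" for e
    by (rule T_L2[OF basis_L2[OF that]])
  define D where "D e = sqn M (\<lambda>x. rep (T' e) x - rep (T e) x)" for e
  have D0: "0 \<le> D e" for e by (simp add: D_def sqn_nonneg)
  have summ': "(\<lambda>e. sqn M (rep (T' e))) summable_on basis"
  proof (rule nonneg_bdd_above_summable_on)
    \<comment> \<open>The weight 1 shows that the conjugate is Hilbert-Schmidt
    again.\<close>
    show "bdd_above (sum (\<lambda>e. sqn M (rep (T' e))) ` {F. F \<subseteq> basis \<and> finite F})"
      using rdiag_tensor_conj[of "\<lambda>x. 1" 1, where g = g]
      by (intro bdd_aboveI[of _ "rdiag (\<lambda>x. 1)"]) (auto simp: sqn_def T'_def)
  qed (simp add: sqn_nonneg)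
  have summ: "(\<lambda>e. sqn M (rep (T e))) summable_on basis"
    using T by (auto simp: unit_HS_def intro: has_sum_imp_summable)
  have "D e \<le> 2 * sqn M (rep (T' e)) + 2 * sqn M (rep (T e))" if e: "e \<in> basis" for e
  proof -
    have "0 \<le> sqn M (\<lambda>x. rep (T' e) x + rep (T e) x)" by (rule sqn_nonneg)
    then show ?thesis unfolding D_def sqn_diff[OF T'sq[OF e] T_sq[OF e]] sqn_add[OF T'sq[OF e] T_sq[OF e]] by simp
  qed
  then have "D summable_on basis"
    by (intro summable_on_nonneg_le[OF summable_on_add[OF summable_on_cmult_right[OF summ'] summable_on_cmult_right[OF summ]] D0])
  then have Dsum: "(D has_sum infsum D basis) basis" by (rule has_sum_infsum)
  have "sqrt (infsum D basis) < \<delta>"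
    using close HS_norm_diff[where s = "infsum D basis", OF T'L TL] Dsum unfolding T'_def D_def[abs_def] by simp
  then have D\<delta>: "infsum D basis \<le> \<delta>\<^sup>2"
    using sqrt_le_D[of "infsum D basis" \<delta>] by simp
  define P where "P e = (\<integral>x. w' x * (norm (rep (T' e) x))\<^sup>2 \<partial>M)" for e
  have P0: "0 \<le> P e" for e unfolding P_def using w'b by simp
  have Ple: "sum P F \<le> rdiag w" if "finite F" "F \<subseteq> basis" for F
    unfolding P_def w'_def T'_def by (rule rdiag_tensor_conj[OF w wb that])
  have "P summable_on basis"
    using P0 Ple by (intro nonneg_bdd_above_summable_on bdd_aboveI[of _ "rdiag w"]) auto
  then have Psum: "(P has_sum infsum P basis) basis" by (rule has_sum_infsum)
  have P_le: "infsum P basis \<le> rdiag w" by (rule has_sum_le_finite_sums[OF Psum Ple])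
  have rw: "rdiag w \<le> C"
  proof -
    have 1: "((\<lambda>e. C * sqn M (rep (T e))) has_sum C * 1) basis"
      using T by (intro has_sum_cmult_right) (auto simp: unit_HS_def)
    have "rdiag w \<le> C * 1"
    proof (rule has_sum_mono[OF rdiag_has_sum(1)[OF w wb] 1])
      fix e assume e: "e \<in> basis"
      show "(\<integral>x. w x * (norm (rep (T e) x))\<^sup>2 \<partial>M) \<le> C * sqn M (rep (T e))"
        using diag_term_bound[of "\<lambda>x. complex_of_real (w x)" C e] wb e
        by (simp add: abs_le_iff flip: of_real_mult of_real_power)
    qed
    then show ?thesis by simp
  qed
  have "(\<integral>x. w' x * (norm (rep (T e) x))\<^sup>2 \<partial>M) \<le> (1 + \<delta>) * P e + ((1 + 1 / \<delta>) * C) * D e" if e: "e \<in> basis" for e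
  proof -
    note sqs = sq_intD(2)[OF T_sq[OF e]] sq_intD(2)[OF T'sq[OF e]] sq_intD(2)[OF sq_int_diff[OF T'sq[OF e] T_sq[OF e]]]
    note [measurable] = sq_intD(1)[OF T_sq[OF e]] sq_intD(1)[OF T'sq[OF e]]
    have wi: "integrable M (\<lambda>x. w' x * h x)" if "integrable M h" for h :: "'x \<Rightarrow> real"
    proof (rule Bochner_Integration.integrable_bound[OF integrable_mult_right[OF integrable_abs[OF that], of C]])
      show "(\<lambda>x. w' x * h x) \<in> borel_measurable M" using that by measurable
      show "AE x in M. norm (w' x * h x) \<le> norm (C * \<bar>h x\<bar>)"
        using w'b C by (intro AE_I2) (auto simp: abs_mult intro: mult_right_mono)
    qed
    have pt: "(norm b)\<^sup>2 \<le> (1 + \<delta>) * (norm a)\<^sup>2 + (1 + 1 / \<delta>) * (norm (a - b))\<^sup>2" for a b :: complex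
    proof -
      have "norm b \<le> norm a + norm (a - b)" by (metis norm_minus_commute norm_triangle_sub)
      then have "(norm b)\<^sup>2 \<le> (norm a + norm (a - b))\<^sup>2" by (intro power_mono) auto
      moreover have "0 \<le> (\<delta> * norm a - norm (a - b))\<^sup>2 / \<delta>" using \<delta> by simp
      then have "2 * norm a * norm (a - b) \<le> \<delta> * (norm a)\<^sup>2 + (1 / \<delta>) * (norm (a - b))\<^sup>2"
        using \<delta> by (simp add: power2_eq_square field_simps)
      ultimately show ?thesis by (simp add: power2_sum algebra_simps)
    qed
    have "(\<integral>x. w' x * (norm (rep (T e) x))\<^sup>2 \<partial>M)
        \<le> (\<integral>x. (1 + \<delta>) * (w' x * (norm (rep (T' e) x))\<^sup>2) + ((1 + 1 / \<delta>) * C) * (norm (rep (T' e) x - rep (T e) x))\<^sup>2 \<partial>M)"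
    proof (rule integral_mono)
      show "integrable M (\<lambda>x. w' x * (norm (rep (T e) x))\<^sup>2)" by (rule wi[OF sqs(1)])
      show "integrable M (\<lambda>x. (1 + \<delta>) * (w' x * (norm (rep (T' e) x))\<^sup>2) + ((1 + 1 / \<delta>) * C) * (norm (rep (T' e) x - rep (T e) x))\<^sup>2)"
        using wi[OF sqs(2)] sqs(3) by (intro Bochner_Integration.integrable_add integrable_mult_right)
      fix x
      have "w' x * (norm (rep (T e) x))\<^sup>2
          \<le> w' x * ((1 + \<delta>) * (norm (rep (T' e) x))\<^sup>2 + (1 + 1 / \<delta>) * (norm (rep (T' e) x - rep (T e) x))\<^sup>2)"
        by (intro mult_left_mono pt w'b)
      also have "\<dots> = (1 + \<delta>) * (w' x * (norm (rep (T' e) x))\<^sup>2) + w' x * ((1 + 1 / \<delta>) * (norm (rep (T' e) x - rep (T e) x))\<^sup>2)"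
        by (simp only: distrib_left mult.left_commute)
      also have "w' x * ((1 + 1 / \<delta>) * (norm (rep (T' e) x - rep (T e) x))\<^sup>2) \<le> C * ((1 + 1 / \<delta>) * (norm (rep (T' e) x - rep (T e) x))\<^sup>2)"
        using \<delta> w'b by (intro mult_right_mono) auto
      finally show "w' x * (norm (rep (T e) x))\<^sup>2
          \<le> (1 + \<delta>) * (w' x * (norm (rep (T' e) x))\<^sup>2) + ((1 + 1 / \<delta>) * C) * (norm (rep (T' e) x - rep (T e) x))\<^sup>2"
        by (simp only: mult_ac) 
    qed
    also have "\<dots> = (1 + \<delta>) * P e + ((1 + 1 / \<delta>) * C) * D e"
      using wi[OF sqs(2)] sqs(3) unfolding P_def D_def sqn_def by (subst Bochner_Integration.integral_add) simp_all
    finally show ?thesis .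
  qed
  then have "rdiag w' \<le> (1 + \<delta>) * infsum P basis + ((1 + 1 / \<delta>) * C) * infsum D basis"
    by (rule has_sum_mono[OF rdiag_has_sum(1)[OF w'm w'b] has_sum_add[OF has_sum_cmult_right[OF Psum] has_sum_cmult_right[OF Dsum]]])
  also have "\<dots> \<le> (1 + \<delta>) * rdiag w + ((1 + 1 / \<delta>) * C) * \<delta>\<^sup>2"
    using \<delta> C P_le D\<delta> by (intro add_mono mult_left_mono mult_nonneg_nonneg) auto
  also have "((1 + 1 / \<delta>) * C) * \<delta>\<^sup>2 = C * (\<delta> + \<delta>\<^sup>2)"
    using \<delta> by (simp add: power2_eq_square field_simps)
  also have "(1 + \<delta>) * rdiag w \<le> rdiag w + \<delta> * C"
    using rw \<delta> by (simp add: distrib_right mult_left_mono)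
  finally show ?thesis unfolding w'_def by (simp add: algebra_simps)
qed

end

abbreviation tens where "tens \<equiv> tensor_conj (L2 M) (lambda_rep M act)"

text \<open>
  Operators moved by less than \<open>1 / (n + 1)\<close> by every element of a finite set;
  finite sets are enough, since a mean is tested with one group element at a time.
\<close>

definition close_HS :: "'g set \<times> nat \<Rightarrow> (('x \<Rightarrow> complex) set \<Rightarrow> ('x \<Rightarrow> complex) set) set" where
  "close_HS p = {T. unit_HS T \<and> (\<forall>g\<in>fst p. vnorm (HS (L2 M)) (vdiff (HS (L2 M)) (tens g T) T) < 1 / real (Suc (snd p)))}"

definition HS_filter :: "(('x \<Rightarrow> complex) set \<Rightarrow> ('x \<Rightarrow> complex) set) filter" where
  "HS_filter = (INF p\<in>{p. finite (fst p)}. principal (close_HS p))"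

lemma HS_filter_not_bot:
  assumes "almost_has_invariant_vectors (HS (L2 M)) tens"
  shows "HS_filter \<noteq> bot"
proof -
  have ne: "close_HS p \<noteq> {}" if p: "finite (fst p)" for p
  proof -
    have "compact (fst p) \<and> 0 < 1 / real (Suc (snd p))" using p by (simp add: finite_imp_compact)
    from assms[unfolded almost_has_invariant_vectors_def, rule_format, OF this]
    obtain T where "T \<in> vectors (HS (L2 M))" "vnorm (HS (L2 M)) T = 1"
      "\<forall>g\<in>fst p. vnorm (HS (L2 M)) (vdiff (HS (L2 M)) (tens g T) T) < 1 / real (Suc (snd p))" by blast
    then have "T \<in> close_HS p" unfolding close_HS_def by (simp add: unit_HS_iff)
    then show ?thesis by blast
  qed
  have "(INF p\<in>{p. finite (fst p)}. principal (close_HS p)) = bot \<longleftrightarrow> (\<exists>p\<in>{p. finite (fst p)}. principal (close_HS p) = bot)"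
  proof (rule INF_filter_bot_base)
    fix p q :: "'g set \<times> nat" assume p: "p \<in> {p. finite (fst p)}" and q: "q \<in> {p. finite (fst p)}"
    define r where "r = (fst p \<union> fst q, max (snd p) (snd q))"
    have sub: "close_HS r \<subseteq> close_HS p \<inter> close_HS q"
    proof
      fix T assume T: "T \<in> close_HS r"
      have "1 / real (Suc (snd r)) \<le> 1 / real (Suc (snd p))" "1 / real (Suc (snd r)) \<le> 1 / real (Suc (snd q))"
        by (auto simp: r_def intro!: divide_left_mono)
      moreover have "T \<in> close_HS s" if s: "fst s \<subseteq> fst r" "1 / real (Suc (snd r)) \<le> 1 / real (Suc (snd s))" for s
        unfolding close_HS_def
      proof (intro CollectI conjI ballI)
        show "unit_HS T" using T by (simp add: close_HS_def)
        fix g assume "g \<in> fst s"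
        then have "vnorm (HS (L2 M)) (vdiff (HS (L2 M)) (tens g T) T) < 1 / real (Suc (snd r))"
          using T s(1) by (auto simp: close_HS_def)
        then show "vnorm (HS (L2 M)) (vdiff (HS (L2 M)) (tens g T) T) < 1 / real (Suc (snd s))"
          using s(2) by (rule less_le_trans)
      qed
      ultimately show "T \<in> close_HS p \<inter> close_HS q" by (simp add: r_def)
    qed
    have "r \<in> {p. finite (fst p)}" using p q by (simp add: r_def)
    then show "\<exists>k\<in>{p. finite (fst p)}. principal (close_HS k) \<le> inf (principal (close_HS p)) (principal (close_HS q))"
      using sub by (intro bexI[of _ r]) simp_all
  qed
  then show ?thesis using ne unfolding HS_filter_def by (auto simp: principal_eq_bot_iff)
qed

lemma eventually_close_HS: "finite F \<Longrightarrow> eventually (\<lambda>T. T \<in> close_HS (F, n)) HS_filter"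
  unfolding HS_filter_def by (rule eventually_INF1[of "(F, n)"]) (auto simp: eventually_principal)

lemma ess_bounded_translate:
  assumes "f \<in> ess_bounded M"
  shows "(\<lambda>x. f (act g x)) \<in> ess_bounded M"
proof -
  obtain C where C: "f \<in> borel_measurable M" "0 \<le> C" "AE x in M. norm (f x) \<le> C"
    using assms by (rule ess_boundedE)
  note [measurable] = C(1)
  have "(\<lambda>x. f (act g x)) \<in> borel_measurable M" by measurable
  then show ?thesis using AE_act[OF C(3), of g] by (auto simp: ess_bounded_def)
qed

text \<open>
  The limit \<open>m\<close> of the functionals \<open>diag T\<close> along an ultrafilter
  finer than \<open>HS_filter\<close> is a mean. In the limit
  \<open>rdiag_almost_invariant\<close> says that translating a bounded nonnegative function
  does not increase the value of \<open>m\<close>; the same for the inverse element gives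
  equality. A complex function is a combination of two nonnegative ones and a constant.
\<close>

theorem co_amenable_if_tensor:
  assumes "almost_has_invariant_vectors (HS (L2 M)) tens"
  shows "co_amenable M act"
proof -
  obtain U where U: "U \<le> HS_filter" "ultra U" using ultra_refines[OF HS_filter_not_bot[OF assms]] by blast
  have U_bot: "U \<noteq> bot" by (rule ultra_not_bot[OF U(2)])
  have ev_close: "eventually (\<lambda>T. T \<in> close_HS (F, n)) U" if "finite F" for F n
    by (rule filter_leD[OF U(1) eventually_close_HS[OF that]])
  have ev_unit: "eventually unit_HS U"
    using ev_close[of "{}" 0] by (auto simp: close_HS_def elim: eventually_mono)
  define m where "m A = Lim U (\<lambda>T. diag T (rep A))" for A
  have m: "((\<lambda>T. diag T f) \<longlongrightarrow> m (ae_class M f)) U" if f: "f \<in> ess_bounded M" for f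
  proof -
    obtain C where C: "f \<in> borel_measurable M" "0 \<le> C" "AE x in M. norm (f x) \<le> C"
      using f by (rule ess_boundedE)
    let ?r = "rep (ae_class M f)"
    have eq: "eventually (\<lambda>T. diag T ?r = diag T f) U"
      using ev_unit by eventually_elim (intro diag_cong_AE rep_ae_class C(1))
    have "eventually (\<lambda>T. diag T f \<in> cball 0 C) U"
      using ev_unit by eventually_elim (simp add: diag_bound C)
    with eq have "eventually (\<lambda>T. diag T ?r \<in> cball 0 C) U" by eventually_elim simp
    then have "((\<lambda>T. diag T ?r) \<longlongrightarrow> m (ae_class M f)) U"
      unfolding m_def by (rule ultra_tendsto_Lim[OF U(2) _ bounded_cball])
    then show ?thesis by (rule Lim_transform_eventually) (rule eq)
  qed
  have m_unique: "m (ae_class M f) = l" if "f \<in> ess_bounded M" "((\<lambda>T. diag T f) \<longlongrightarrow> l) U" for f l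
    by (rule tendsto_unique[OF U_bot m[OF that(1)] that(2)])
  have one: "(\<lambda>x. 1) \<in> ess_bounded M" by (auto simp: ess_bounded_def intro: exI[of _ 1])
  have add_b: "(\<lambda>x. f x + h x) \<in> ess_bounded M" if fh: "f \<in> ess_bounded M" "h \<in> ess_bounded M" for f h
  proof -
    obtain C where C: "f \<in> borel_measurable M" "0 \<le> C" "AE x in M. norm (f x) \<le> C"
      using fh(1) by (rule ess_boundedE)
    obtain D where D: "h \<in> borel_measurable M" "0 \<le> D" "AE x in M. norm (h x) \<le> D"
      using fh(2) by (rule ess_boundedE)
    have "AE x in M. norm (f x + h x) \<le> C + D"
      using C(3) D(3) by eventually_elim (rule norm_triangle_le, simp)
    then show ?thesis using C(1) D(1) by (auto simp: ess_bounded_def)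
  qed
  have scale_b: "(\<lambda>x. c * f x) \<in> ess_bounded M" if f: "f \<in> ess_bounded M" for c f
  proof -
    obtain C where C: "f \<in> borel_measurable M" "0 \<le> C" "AE x in M. norm (f x) \<le> C"
      using f by (rule ess_boundedE)
    have "AE x in M. norm (c * f x) \<le> norm c * C"
      using C(3) by eventually_elim (simp add: norm_mult mult_left_mono)
    then show ?thesis using C(1) by (auto simp: ess_bounded_def)
  qed
  have m_add: "m (ae_class M (\<lambda>x. f x + h x)) = m (ae_class M f) + m (ae_class M h)"
    if f: "f \<in> ess_bounded M" and h: "h \<in> ess_bounded M" for f h
  proof (rule m_unique[OF add_b[OF f h]])
    have "eventually (\<lambda>T. diag T f + diag T h = diag T (\<lambda>x. f x + h x)) U"
      using ev_unit by eventually_elim (simp add: diag_add f h)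
    then show "((\<lambda>T. diag T (\<lambda>x. f x + h x)) \<longlongrightarrow> m (ae_class M f) + m (ae_class M h)) U"
      by (rule Lim_transform_eventually[OF tendsto_add[OF m[OF f] m[OF h]]])
  qed
  have m_scale: "m (ae_class M (\<lambda>x. c * f x)) = c * m (ae_class M f)" if f: "f \<in> ess_bounded M" for c f
  proof (rule m_unique[OF scale_b[OF f]])
    have "eventually (\<lambda>T. c * diag T f = diag T (\<lambda>x. c * f x)) U"
      using ev_unit by eventually_elim (simp add: diag_scale)
    then show "((\<lambda>T. diag T (\<lambda>x. c * f x)) \<longlongrightarrow> c * m (ae_class M f)) U"
      by (rule Lim_transform_eventually[OF tendsto_mult[OF tendsto_const m[OF f]]])
  qed
  have m_pos: "m (ae_class M f) \<in> \<real>\<^sub>\<ge>\<^sub>0" if f: "f \<in> ess_bounded M" and pos: "AE x in M. f x \<in> \<real>\<^sub>\<ge>\<^sub>0" for f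
  proof (rule Lim_in_closed_set[OF closed_nonneg_Reals_complex _ U_bot m[OF f]])
    show "eventually (\<lambda>T. diag T f \<in> \<real>\<^sub>\<ge>\<^sub>0) U"
      using ev_unit by eventually_elim (intro diag_pos f pos)
  qed
  have m_one: "m (ae_class M (\<lambda>x. 1)) = 1"
  proof (rule m_unique[OF one])
    have "eventually (\<lambda>T. 1 = diag T (\<lambda>x. 1)) U"
      using ev_unit by eventually_elim (simp add: diag_one)
    then show "((\<lambda>T. diag T (\<lambda>x. 1)) \<longlongrightarrow> 1) U"
      by (rule Lim_transform_eventually[OF tendsto_const])
  qed
  have mean: "is_mean M m"
    unfolding is_mean_def using m_add m_scale m_pos m_one by blast
  have real_b: "(\<lambda>x. complex_of_real (w x)) \<in> ess_bounded M"
    if "w \<in> borel_measurable M" "\<And>x. 0 \<le> w x" "\<And>x. w x \<le> C" for w :: "'x \<Rightarrow> real" and C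
    using that by (auto simp: ess_bounded_def intro!: exI[of _ C])
  have le: "Re (m (ae_class M (\<lambda>x. complex_of_real (w (act (- g) x))))) \<le> Re (m (ae_class M (\<lambda>x. complex_of_real (w x))))"
    if w[measurable]: "w \<in> borel_measurable M" and wb: "\<And>x. 0 \<le> w x" "\<And>x. w x \<le> C" and C: "0 \<le> C"
    for w :: "'x \<Rightarrow> real" and C g
  proof -
    have w'm: "(\<lambda>x. w (act (- g) x)) \<in> borel_measurable M" by measurable
    let ?w = "\<lambda>x. complex_of_real (w x)" and ?w' = "\<lambda>x. complex_of_real (w (act (- g) x))"
    have bound: "Re (m (ae_class M ?w')) \<le> Re (m (ae_class M ?w)) + C * (2 * \<delta> + \<delta>\<^sup>2)"
      if \<delta>: "\<delta> = 1 / real (Suc n)" for \<delta> n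
    proof (rule tendsto_le[OF U_bot])
      show "((\<lambda>T. Re (diag T ?w) + C * (2 * \<delta> + \<delta>\<^sup>2)) \<longlongrightarrow> Re (m (ae_class M ?w)) + C * (2 * \<delta> + \<delta>\<^sup>2)) U"
        by (intro tendsto_add tendsto_Re m real_b[OF w wb] tendsto_const)
      show "((\<lambda>T. Re (diag T ?w')) \<longlongrightarrow> Re (m (ae_class M ?w'))) U"
        by (intro tendsto_Re m real_b[OF w'm wb])
      show "eventually (\<lambda>T. Re (diag T ?w') \<le> Re (diag T ?w) + C * (2 * \<delta> + \<delta>\<^sup>2)) U"
        using ev_close[of "{g}" n, simplified]
      proof eventually_elim
        case (elim T)
        then have T: "unit_HS T" and cl: "vnorm (HS (L2 M)) (vdiff (HS (L2 M)) (tens g T) T) < \<delta>"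
          by (simp_all add: close_HS_def \<delta>)
        have "0 < \<delta>" by (simp add: \<delta>)
        from rdiag_almost_invariant[OF T w wb C this cl]
        show ?case
          by (simp add: rdiag_has_sum(2)[OF T w wb] rdiag_has_sum(2)[OF T w'm wb])
      qed
    qed
    have lim: "(\<lambda>n. Re (m (ae_class M ?w)) + C * (2 * (1 / real (Suc n)) + (1 / real (Suc n))\<^sup>2))
        \<longlonglongrightarrow> Re (m (ae_class M ?w)) + C * (2 * 0 + 0\<^sup>2)"
      by (intro tendsto_add tendsto_mult tendsto_power tendsto_const LIMSEQ_Suc[OF lim_1_over_n])
    show ?thesis
      using LIMSEQ_le_const[OF lim] bound by auto
  qed
  have eq_real: "m (ae_class M (\<lambda>x. complex_of_real (w (act (- g) x)))) = m (ae_class M (\<lambda>x. complex_of_real (w x)))"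
    if w[measurable]: "w \<in> borel_measurable M" and wb: "\<And>x. 0 \<le> w x" "\<And>x. w x \<le> C" and C: "0 \<le> C"
    for w :: "'x \<Rightarrow> real" and C g
  proof -
    have w'm: "(\<lambda>x. w (act (- g) x)) \<in> borel_measurable M" by measurable
    have "Re (m (ae_class M (\<lambda>x. complex_of_real (w (act (- g) (act (- (- g)) x))))))
        \<le> Re (m (ae_class M (\<lambda>x. complex_of_real (w (act (- g) x)))))"
      by (rule le[OF w'm wb C])
    also have "ae_class M (\<lambda>x. complex_of_real (w (act (- g) (act (- (- g)) x)))) = ae_class M (\<lambda>x. complex_of_real (w x))"
      by (intro ae_class_cong AE_I2) (auto simp: act_minus)
    finally have "Re (m (ae_class M (\<lambda>x. complex_of_real (w (act (- g) x))))) = Re (m (ae_class M (\<lambda>x. complex_of_real (w x))))"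
      using le[OF w wb C, of g] by simp
    moreover have "m (ae_class M (\<lambda>x. complex_of_real (w (act (- g) x)))) \<in> \<real>\<^sub>\<ge>\<^sub>0"
      "m (ae_class M (\<lambda>x. complex_of_real (w x))) \<in> \<real>\<^sub>\<ge>\<^sub>0"
      using wb by (auto intro!: m_pos real_b[OF w'm wb] real_b[OF w wb])
    ultimately show ?thesis by (auto simp: complex_eq_iff complex_nonneg_Reals_iff)
  qed
  have "m (ae_class M (\<lambda>x. f (act (- g) x))) = m (ae_class M f)" if f: "f \<in> ess_bounded M" for f g
  proof -
    obtain C where C: "f \<in> borel_measurable M" "0 \<le> C" "AE x in M. norm (f x) \<le> C"
      using f by (rule ess_boundedE)
    note [measurable] = C(1)
    \<comment> \<open>Real and imaginary part are shifted by \<open>C\<close> to become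
    nonnegative. They are truncated because the bound on \<open>f\<close> holds almost
    everywhere only.\<close>
    define u where "u x = max 0 (min (2 * C) (Re (f x) + C))" for x
    define v where "v x = max 0 (min (2 * C) (Im (f x) + C))" for x
    have [measurable]: "u \<in> borel_measurable M" "v \<in> borel_measurable M"
      unfolding u_def[abs_def] v_def[abs_def] by measurable
    have uv: "0 \<le> u x" "u x \<le> 2 * C" "0 \<le> v x" "v x \<le> 2 * C" for x using C(2) by (auto simp: u_def v_def)
    let ?U = "\<lambda>x. complex_of_real (u x)" and ?V = "\<lambda>x. complex_of_real (v x)"
    let ?c = "- (complex_of_real C + \<i> * complex_of_real C)"
    define h where "h = (\<lambda>x. (?U x + \<i> * ?V x) + ?c * 1)"
    have h_eq: "AE x in M. f x = h x"
      using C(3)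
    proof eventually_elim
      case (elim x)
      then have "\<bar>Re (f x)\<bar> \<le> C" "\<bar>Im (f x)\<bar> \<le> C"
        using abs_Re_le_cmod[of "f x"] abs_Im_le_cmod[of "f x"] by linarith+
      then show ?case by (auto simp: h_def u_def v_def complex_eq_iff)
    qed
    have hm[measurable]: "h \<in> borel_measurable M" unfolding h_def by measurable
    have Ub: "?U \<in> ess_bounded M" and Vb: "?V \<in> ess_bounded M"
      using uv by (auto intro!: real_b[of _ "2 * C"])
    have val: "m (ae_class M (\<lambda>x. (p x + \<i> * q x) + ?c * 1)) = (m (ae_class M p) + \<i> * m (ae_class M q)) + ?c"
      if "p \<in> ess_bounded M" "q \<in> ess_bounded M" for p q
    proof -
      have "m (ae_class M (\<lambda>x. (p x + \<i> * q x) + ?c * 1))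
          = m (ae_class M (\<lambda>x. p x + \<i> * q x)) + m (ae_class M (\<lambda>x. ?c * 1))"
        by (rule m_add) (intro add_b scale_b that one)+
      also have "m (ae_class M (\<lambda>x. p x + \<i> * q x)) = m (ae_class M p) + m (ae_class M (\<lambda>x. \<i> * q x))"
        by (rule m_add) (intro add_b scale_b that one)+
      also have "m (ae_class M (\<lambda>x. \<i> * q x)) = \<i> * m (ae_class M q)" by (rule m_scale[OF that(2)])
      also have "m (ae_class M (\<lambda>x. ?c * 1)) = ?c * 1" unfolding m_scale[OF one] m_one ..
      finally show ?thesis by simp
    qed
    have "ae_class M (\<lambda>x. f (act (- g) x)) = ae_class M (\<lambda>x. h (act (- g) x))"
      using AE_act[OF h_eq] by (intro ae_class_cong) auto
    then have "m (ae_class M (\<lambda>x. f (act (- g) x))) = m (ae_class M (\<lambda>x. h (act (- g) x)))" by simp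
    also have "\<dots> = (m (ae_class M (\<lambda>x. ?U (act (- g) x))) + \<i> * m (ae_class M (\<lambda>x. ?V (act (- g) x)))) + ?c"
      unfolding h_def by (intro val ess_bounded_translate Ub Vb)
    also have "\<dots> = (m (ae_class M ?U) + \<i> * m (ae_class M ?V)) + ?c"
      using C(2) uv by (simp add: eq_real[where C = "2 * C"])
    also have "\<dots> = m (ae_class M h)" unfolding h_def by (intro val[symmetric] Ub Vb)
    also have "ae_class M h = ae_class M f" using h_eq by (intro ae_class_cong) (auto elim: eventually_mono)
    finally show ?thesis .
  qed
  with mean show ?thesis unfolding co_amenable_def by blast
qed

end

section \<open>Averages over the group and invariant means\<close>

lemma left_continuous_probD:
  assumes "left_continuous_prob \<rho>"
  shows "prob_space \<rho>" "sets \<rho> = sets borel" "space \<rho> = UNIV"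
  using assms sets_eq_imp_space_eq[of \<rho> borel] by (auto simp: left_continuous_prob_def)

lemma left_continuous_prob_nbhd:
  assumes "left_continuous_prob \<rho>" "0 < e"
  obtains U where "open U" "0 \<in> U"
    "\<forall>u\<in>U. shift_close \<rho> e u"
  using assms unfolding left_continuous_prob_def by blast

text \<open>
  Translating the translated measure by \<open>u\<close> is the same as translating
  \<open>\<rho>\<close> by the conjugate \<open>- g + u + g\<close>, which is near 0 together
  with \<open>u\<close>.
\<close>

lemma left_continuous_prob_translate:
  fixes \<rho> :: "'g::topological_group_add measure"
  assumes \<rho>: "left_continuous_prob \<rho>"
  shows "left_continuous_prob (distr \<rho> borel ((+) g))"
  unfolding left_continuous_prob_def
proof (intro conjI allI impI)
  have m: "(+) a \<in> measurable \<rho> borel" for a :: 'g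
    unfolding measurable_cong_sets[OF left_continuous_probD(2)[OF \<rho>] refl]
    by (intro borel_measurable_continuous_onI continuous_intros)
  show "prob_space (distr \<rho> borel ((+) g))"
    by (rule prob_space.prob_space_distr[OF left_continuous_probD(1)[OF \<rho>] m])
  fix e :: real assume "0 < e"
  then obtain U where U: "open U" "0 \<in> U" "\<forall>u\<in>U. shift_close \<rho> e u"
    by (rule left_continuous_prob_nbhd[OF \<rho>])
  let ?U = "(\<lambda>u. - g + u + g) -` U"
  have "open ?U" by (rule open_vimage[OF U(1)]) (intro continuous_intros)
  moreover have "0 \<in> ?U" using U(2) by simp
  moreover have "\<bar>(\<integral>h. \<phi> (u + h) \<partial>distr \<rho> borel ((+) g)) - (\<integral>h. \<phi> h \<partial>distr \<rho> borel ((+) g))\<bar> \<le> e"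
    if u: "u \<in> ?U" and \<phi>: "\<phi> \<in> borel_measurable borel" "\<forall>x. \<bar>\<phi> x\<bar> \<le> 1" for u and \<phi> :: "'g \<Rightarrow> real"
  proof -
    have bm: "(\<lambda>h. \<phi> (a + h)) \<in> borel_measurable borel" for a
      by (rule measurable_compose[OF _ \<phi>(1)]) (intro borel_measurable_continuous_onI continuous_intros)
    have "\<bar>(\<integral>h. \<phi> (g + ((- g + u + g) + h)) \<partial>\<rho>) - (\<integral>h. \<phi> (g + h) \<partial>\<rho>)\<bar> \<le> e"
      using u bm[of g] \<phi>(2) by (intro shift_closeD[OF bspec[OF U(3)], of "- g + u + g" "\<lambda>h. \<phi> (g + h)"]) auto
    moreover have "g + ((- g + u + g) + h) = u + (g + h)" for h
      by (simp add: add.assoc[symmetric])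
    ultimately show ?thesis
      by (simp add: integral_distr[OF m] bm \<phi>(1))
  qed
  ultimately show "\<exists>U. open U \<and> 0 \<in> U \<and> (\<forall>u\<in>U. shift_close (distr \<rho> borel ((+) g)) e u)"
    unfolding shift_close_def by blast
qed simp

context quasi_invariant_action
begin

text \<open>
  Boundedness everywhere, not only up to null sets, lets these functions be integrated along
  each single orbit.
\<close>

definition bounded_meas :: "('x \<Rightarrow> real) set" where
  "bounded_meas = {\<phi> \<in> borel_measurable M. \<exists>C. \<forall>x\<in>space M. \<bar>\<phi> x\<bar> \<le> C}"

text \<open>
  The real form of an invariant mean, on functions; positivity up to null sets makes it a
  functional on classes.
\<close>

definition invariant_mean :: "(('x \<Rightarrow> real) \<Rightarrow> real) \<Rightarrow> bool" where
  "invariant_mean \<mu> \<longleftrightarrow>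
     (\<forall>\<phi>\<in>bounded_meas. \<forall>\<psi>\<in>bounded_meas. \<mu> (\<lambda>x. \<phi> x + \<psi> x) = \<mu> \<phi> + \<mu> \<psi>) \<and>
     (\<forall>c. \<forall>\<phi>\<in>bounded_meas. \<mu> (\<lambda>x. c * \<phi> x) = c * \<mu> \<phi>) \<and>
     (\<forall>\<phi>\<in>bounded_meas. (AE x in M. 0 \<le> \<phi> x) \<longrightarrow> 0 \<le> \<mu> \<phi>) \<and>
     \<mu> (\<lambda>x. 1) = 1 \<and>
     (\<forall>g. \<forall>\<phi>\<in>bounded_meas. \<mu> (\<lambda>x. \<phi> (act g x)) = \<mu> \<phi>)"

lemma bounded_measI: "\<phi> \<in> borel_measurable M \<Longrightarrow> (\<And>x. x \<in> space M \<Longrightarrow> \<bar>\<phi> x\<bar> \<le> C) \<Longrightarrow> \<phi> \<in> bounded_meas"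
  by (auto simp: bounded_meas_def)

lemma bounded_measE:
  assumes "\<phi> \<in> bounded_meas"
  obtains C where "\<phi> \<in> borel_measurable M" "0 \<le> C" "\<forall>x\<in>space M. \<bar>\<phi> x\<bar> \<le> C"
proof -
  obtain C where C: "\<phi> \<in> borel_measurable M" "\<forall>x\<in>space M. \<bar>\<phi> x\<bar> \<le> C"
    using assms by (auto simp: bounded_meas_def)
  have "\<forall>x\<in>space M. \<bar>\<phi> x\<bar> \<le> \<bar>C\<bar>" using C(2) by force
  with C(1) show ?thesis by (intro that[of "\<bar>C\<bar>"]) auto
qed

lemma bounded_meas_add: "\<phi> \<in> bounded_meas \<Longrightarrow> \<psi> \<in> bounded_meas \<Longrightarrow> (\<lambda>x. \<phi> x + \<psi> x) \<in> bounded_meas"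
proof -
  assume a: "\<phi> \<in> bounded_meas" "\<psi> \<in> bounded_meas"
  obtain C where C: "\<phi> \<in> borel_measurable M" "0 \<le> C" "\<forall>x\<in>space M. \<bar>\<phi> x\<bar> \<le> C" by (rule bounded_measE[OF a(1)])
  obtain D where D: "\<psi> \<in> borel_measurable M" "0 \<le> D" "\<forall>x\<in>space M. \<bar>\<psi> x\<bar> \<le> D" by (rule bounded_measE[OF a(2)])
  show ?thesis
  proof (rule bounded_measI)
    show "\<bar>\<phi> x + \<psi> x\<bar> \<le> C + D" if "x \<in> space M" for x
      using bspec[OF C(3) that] bspec[OF D(3) that] by linarith
  qed (use C D in simp)
qed

lemma bounded_meas_scale: "\<phi> \<in> bounded_meas \<Longrightarrow> (\<lambda>x. c * \<phi> x) \<in> bounded_meas"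
proof -
  assume a: "\<phi> \<in> bounded_meas"
  obtain C where C: "\<phi> \<in> borel_measurable M" "0 \<le> C" "\<forall>x\<in>space M. \<bar>\<phi> x\<bar> \<le> C" by (rule bounded_measE[OF a])
  show ?thesis
    by (rule bounded_measI[of _ "\<bar>c\<bar> * C"]) (use C in \<open>auto simp: abs_mult intro: mult_left_mono\<close>)
qed

lemma bounded_meas_diff: "\<phi> \<in> bounded_meas \<Longrightarrow> \<psi> \<in> bounded_meas \<Longrightarrow> (\<lambda>x. \<phi> x - \<psi> x) \<in> bounded_meas"
  using bounded_meas_add[OF _ bounded_meas_scale[of \<psi> "-1"], of \<phi>] by simp

lemma bounded_meas_const: "(\<lambda>x. c) \<in> bounded_meas"
  by (rule bounded_measI[of _ "\<bar>c\<bar>"]) auto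

lemma bounded_meas_sum: "(\<And>i. i \<in> I \<Longrightarrow> \<phi> i \<in> bounded_meas) \<Longrightarrow> (\<lambda>x. \<Sum>i\<in>I. \<phi> i x) \<in> bounded_meas"
  by (induction I rule: infinite_finite_induct) (auto simp: bounded_meas_const intro: bounded_meas_add)

lemma bounded_meas_translate: "\<phi> \<in> bounded_meas \<Longrightarrow> (\<lambda>x. \<phi> (act g x)) \<in> bounded_meas"
proof -
  assume a: "\<phi> \<in> bounded_meas"
  obtain C where C: "\<phi> \<in> borel_measurable M" "0 \<le> C" "\<forall>x\<in>space M. \<bar>\<phi> x\<bar> \<le> C" by (rule bounded_measE[OF a])
  note [measurable] = C(1)
  show ?thesis by (rule bounded_measI[of _ C]) (use C act_space in auto)
qed

lemma invariant_mean_exists: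
  assumes "co_amenable M act"
  shows "\<exists>\<mu>. invariant_mean \<mu>"
proof -
  obtain m where m: "is_mean M m"
    and inv: "\<And>g f. f \<in> ess_bounded M \<Longrightarrow> m (ae_class M (\<lambda>x. f (act (- g) x))) = m (ae_class M f)"
    using assms unfolding co_amenable_def by blast
  have eb: "(\<lambda>x. complex_of_real (\<phi> x)) \<in> ess_bounded M" if "\<phi> \<in> bounded_meas" for \<phi>
    using that by (auto simp: bounded_meas_def ess_bounded_def)
  define \<mu> where "\<mu> \<phi> = Re (m (ae_class M (\<lambda>x. complex_of_real (\<phi> x))))" for \<phi> :: "'x \<Rightarrow> real"
  have "invariant_mean \<mu>"
    unfolding invariant_mean_def
  proof (intro conjI ballI allI impI)
    fix \<phi> assume \<phi>: "\<phi> \<in> bounded_meas"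
    show "\<mu> (\<lambda>x. \<phi> x + \<psi> x) = \<mu> \<phi> + \<mu> \<psi>" if "\<psi> \<in> bounded_meas" for \<psi>
      using m eb[OF \<phi>] eb[OF that] by (simp add: \<mu>_def is_mean_def)
    show "\<mu> (\<lambda>x. c * \<phi> x) = c * \<mu> \<phi>" for c
      using m eb[OF \<phi>] by (simp add: \<mu>_def is_mean_def)
    show "0 \<le> \<mu> \<phi>" if pos: "AE x in M. 0 \<le> \<phi> x"
    proof -
      have "AE x in M. complex_of_real (\<phi> x) \<in> \<real>\<^sub>\<ge>\<^sub>0" using pos by eventually_elim simp
      then have "m (ae_class M (\<lambda>x. complex_of_real (\<phi> x))) \<in> \<real>\<^sub>\<ge>\<^sub>0"
        using m eb[OF \<phi>] by (simp add: is_mean_def)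
      then show ?thesis by (simp add: \<mu>_def complex_nonneg_Reals_iff)
    qed
    show "\<mu> (\<lambda>x. \<phi> (act g x)) = \<mu> \<phi>" for g
      using inv[OF eb[OF \<phi>], of "- g"] by (simp add: \<mu>_def)
  qed (use m in \<open>simp add: \<mu>_def is_mean_def\<close>)
  then show ?thesis by blast
qed

context
  fixes \<mu> assumes \<mu>: "invariant_mean \<mu>"
begin

lemma mean_add: "\<phi> \<in> bounded_meas \<Longrightarrow> \<psi> \<in> bounded_meas \<Longrightarrow> \<mu> (\<lambda>x. \<phi> x + \<psi> x) = \<mu> \<phi> + \<mu> \<psi>"
  and mean_scale: "\<phi> \<in> bounded_meas \<Longrightarrow> \<mu> (\<lambda>x. c * \<phi> x) = c * \<mu> \<phi>"
  and mean_nonneg: "\<phi> \<in> bounded_meas \<Longrightarrow> AE x in M. 0 \<le> \<phi> x \<Longrightarrow> 0 \<le> \<mu> \<phi>"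
  and mean_one: "\<mu> (\<lambda>x. 1) = 1"
  and mean_translate: "\<phi> \<in> bounded_meas \<Longrightarrow> \<mu> (\<lambda>x. \<phi> (act g x)) = \<mu> \<phi>"
  using \<mu> by (auto simp: invariant_mean_def)

lemma mean_const: "\<mu> (\<lambda>x. c) = c"
  using mean_scale[OF bounded_meas_const, of c 1] mean_one by simp

lemma mean_diff: "\<phi> \<in> bounded_meas \<Longrightarrow> \<psi> \<in> bounded_meas \<Longrightarrow> \<mu> (\<lambda>x. \<phi> x - \<psi> x) = \<mu> \<phi> - \<mu> \<psi>"
  using mean_add[OF _ bounded_meas_scale[of \<psi> "-1"], of \<phi>] mean_scale[of \<psi> "-1"] by simp

lemma mean_sum: "(\<And>i. i \<in> I \<Longrightarrow> \<phi> i \<in> bounded_meas) \<Longrightarrow> \<mu> (\<lambda>x. \<Sum>i\<in>I. \<phi> i x) = (\<Sum>i\<in>I. \<mu> (\<phi> i))"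
  by (induction I rule: infinite_finite_induct) (auto simp: mean_const mean_add bounded_meas_sum)

lemma mean_mono:
  assumes "\<phi> \<in> bounded_meas" "\<psi> \<in> bounded_meas" "AE x in M. \<phi> x \<le> \<psi> x"
  shows "\<mu> \<phi> \<le> \<mu> \<psi>"
  using mean_nonneg[OF bounded_meas_diff[OF assms(2,1)]] assms(3) mean_diff[OF assms(2,1)] by simp

lemma mean_close:
  assumes "\<phi> \<in> bounded_meas" "\<psi> \<in> bounded_meas" "\<And>x. x \<in> space M \<Longrightarrow> \<bar>\<phi> x - \<psi> x\<bar> \<le> e"
  shows "\<bar>\<mu> \<phi> - \<mu> \<psi>\<bar> \<le> e"
proof -
  have "\<mu> (\<lambda>x. \<phi> x - \<psi> x) \<le> \<mu> (\<lambda>x. e)"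
    using assms(3) by (intro mean_mono bounded_meas_diff assms bounded_meas_const AE_I2) (auto simp: abs_le_iff)
  moreover have "\<mu> (\<lambda>x. - e) \<le> \<mu> (\<lambda>x. \<phi> x - \<psi> x)"
    using assms(3) by (intro mean_mono bounded_meas_diff assms bounded_meas_const AE_I2) (force simp: abs_le_iff)
  ultimately show ?thesis unfolding mean_const mean_diff[OF assms(1,2)] by auto
qed

end

text \<open>
  The average of \<open>\<phi>\<close> along the orbits.
\<close>

definition smear :: "'g measure \<Rightarrow> ('x \<Rightarrow> real) \<Rightarrow> 'x \<Rightarrow> real" where
  "smear \<rho> \<phi> x = (\<integral>h. \<phi> (act h x) \<partial>\<rho>)"

lemma orbit_measurable:
  assumes "\<phi> \<in> borel_measurable M" "x \<in> space M"
  shows "(\<lambda>h. \<phi> (act h x)) \<in> borel_measurable borel"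
proof -
  have "(\<lambda>h. (h, x)) \<in> borel \<rightarrow>\<^sub>M borel \<Otimes>\<^sub>M M" using assms(2) by measurable
  from measurable_compose[OF this act_joint] have "(\<lambda>h. act h x) \<in> borel \<rightarrow>\<^sub>M M" by simp
  from measurable_compose[OF this assms(1)] show ?thesis .
qed

context
  fixes \<rho> :: "'g measure" assumes \<rho>: "prob_space \<rho>" and \<rho>_sets [measurable_cong]: "sets \<rho> = sets borel"
begin

interpretation \<rho>: prob_space \<rho> by (rule \<rho>)

lemma orbit_measurable_pair:
  assumes [measurable]: "\<phi> \<in> borel_measurable M"
  shows "(\<lambda>(x, h). \<phi> (act h x)) \<in> borel_measurable (M \<Otimes>\<^sub>M \<rho>)"
proof -
  have "(\<lambda>p. (snd p, fst p)) \<in> M \<Otimes>\<^sub>M \<rho> \<rightarrow>\<^sub>M borel \<Otimes>\<^sub>M M" by measurable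
  from measurable_compose[OF measurable_compose[OF this act_joint] assms]
  show ?thesis by (simp add: case_prod_beta)
qed

lemma orbit_integrable:
  fixes \<phi> :: "'x \<Rightarrow> real"
  assumes "\<phi> \<in> borel_measurable M" "\<forall>x\<in>space M. \<bar>\<phi> x\<bar> \<le> C" "x \<in> space M"
  shows "integrable \<rho> (\<lambda>h. \<phi> (act h x))"
  using orbit_measurable[OF assms(1,3)] assms(2) act_space[OF assms(3)]
  by (intro \<rho>.integrable_const_bound[where B = C]) (auto simp: measurable_cong_sets[OF \<rho>_sets refl])

lemma smear_bound:
  assumes "\<phi> \<in> borel_measurable M" "\<forall>x\<in>space M. \<bar>\<phi> x\<bar> \<le> C" "x \<in> space M"
  shows "\<bar>smear \<rho> \<phi> x\<bar> \<le> C"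
proof -
  have "\<bar>smear \<rho> \<phi> x\<bar> \<le> (\<integral>h. \<bar>\<phi> (act h x)\<bar> \<partial>\<rho>)" unfolding smear_def by (rule integral_abs_bound)
  also have "\<dots> \<le> (\<integral>h. C \<partial>\<rho>)"
    using orbit_integrable[OF assms] assms(2) act_space[OF assms(3)] by (intro integral_mono) auto
  finally show ?thesis by (simp add: \<rho>.prob_space)
qed

lemma smear_measurable [measurable]:
  assumes "\<phi> \<in> borel_measurable M"
  shows "smear \<rho> \<phi> \<in> borel_measurable M"
  unfolding smear_def[abs_def]
  by (rule \<rho>.borel_measurable_lebesgue_integral) (rule orbit_measurable_pair[OF assms])

lemma smear_bounded_meas: "\<phi> \<in> bounded_meas \<Longrightarrow> smear \<rho> \<phi> \<in> bounded_meas"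
  by (elim bounded_measE, rule bounded_measI) (auto intro: smear_bound smear_measurable)

end

text \<open>
  Cover \<open>G\<close> by countably many translates \<open>W + g\<^sub>n\<close> of a
  neighbourhood on which \<open>\<Theta>\<close> varies by at most \<open>\<epsilon>\<close>
  along every orbit. Up to a tail of small \<open>\<rho>\<close>-measure, finitely many of
  them suffice. So the average of \<open>\<Theta>\<close> is uniformly close to a finite
  combination of the translates \<open>\<Theta> \<circ> g\<^sub>n\<close>, with coefficients
  that almost sum to 1, and on such a combination the invariance of \<open>\<mu>\<close> can
  be used.
\<close>

lemma mean_smear_eq:
  fixes \<rho> :: "'g measure"
  assumes \<mu>: "invariant_mean \<mu>" and \<rho>: "prob_space \<rho>" "sets \<rho> = sets borel"
    and \<Theta>: "\<Theta> \<in> borel_measurable M" "\<forall>x\<in>space M. \<bar>\<Theta> x\<bar> \<le> 1"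
    and cont: "\<And>\<epsilon>. 0 < \<epsilon> \<Longrightarrow> \<exists>W. open W \<and> 0 \<in> W \<and> (\<forall>u\<in>W. \<forall>x\<in>space M. \<bar>\<Theta> (act u x) - \<Theta> x\<bar> \<le> \<epsilon>)"
  shows "\<mu> (smear \<rho> \<Theta>) = \<mu> \<Theta>"
proof -
  interpret \<rho>: prob_space \<rho> by (rule \<rho>(1))
  have \<rho>_space: "space \<rho> = UNIV" using sets_eq_imp_space_eq[OF \<rho>(2)] by simp
  note [measurable_cong] = \<rho>(2)
  note [measurable] = \<Theta>(1)
  have \<Theta>b: "\<Theta> \<in> bounded_meas" by (rule bounded_measI[OF \<Theta>(1)]) (use \<Theta>(2) in auto)
  have small: "\<bar>\<mu> (smear \<rho> \<Theta>) - \<mu> \<Theta>\<bar> \<le> 3 * \<epsilon>" if \<epsilon>: "0 < \<epsilon>" for \<epsilon>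
  proof -
    obtain W where W: "open W" "0 \<in> W" "\<forall>u\<in>W. \<forall>x\<in>space M. \<bar>\<Theta> (act u x) - \<Theta> x\<bar> \<le> \<epsilon>"
      using cont[OF \<epsilon>] by blast
    obtain D :: "'g set" where D: "countable D" "\<And>X. open X \<Longrightarrow> X \<noteq> {} \<Longrightarrow> \<exists>d\<in>D. d \<in> X"
      using countable_dense_exists by blast
    have Dne: "D \<noteq> {}" using D(2)[OF open_UNIV] by auto
    define g where "g = from_nat_into D"
    have hit: "\<exists>n. h - g n \<in> W" for h
    proof -
      have "open ((\<lambda>a. h + - a) -` W)" by (rule open_vimage[OF W(1)]) (intro continuous_intros)
      moreover have "h \<in> (\<lambda>a. h + - a) -` W" using W(2) by simp
      ultimately obtain d where d: "d \<in> D" "h + - d \<in> W" using D(2) by blast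
      then obtain n where "d = g n" unfolding g_def using from_nat_into_surj[OF D(1)] by metis
      then show ?thesis using d by auto
    qed
    \<comment> \<open>The first translate that contains \<open>h\<close>; its level sets
    partition \<open>G\<close> into measurable pieces.\<close>
    define J where "J h = (LEAST n. h - g n \<in> W)" for h
    have J: "h - g (J h) \<in> W" for h unfolding J_def by (rule LeastI_ex[OF hit])
    have J_meas[measurable]: "J \<in> borel \<rightarrow>\<^sub>M count_space UNIV"
      unfolding J_def
    proof (rule measurable_Least)
      fix n
      have "(\<lambda>h. h + - g n) \<in> borel_measurable borel"
        by (intro borel_measurable_continuous_onI continuous_intros)
      then have "(\<lambda>h. h - g n) -` W \<in> sets borel"
        using W(1) measurable_sets_borel[of "\<lambda>h. h + - g n" borel W] by simp
      then show "Measurable.pred borel (\<lambda>h. h - g n \<in> W)"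
        unfolding pred_def by (simp add: vimage_def)
    qed
    define T where "T N = {h. N \<le> J h}" for N
    have T_meas[measurable]: "T N \<in> sets \<rho>" for N
    proof -
      have "{h \<in> space borel. N \<le> J h} \<in> sets borel" by measurable
      then show ?thesis by (simp add: T_def \<rho>(2))
    qed
    define A where "A n = {h. J h = n}" for n
    have A_meas[measurable]: "A n \<in> sets \<rho>" for n
    proof -
      have "{h \<in> space borel. J h = n} \<in> sets borel" by measurable
      then show ?thesis by (simp add: A_def \<rho>(2))
    qed
    have "(\<lambda>N. measure \<rho> (T N)) \<longlonglongrightarrow> measure \<rho> (\<Inter>N. T N)"
      by (rule \<rho>.finite_Lim_measure_decseq) (auto simp: decseq_def T_def)
    also have "(\<Inter>N. T N) = {}" by (auto simp: T_def) (metis Suc_n_not_le_n)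
    finally have "(\<lambda>N. measure \<rho> (T N)) \<longlonglongrightarrow> 0" by simp
    then have "eventually (\<lambda>N. measure \<rho> (T N) < \<epsilon>) sequentially"
      using \<epsilon> by (rule order_tendstoD(2))
    then obtain N where N: "measure \<rho> (T N) < \<epsilon>" by (auto simp: eventually_sequentially)
    \<comment> \<open>The finite combination of translates that approximates the average of
    \<open>\<Theta>\<close>.\<close>
    define \<Xi> where "\<Xi> x = (\<Sum>n<N. measure \<rho> (A n) * \<Theta> (act (g n) x))" for x
    have \<Xi>b: "\<Xi> \<in> bounded_meas"
      unfolding \<Xi>_def[abs_def] by (intro bounded_meas_sum bounded_meas_scale bounded_meas_translate \<Theta>b)
    have tot: "(\<Sum>n<N. measure \<rho> (A n)) = 1 - measure \<rho> (T N)"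
    proof -
      have "(\<Sum>n<N. measure \<rho> (A n)) = measure \<rho> (\<Union>n<N. A n)"
        by (rule \<rho>.finite_measure_finite_Union[symmetric]) (auto simp: disjoint_family_on_def A_def)
      also have "(\<Union>n<N. A n) = space \<rho> - T N" by (auto simp: A_def T_def \<rho>_space)
      also have "measure \<rho> \<dots> = 1 - measure \<rho> (T N)" by (rule \<rho>.prob_compl) measurable
      finally show ?thesis .
    qed
    have \<mu>\<Xi>: "\<mu> \<Xi> = (1 - measure \<rho> (T N)) * \<mu> \<Theta>"
    proof -
      have "\<mu> \<Xi> = (\<Sum>n<N. \<mu> (\<lambda>x. measure \<rho> (A n) * \<Theta> (act (g n) x)))"
        unfolding \<Xi>_def[abs_def] by (intro mean_sum[OF \<mu>] bounded_meas_scale bounded_meas_translate \<Theta>b)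
      also have "\<dots> = (\<Sum>n<N. measure \<rho> (A n) * \<mu> \<Theta>)"
        by (simp add: mean_scale[OF \<mu>] mean_translate[OF \<mu>] bounded_meas_translate \<Theta>b)
      finally show ?thesis by (simp add: sum_distrib_right[symmetric] tot)
    qed
    have close: "\<bar>smear \<rho> \<Theta> x - \<Xi> x\<bar> \<le> 2 * \<epsilon>" if x: "x \<in> space M" for x
    proof -
      have oi: "integrable \<rho> (\<lambda>h. \<Theta> (act h x))" by (rule orbit_integrable[OF \<rho> \<Theta> x])
      have ind: "integrable \<rho> (\<lambda>h. indicator E h * c)" if "E \<in> sets \<rho>" for E and c :: real
        using that by (intro integrable_mult_left integrable_real_indicator) (auto simp: \<rho>.emeasure_eq_measure)
      have \<Xi>_int: "\<Xi> x = (\<integral>h. (\<Sum>n<N. indicator (A n) h * \<Theta> (act (g n) x)) \<partial>\<rho>)"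
      proof -
        have "(\<integral>h. indicator (A n) h * c \<partial>\<rho>) = measure \<rho> (A n) * c" for n and c :: real
          by (simp add: \<rho>_space)
        then have "\<Xi> x = (\<Sum>n<N. \<integral>h. indicator (A n) h * \<Theta> (act (g n) x) \<partial>\<rho>)"
          by (simp only: \<Xi>_def)
        also have "\<dots> = (\<integral>h. (\<Sum>n<N. indicator (A n) h * \<Theta> (act (g n) x)) \<partial>\<rho>)"
          by (rule Bochner_Integration.integral_sum[symmetric]) (rule ind[OF A_meas])
        finally show ?thesis .
      qed
      have isum: "integrable \<rho> (\<lambda>h. \<Sum>n<N. indicator (A n) h * \<Theta> (act (g n) x))"
        by (rule Bochner_Integration.integrable_sum) (rule ind[OF A_meas])
      have "smear \<rho> \<Theta> x - \<Xi> x = (\<integral>h. \<Theta> (act h x) - (\<Sum>n<N. indicator (A n) h * \<Theta> (act (g n) x)) \<partial>\<rho>)"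
        unfolding smear_def \<Xi>_int by (rule Bochner_Integration.integral_diff[OF oi isum, symmetric])
      then have "\<bar>smear \<rho> \<Theta> x - \<Xi> x\<bar> \<le> (\<integral>h. \<bar>\<Theta> (act h x) - (\<Sum>n<N. indicator (A n) h * \<Theta> (act (g n) x))\<bar> \<partial>\<rho>)"
        by (simp only: integral_abs_bound)
      also have "\<dots> \<le> (\<integral>h. \<epsilon> + indicator (T N) h * 1 \<partial>\<rho>)"
      proof (rule integral_mono)
        show "integrable \<rho> (\<lambda>h. \<bar>\<Theta> (act h x) - (\<Sum>n<N. indicator (A n) h * \<Theta> (act (g n) x))\<bar>)"
          using oi ind[OF A_meas] by (intro integrable_abs Bochner_Integration.integrable_diff Bochner_Integration.integrable_sum)
        show "integrable \<rho> (\<lambda>h. \<epsilon> + indicator (T N) h * 1)"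
          using ind[OF T_meas] by (intro Bochner_Integration.integrable_add) auto
        fix h assume "h \<in> space \<rho>"
        have sum_eq: "(\<Sum>n<N. indicator (A n) h * \<Theta> (act (g n) x)) = (if J h < N then \<Theta> (act (g (J h)) x) else 0)"
        proof -
          have "(\<Sum>n<N. indicator (A n) h * \<Theta> (act (g n) x)) = (\<Sum>n<N. if n = J h then \<Theta> (act (g (J h)) x) else 0)"
            by (intro sum.cong) (auto simp: A_def indicator_def)
          then show ?thesis by (simp add: sum.delta)
        qed
        show "\<bar>\<Theta> (act h x) - (\<Sum>n<N. indicator (A n) h * \<Theta> (act (g n) x))\<bar> \<le> \<epsilon> + indicator (T N) h * 1"
        proof (cases "J h < N")
          case True
          have "act h x = act (h - g (J h)) (act (g (J h)) x)"
            using act_add[OF x, of "h - g (J h)" "g (J h)"] by simp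
          then have "\<bar>\<Theta> (act h x) - \<Theta> (act (g (J h)) x)\<bar> \<le> \<epsilon>"
            using W(3) J[of h] act_space[OF x, of "g (J h)"] by simp
          then show ?thesis using True by (simp add: sum_eq T_def)
        next
          case False
          then show ?thesis using \<Theta>(2) act_space[OF x, of h] \<epsilon> by (simp add: sum_eq T_def add_increasing)
        qed
      qed
      also have "\<dots> = \<epsilon> + measure \<rho> (T N)"
        using ind[OF T_meas, of N 1] by (simp add: \<rho>.prob_space)
      also have "\<dots> \<le> 2 * \<epsilon>" using N by simp
      finally show ?thesis .
    qed
    have "\<bar>\<mu> (smear \<rho> \<Theta>) - \<mu> \<Xi>\<bar> \<le> 2 * \<epsilon>"
      by (rule mean_close[OF \<mu> smear_bounded_meas[OF \<rho> \<Theta>b] \<Xi>b close])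
    moreover have "\<bar>\<mu> \<Xi> - \<mu> \<Theta>\<bar> \<le> \<epsilon>"
    proof -
      have "\<bar>\<mu> \<Theta>\<bar> \<le> 1"
        using mean_close[OF \<mu> \<Theta>b bounded_meas_const[of 0], of 1] \<Theta>(2) by (simp add: mean_const[OF \<mu>])
      then have "measure \<rho> (T N) * \<bar>\<mu> \<Theta>\<bar> \<le> measure \<rho> (T N) * 1" by (intro mult_left_mono) auto
      moreover have "\<mu> \<Xi> - \<mu> \<Theta> = - (measure \<rho> (T N) * \<mu> \<Theta>)" unfolding \<mu>\<Xi> by (simp add: algebra_simps)
      ultimately show ?thesis using N by (simp add: abs_mult)
    qed
    ultimately show ?thesis by linarith
  qed
  have "\<bar>\<mu> (smear \<rho> \<Theta>) - \<mu> \<Theta>\<bar> \<le> 0"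
  proof (rule field_le_epsilon)
    fix d :: real assume "0 < d"
    then show "\<bar>\<mu> (smear \<rho> \<Theta>) - \<mu> \<Theta>\<bar> \<le> 0 + d" using small[of "d / 3"] by simp
  qed
  then show ?thesis by simp
qed

text \<open>
  The second mean is that of the average \<open>\<Theta>\<close> of \<open>\<phi>\<close> over
  the reflection of \<open>e\<close>, and it does not involve \<open>\<rho>\<close>. As
  \<open>e\<close> is left-continuous, \<open>\<Theta>\<close> is uniformly continuous along
  the orbits, so that \<open>mean_smear_eq\<close> replaces \<open>\<Theta>\<close> by its
  average over \<open>\<rho>\<close>. That average is, by Fubini's theorem, an average of
  \<open>\<phi>\<close> over translates of \<open>\<rho>\<close> by elements of
  \<open>U\<close>, hence close to the average over \<open>\<rho>\<close>.
\<close>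

lemma mean_smear_approx:
  fixes \<rho> e :: "'g measure"
  assumes \<mu>: "invariant_mean \<mu>" and \<rho>: "left_continuous_prob \<rho>" and e: "left_continuous_prob e"
    and \<phi>: "\<phi> \<in> borel_measurable M" "\<forall>x. \<bar>\<phi> x\<bar> \<le> 1"
    and U: "\<forall>u\<in>U. shift_close \<rho> \<epsilon> u"
    and conc: "AE k in e. - k \<in> U"
  shows "\<bar>\<mu> (smear \<rho> \<phi>) - \<mu> (\<lambda>x. \<integral>k. \<phi> (act (- k) x) \<partial>e)\<bar> \<le> \<epsilon>"
proof -
  note \<rho>p = left_continuous_probD(1,2)[OF \<rho>] and ep = left_continuous_probD(1,2)[OF e]
  interpret \<rho>: prob_space \<rho> by (rule \<rho>p(1))
  interpret e: prob_space e by (rule ep(1))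
  interpret P: pair_prob_space e \<rho> ..
  note [measurable_cong] = \<rho>p(2) ep(2)
  note [measurable] = \<phi>(1)
  have [measurable]: "(\<lambda>k::'g. - k) \<in> borel \<rightarrow>\<^sub>M borel"
    by (intro borel_measurable_continuous_onI continuous_intros)
  define \<Theta> where "\<Theta> x = (\<integral>k. \<phi> (act (- k) x) \<partial>e)" for x
  define e' where "e' = distr e borel (\<lambda>k. - k)"
  have e'_prob: "prob_space e'" unfolding e'_def by (rule e.prob_space_distr) measurable
  have \<phi>b: "\<phi> \<in> bounded_meas" by (rule bounded_measI[OF \<phi>(1)]) (use \<phi>(2) in auto)
  have \<phi>s: "\<forall>x\<in>space M. \<bar>\<phi> x\<bar> \<le> 1" using \<phi>(2) by simp
  have orb: "(\<lambda>h. \<phi> (act h x)) \<in> borel_measurable borel" if "x \<in> space M" for x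
    by (rule orbit_measurable[OF \<phi>(1) that])
  have \<Theta>_smear: "\<Theta> x = smear e' \<phi> x" if "x \<in> space M" for x
    unfolding \<Theta>_def smear_def e'_def using orb[OF that] by (subst integral_distr) auto
  have \<Theta>m: "\<Theta> \<in> borel_measurable M"
    using smear_measurable[OF e'_prob _ \<phi>(1)] \<Theta>_smear by (subst measurable_cong[where g = "smear e' \<phi>"]) (auto simp: e'_def)
  have \<Theta>1: "\<forall>x\<in>space M. \<bar>\<Theta> x\<bar> \<le> 1"
    using smear_bound[OF e'_prob _ \<phi>(1) \<phi>s] \<Theta>_smear by (auto simp: e'_def)
  have \<Theta>b: "\<Theta> \<in> bounded_meas" by (rule bounded_measI[OF \<Theta>m]) (use \<Theta>1 in auto)
  have cont: "\<exists>W. open W \<and> 0 \<in> W \<and> (\<forall>u\<in>W. \<forall>x\<in>space M. \<bar>\<Theta> (act u x) - \<Theta> x\<bar> \<le> \<epsilon>)" if "0 < \<epsilon>" for \<epsilon>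
  proof -
    obtain V where V: "open V" "0 \<in> V" "\<forall>u\<in>V. shift_close e \<epsilon> u"
      by (rule left_continuous_prob_nbhd[OF e \<open>0 < \<epsilon>\<close>])
    have "\<bar>\<Theta> (act u x) - \<Theta> x\<bar> \<le> \<epsilon>" if u: "- u \<in> V" and x: "x \<in> space M" for u x
    proof -
      have "(\<lambda>k. \<phi> (act (- k) x)) \<in> borel_measurable borel"
        using orb[OF x] by measurable
      then have "\<bar>(\<integral>k. \<phi> (act (- (- u + k)) x) \<partial>e) - (\<integral>k. \<phi> (act (- k) x) \<partial>e)\<bar> \<le> \<epsilon>"
        using shift_closeD[OF bspec[OF V(3) u], of "\<lambda>k. \<phi> (act (- k) x)"] \<phi>(2) by simp
      moreover have "act (- (- u + k)) x = act (- k) (act u x)" for k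
        using act_add[OF x, of "- k" u] by (simp add: minus_add)
      ultimately show ?thesis by (simp add: \<Theta>_def)
    qed
    moreover have "open (uminus -` V)" by (rule open_vimage[OF V(1)]) (intro continuous_intros)
    ultimately show ?thesis using V(2) by (intro exI[of _ "uminus -` V"]) auto
  qed
  have eq: "\<mu> (smear \<rho> \<Theta>) = \<mu> \<Theta>"
    by (rule mean_smear_eq[OF \<mu> \<rho>p \<Theta>m \<Theta>1 cont])
  have close: "\<bar>smear \<rho> \<phi> x - smear \<rho> \<Theta> x\<bar> \<le> \<epsilon>" if x: "x \<in> space M" for x
  proof -
    note [measurable] = orb[OF x]
    have joint[measurable]: "(\<lambda>(k, h). \<phi> (act (- k + h) x)) \<in> borel_measurable (e \<Otimes>\<^sub>M \<rho>)"
    proof -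
      have "(\<lambda>p. - fst p + snd p) \<in> borel_measurable (e \<Otimes>\<^sub>M \<rho>)"
        by measurable
      from measurable_compose[OF this orb[OF x]] show ?thesis by (simp add: case_prod_beta)
    qed
    have int: "integrable (e \<Otimes>\<^sub>M \<rho>) (\<lambda>(k, h). \<phi> (act (- k + h) x))"
      using \<phi>(2) by (intro P.P.integrable_const_bound[where B = 1]) (auto simp: case_prod_beta)
    have "smear \<rho> \<Theta> x = (\<integral>h. (\<integral>k. \<phi> (act (- k + h) x) \<partial>e) \<partial>\<rho>)"
      unfolding smear_def \<Theta>_def by (simp add: act_add[OF x])
    also have "\<dots> = (\<integral>k. (\<integral>h. \<phi> (act (- k + h) x) \<partial>\<rho>) \<partial>e)"
      by (rule P.Fubini_integral[OF int])
    finally have sm: "smear \<rho> \<Theta> x = (\<integral>k. (\<integral>h. \<phi> (act (- k + h) x) \<partial>\<rho>) \<partial>e)" .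
    have ik: "integrable e (\<lambda>k. \<integral>h. \<phi> (act (- k + h) x) \<partial>\<rho>)"
      using P.integrable_fst'[OF int] by simp
    have "smear \<rho> \<phi> x - smear \<rho> \<Theta> x = (\<integral>k. smear \<rho> \<phi> x - (\<integral>h. \<phi> (act (- k + h) x) \<partial>\<rho>) \<partial>e)"
      unfolding sm using ik by (simp add: e.prob_space)
    then have "\<bar>smear \<rho> \<phi> x - smear \<rho> \<Theta> x\<bar> \<le> (\<integral>k. \<bar>smear \<rho> \<phi> x - (\<integral>h. \<phi> (act (- k + h) x) \<partial>\<rho>)\<bar> \<partial>e)"
      by (simp only: integral_abs_bound)
    also have "\<dots> \<le> (\<integral>k. \<epsilon> \<partial>e)"
    proof (rule integral_mono_AE)
      show "integrable e (\<lambda>k. \<bar>smear \<rho> \<phi> x - (\<integral>h. \<phi> (act (- k + h) x) \<partial>\<rho>)\<bar>)"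
        using ik by (intro integrable_abs Bochner_Integration.integrable_diff) auto
      show "AE k in e. \<bar>smear \<rho> \<phi> x - (\<integral>h. \<phi> (act (- k + h) x) \<partial>\<rho>)\<bar> \<le> \<epsilon>"
        using conc
      proof eventually_elim
        case (elim k)
        show ?case
          using shift_closeD[OF bspec[OF U elim], of "\<lambda>h. \<phi> (act h x)"] orb[OF x] \<phi>(2)
          by (simp add: smear_def abs_minus_commute)
      qed
    qed auto
    also have "\<dots> = \<epsilon>" by (simp add: e.prob_space)
    finally show ?thesis .
  qed
  have "\<bar>\<mu> (smear \<rho> \<phi>) - \<mu> (smear \<rho> \<Theta>)\<bar> \<le> \<epsilon>"
    by (rule mean_close[OF \<mu> smear_bounded_meas[OF \<rho>p \<phi>b] smear_bounded_meas[OF \<rho>p \<Theta>b] close])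
  then show ?thesis unfolding eq by (simp add: \<Theta>_def[abs_def])
qed

text \<open>
  The left-hand side is the mean of the average of \<open>\<phi>\<close> over the translate
  \<open>\<sigma>\<close> of \<open>\<rho>\<close> by \<open>g\<close>. A measure
  \<open>e\<close> concentrated so near 0 that it serves for \<open>\<rho>\<close> and for
  \<open>\<sigma>\<close> compares both averages with the same third function.
\<close>

theorem mean_smear_translate:
  fixes \<rho> :: "'g measure"
  assumes lc: "locally_compact_space (euclidean :: 'g topology)"
    and \<mu>: "invariant_mean \<mu>" and \<rho>: "left_continuous_prob \<rho>"
    and \<phi>: "\<phi> \<in> borel_measurable M" "\<forall>x. \<bar>\<phi> x\<bar> \<le> 1"
  shows "\<mu> (smear \<rho> (\<lambda>x. \<phi> (act g x))) = \<mu> (smear \<rho> \<phi>)"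
proof -
  define \<sigma> where "\<sigma> = distr \<rho> borel ((+) g)"
  have \<sigma>: "left_continuous_prob \<sigma>" unfolding \<sigma>_def by (rule left_continuous_prob_translate[OF \<rho>])
  note \<rho>p = left_continuous_probD(1,2)[OF \<rho>]
  have \<phi>b: "\<phi> \<in> bounded_meas" by (rule bounded_measI[OF \<phi>(1)]) (use \<phi>(2) in auto)
  have \<sigma>_eq: "smear \<sigma> \<phi> x = smear \<rho> (\<lambda>x. \<phi> (act g x)) x" if x: "x \<in> space M" for x
  proof -
    have m: "(+) g \<in> measurable \<rho> borel"
      unfolding measurable_cong_sets[OF \<rho>p(2) refl]
      by (intro borel_measurable_continuous_onI continuous_intros)
    show ?thesis
      unfolding smear_def \<sigma>_def using orbit_measurable[OF \<phi>(1) x]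
      by (subst integral_distr[OF m]) (auto simp: act_add[OF x])
  qed
  have \<mu>\<sigma>: "\<mu> (smear \<sigma> \<phi>) = \<mu> (smear \<rho> (\<lambda>x. \<phi> (act g x)))"
    using mean_close[where e = 0, OF \<mu> smear_bounded_meas[OF left_continuous_probD(1,2)[OF \<sigma>] \<phi>b]
        smear_bounded_meas[OF \<rho>p bounded_meas_translate[OF \<phi>b, where g = g]]] \<sigma>_eq by simp
  have "\<bar>\<mu> (smear \<sigma> \<phi>) - \<mu> (smear \<rho> \<phi>)\<bar> \<le> 0"
  proof (rule field_le_epsilon)
    fix d :: real assume d: "0 < d"
    then have d2: "0 < d / 2" by simp
    obtain U where U: "open U" "0 \<in> U" "\<forall>u\<in>U. shift_close \<rho> (d / 2) u"
      by (rule left_continuous_prob_nbhd[OF \<rho> d2])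
    obtain V where V: "open V" "0 \<in> V" "\<forall>u\<in>V. shift_close \<sigma> (d / 2) u"
      by (rule left_continuous_prob_nbhd[OF \<sigma> d2])
    have "open (uminus -` (U \<inter> V))" by (rule open_vimage) (use U V in \<open>auto intro: continuous_intros\<close>)
    moreover have "0 \<in> uminus -` (U \<inter> V)" using U V by simp
    ultimately obtain e where e: "left_continuous_prob e" "AE k in e. k \<in> uminus -` (U \<inter> V)"
      by (rule ex_left_continuous_prob[OF lc])
    have "AE k in e. - k \<in> U" "AE k in e. - k \<in> V" using e(2) by (auto elim: eventually_mono)
    then show "\<bar>\<mu> (smear \<sigma> \<phi>) - \<mu> (smear \<rho> \<phi>)\<bar> \<le> 0 + d"
      using mean_smear_approx[OF \<mu> \<rho> e(1) \<phi> U(3)] mean_smear_approx[OF \<mu> \<sigma> e(1) \<phi> V(3)] by linarith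
  qed
  then show ?thesis using \<mu>\<sigma> by simp
qed

section \<open>From an invariant mean to almost invariant vectors\<close>

definition densities :: "('x \<Rightarrow> real) set" where
  "densities = {f. (\<forall>x. 0 \<le> f x) \<and> integrable M f \<and> (\<integral>x. f x \<partial>M) = 1}"

lemma densitiesD:
  assumes "f \<in> densities"
  shows "0 \<le> f x" "integrable M f" "(\<integral>x. f x \<partial>M) = 1" "f \<in> borel_measurable M"
  using assms by (auto simp: densities_def)

lemma bounded_meas_mult_integrable:
  assumes "\<phi> \<in> bounded_meas" "integrable M f"
  shows "integrable M (\<lambda>x. \<phi> x * f x)"
proof -
  obtain C where C: "\<phi> \<in> borel_measurable M" "0 \<le> C" "\<forall>x\<in>space M. \<bar>\<phi> x\<bar> \<le> C" by (rule bounded_measE[OF assms(1)])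
  note [measurable] = C(1) borel_measurable_integrable[OF assms(2)]
  show ?thesis
  proof (rule Bochner_Integration.integrable_bound[OF integrable_mult_right[OF integrable_abs[OF assms(2)], of C]])
    show "AE x in M. norm (\<phi> x * f x) \<le> norm (C * \<bar>f x\<bar>)"
      using C by (intro AE_I2) (auto simp: abs_mult intro: mult_right_mono)
  qed measurable
qed

text \<open>
  In terms of measures, \<open>f'\<close> is the density of the image of \<open>\<rho>
  \<otimes> f\<nu>\<close> under the action. The relation is characterised by its dual, the
  averaging of test functions, which is how it is used.
\<close>

definition smears_to :: "'g measure \<Rightarrow> ('x \<Rightarrow> real) \<Rightarrow> ('x \<Rightarrow> real) \<Rightarrow> bool" where
  "smears_to \<rho> f f' \<longleftrightarrow> (\<forall>\<phi>\<in>bounded_meas. (\<integral>x. \<phi> x * f' x \<partial>M) = (\<integral>x. smear \<rho> \<phi> x * f x \<partial>M))"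

text \<open>
  The image measure is absolutely continuous by Fubini's theorem, since every single group
  element preserves null sets.
\<close>

lemma smears_to_exists:
  fixes \<rho> :: "'g measure"
  assumes \<rho>: "prob_space \<rho>" "sets \<rho> = sets borel" and f: "f \<in> densities"
  shows "\<exists>f'\<in>densities. smears_to \<rho> f f'"
proof -
  interpret \<rho>: prob_space \<rho> by (rule \<rho>(1))
  note [measurable_cong] = \<rho>(2)
  have [measurable]: "f \<in> borel_measurable M" by (rule densitiesD(4)[OF f])
  define F where "F = density M (\<lambda>x. ennreal (f x))"
  have F_sets[measurable_cong]: "sets F = sets M" by (simp add: F_def)
  have F_prob: "prob_space F"
  proof
    have "emeasure F (space F) = (\<integral>\<^sup>+x. ennreal (f x) \<partial>M)"
      by (simp add: F_def emeasure_density cong: nn_integral_cong)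
    also have "\<dots> = 1" using densitiesD[OF f] by (subst nn_integral_eq_integral) auto
    finally show "emeasure F (space F) = 1" .
  qed
  interpret F: prob_space F by (rule F_prob)
  interpret P: pair_prob_space F \<rho> ..
  have actm[measurable]: "(\<lambda>(x, h). act h x) \<in> F \<Otimes>\<^sub>M \<rho> \<rightarrow>\<^sub>M M"
  proof -
    have "(\<lambda>p. (snd p, fst p)) \<in> F \<Otimes>\<^sub>M \<rho> \<rightarrow>\<^sub>M borel \<Otimes>\<^sub>M M" by measurable
    from measurable_compose[OF this act_joint] show ?thesis by (simp add: case_prod_beta)
  qed
  define \<kappa> where "\<kappa> = distr (F \<Otimes>\<^sub>M \<rho>) M (\<lambda>(x, h). act h x)"
  have \<kappa>_sets: "sets \<kappa> = sets M" by (simp add: \<kappa>_def)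
  interpret \<kappa>: prob_space \<kappa> unfolding \<kappa>_def by (rule P.P.prob_space_distr) measurable
  have ac: "absolutely_continuous M \<kappa>"
    unfolding absolutely_continuous_def
  proof
    fix N assume N: "N \<in> null_sets M"
    then have [measurable]: "N \<in> sets M" by auto
    have "emeasure \<kappa> N = (\<integral>\<^sup>+y. indicator N y \<partial>\<kappa>)" by (simp add: \<kappa>_sets)
    also have "\<dots> = (\<integral>\<^sup>+p. indicator N ((\<lambda>(x, h). act h x) p) \<partial>(F \<Otimes>\<^sub>M \<rho>))"
      unfolding \<kappa>_def by (rule nn_integral_distr) measurable
    also have "\<dots> = (\<integral>\<^sup>+h. \<integral>\<^sup>+x. indicator N (act h x) \<partial>F \<partial>\<rho>)"
      by (subst P.nn_integral_snd[symmetric]) (auto simp: case_prod_beta)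
    also have "\<dots> = (\<integral>\<^sup>+h. 0 \<partial>\<rho>)"
    proof (intro nn_integral_cong)
      fix h
      have "AE x in M. x \<notin> N" using N by (rule AE_not_in)
      from AE_act[OF this, of h] have "AE x in F. indicator N (act h x) = (0::ennreal)"
        unfolding F_def by (subst AE_density) (auto elim!: eventually_mono)
      then show "(\<integral>\<^sup>+x. indicator N (act h x) \<partial>F) = 0"
        by (subst nn_integral_0_iff_AE) auto
    qed
    finally show "N \<in> null_sets \<kappa>" by (auto simp: null_sets_def \<kappa>_sets)
  qed
  define f' where "f' x = enn2real (RN_deriv M \<kappa> x)" for x
  have f'm[measurable]: "f' \<in> borel_measurable M" unfolding f'_def[abs_def] by measurable
  have f'0: "0 \<le> f' x" for x by (simp add: f'_def)
  have dens: "density M (\<lambda>x. ennreal (f' x)) = \<kappa>"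
  proof -
    have "AE x in M. RN_deriv M \<kappa> x \<noteq> \<infinity>"
      by (rule RN_deriv_finite[OF \<kappa>.sigma_finite_measure_axioms ac \<kappa>_sets])
    then have "AE x in M. ennreal (f' x) = RN_deriv M \<kappa> x"
      by eventually_elim (simp add: f'_def less_top)
    then have "density M (\<lambda>x. ennreal (f' x)) = density M (RN_deriv M \<kappa>)"
      by (intro density_cong) auto
    also have "\<dots> = \<kappa>" by (rule density_RN_deriv[OF ac \<kappa>_sets])
    finally show ?thesis .
  qed
  have nn: "(\<integral>\<^sup>+x. ennreal (f' x) \<partial>M) = 1"
    using \<kappa>.emeasure_space_1 unfolding dens[symmetric] by (simp add: emeasure_density cong: nn_integral_cong)
  have f'_int: "integrable M f'"
    using f'0 nn by (intro integrableI_nonneg) auto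
  have "(\<integral>x. f' x \<partial>M) = 1"
    using nn f'0 by (subst integral_eq_nn_integral) auto
  then have "f' \<in> densities" using f'0 f'_int by (simp add: densities_def)
  moreover have "smears_to \<rho> f f'"
    unfolding smears_to_def
  proof
    fix \<phi> assume \<phi>: "\<phi> \<in> bounded_meas"
    obtain C where C: "\<phi> \<in> borel_measurable M" "0 \<le> C" "\<forall>x\<in>space M. \<bar>\<phi> x\<bar> \<le> C" by (rule bounded_measE[OF \<phi>])
    note [measurable] = C(1)
    have int: "integrable (F \<Otimes>\<^sub>M \<rho>) (\<lambda>(x, h). \<phi> (act h x))"
    proof (rule P.P.integrable_const_bound[where B = C])
      show "AE p in F \<Otimes>\<^sub>M \<rho>. norm (case p of (x, h) \<Rightarrow> \<phi> (act h x)) \<le> C"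
      proof (rule AE_I2)
        fix p assume "p \<in> space (F \<Otimes>\<^sub>M \<rho>)"
        then have "fst p \<in> space M" by (auto simp: space_pair_measure F_def)
        then show "norm (case p of (x, h) \<Rightarrow> \<phi> (act h x)) \<le> C"
          using C(3) act_space by (auto simp: case_prod_beta)
      qed
      show "(\<lambda>(x, h). \<phi> (act h x)) \<in> borel_measurable (F \<Otimes>\<^sub>M \<rho>)"
        using measurable_compose[OF actm C(1)] by (simp add: case_prod_beta)
    qed
    have "(\<integral>x. \<phi> x * f' x \<partial>M) = (\<integral>x. f' x *\<^sub>R \<phi> x \<partial>M)" by (simp add: mult.commute)
    also have "\<dots> = (\<integral>x. \<phi> x \<partial>\<kappa>)" unfolding dens[symmetric] by (rule integral_density[symmetric]) (auto simp: f'0)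
    also have "\<dots> = (\<integral>p. \<phi> ((\<lambda>(x, h). act h x) p) \<partial>(F \<Otimes>\<^sub>M \<rho>))"
      unfolding \<kappa>_def by (rule integral_distr) measurable
    also have "\<dots> = (\<integral>x. (\<integral>h. \<phi> (act h x) \<partial>\<rho>) \<partial>F)"
      using P.integral_fst'[OF int] by (simp add: case_prod_unfold)
    also have "\<dots> = (\<integral>x. smear \<rho> \<phi> x \<partial>F)" by (simp add: smear_def[abs_def])
    also have "\<dots> = (\<integral>x. f x *\<^sub>R smear \<rho> \<phi> x \<partial>M)"
      unfolding F_def using densitiesD(1)[OF f] smear_measurable[OF \<rho> C(1)] by (intro integral_density) auto
    also have "\<dots> = (\<integral>x. smear \<rho> \<phi> x * f x \<partial>M)" by (simp add: mult.commute)
    finally show "(\<integral>x. \<phi> x * f' x \<partial>M) = (\<integral>x. smear \<rho> \<phi> x * f x \<partial>M)" .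
  qed
  ultimately show ?thesis by blast
qed

text \<open>
  The density of the image of \<open>f\<nu>\<close> under \<open>g\<close>.
\<close>

definition push :: "'g \<Rightarrow> ('x \<Rightarrow> real) \<Rightarrow> 'x \<Rightarrow> real" where
  "push g f x = jac g x * f (act (- g) x)"

lemma push_integrable: "integrable M f \<Longrightarrow> integrable M (push g f)"
  using integral_jac_translate(2)[of f g] by (simp add: push_def[abs_def])

lemma push_integral:
  assumes "\<phi> \<in> bounded_meas" "integrable M f"
  shows "(\<integral>x. \<phi> x * push g f x \<partial>M) = (\<integral>x. \<phi> (act g x) * f x \<partial>M)"
proof -
  note b = bounded_meas_mult_integrable[OF bounded_meas_translate[OF assms(1), of g] assms(2)]
  have "(\<integral>x. \<phi> x * push g f x \<partial>M) = (\<integral>x. jac g x *\<^sub>R (\<phi> (act g (act (- g) x)) * f (act (- g) x)) \<partial>M)"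
    by (intro Bochner_Integration.integral_cong) (auto simp: push_def act_minus)
  also have "\<dots> = (\<integral>x. \<phi> (act g x) * f x \<partial>M)"
    using integral_jac_translate(1)[OF borel_measurable_integrable[OF b], of g] by simp
  finally show ?thesis .
qed

text \<open>
  Test with a density concentrated on the set where \<open>w < \<epsilon>\<close>; it exists
  unless that set is null, because \<open>M\<close> is sigma-finite.
\<close>

lemma ge_AE_if_tested_by_densities:
  assumes w: "w \<in> bounded_meas" and le: "\<And>f. f \<in> densities \<Longrightarrow> \<epsilon> \<le> (\<integral>x. w x * f x \<partial>M)"
  shows "AE x in M. \<epsilon> \<le> w x"
proof -
  have wm[measurable]: "w \<in> borel_measurable M" using w by (auto simp: bounded_meas_def)
  obtain v :: "'x \<Rightarrow> real" where v[measurable]: "v \<in> borel_measurable M" and v0: "\<And>x. 0 < v x" and vi: "integrable M v"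
    using obtain_positive_integrable_function by metis
  define A where "A = {x\<in>space M. w x < \<epsilon>}"
  have A[measurable]: "A \<in> sets M" unfolding A_def by measurable
  define u where "u x = v x * indicator A x" for x
  have ui: "integrable M u" unfolding u_def[abs_def] using A vi by (rule integrable_real_mult_indicator)
  have u0: "0 \<le> u x" for x using v0[of x] by (simp add: u_def less_imp_le)
  define s where "s = (\<integral>x. u x \<partial>M)"
  have "s = 0"
  proof (rule ccontr)
    assume "s \<noteq> 0"
    moreover have "0 \<le> s" unfolding s_def using u0 by (intro integral_nonneg_AE) auto
    ultimately have s: "0 < s" by simp
    have "(\<lambda>x. u x / s) \<in> densities"
      using u0 ui s by (simp add: densities_def s_def)
    from le[OF this] have "\<epsilon> \<le> (\<integral>x. w x * u x \<partial>M) / s" by simp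
    then have "0 \<le> (\<integral>x. w x * u x \<partial>M) - \<epsilon> * s" using s by (simp add: field_simps)
    also have "\<dots> = (\<integral>x. w x * u x - \<epsilon> * u x \<partial>M)"
      unfolding s_def using ui bounded_meas_mult_integrable[OF w ui] by simp
    finally have "(\<integral>x. (\<epsilon> - w x) * u x \<partial>M) \<le> 0"
      using ui bounded_meas_mult_integrable[OF w ui] by (simp add: left_diff_distrib)
    moreover have nn: "0 \<le> (\<epsilon> - w x) * u x" for x by (auto simp: u_def A_def indicator_def v0 less_imp_le)
    ultimately have "(\<integral>x. (\<epsilon> - w x) * u x \<partial>M) = 0" by (intro antisym integral_nonneg_AE) auto
    moreover have "integrable M (\<lambda>x. (\<epsilon> - w x) * u x)"
      using ui bounded_meas_mult_integrable[OF w ui] by (simp add: left_diff_distrib)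
    ultimately have "AE x in M. (\<epsilon> - w x) * u x = 0"
      using nn by (subst (asm) integral_nonneg_eq_0_iff_AE) auto
    then have "AE x in M. u x = 0"
      by eventually_elim (auto simp: u_def A_def indicator_def)
    then have "s = 0" unfolding s_def using integral_eq_zero_AE by blast
    then show False using s by simp
  qed
  then have "AE x in M. u x = 0"
    unfolding s_def using ui u0 by (subst (asm) integral_nonneg_eq_0_iff_AE) auto
  then show ?thesis
    using AE_space
  proof eventually_elim
    case (elim x)
    then have "x \<notin> A" using v0[of x] by (auto simp: u_def)
    then show ?case using elim by (simp add: A_def not_less)
  qed
qed

text \<open>
  Without densities \<open>M\<close> would be zero, and then 1 and 0 would agree almost
  everywhere and have the same mean.
\<close>

lemma densities_nonempty:
  assumes "invariant_mean \<mu>"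
  shows "densities \<noteq> {}"
proof
  assume e: "densities = {}"
  have "AE x in M. 1 \<le> (0::real)" by (rule ge_AE_if_tested_by_densities[OF bounded_meas_const]) (use e in auto)
  then have "\<mu> (\<lambda>x. 1) \<le> \<mu> (\<lambda>x. 0)" by (intro mean_mono[OF assms] bounded_meas_const)
  then show False by (simp add: mean_const[OF assms])
qed

lemma mean_ge_const:
  assumes "invariant_mean \<mu>" "w \<in> bounded_meas" "AE x in M. \<epsilon> \<le> w x"
  shows "\<epsilon> \<le> \<mu> w"
  using mean_mono[OF assms(1) bounded_meas_const assms(2,3)] by (simp add: mean_const[OF assms(1)])

text \<open>
  If no averaged density is good enough, then the families \<open>(push g f' -
  f')\<^sub>g\<close>, which form a convex set, all have norm at least
  \<open>\<epsilon>\<close>. A separating functional consists of bounded functions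
  \<open>\<phi>\<^sub>g\<close>. Moving the action and the averaging from the densities to the
  test functions, it says that \<open>w = \<Sum>g. smear \<rho> (\<phi>\<^sub>g \<circ> g) -
  smear \<rho> \<phi>\<^sub>g\<close> has integral at least \<open>\<epsilon>\<close> against
  every density \<open>f\<close>. So \<open>w \<ge> \<epsilon>\<close> almost everywhere,
  although its mean is 0 by \<open>mean_smear_translate\<close>.
\<close>

theorem almost_invariant_density:
  fixes \<rho> :: "'g measure" and J :: "'g set"
  assumes lc: "locally_compact_space (euclidean :: 'g topology)"
    and \<mu>: "invariant_mean \<mu>" and \<rho>: "left_continuous_prob \<rho>" and J: "finite J" and \<epsilon>: "0 < \<epsilon>"
  shows "\<exists>f\<in>densities. \<exists>f'\<in>densities. smears_to \<rho> f f' \<and> (\<forall>g\<in>J. (\<integral>x. \<bar>push g f' x - f' x\<bar> \<partial>M) < \<epsilon>)"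
proof (rule ccontr)
  assume neg: "\<not> ?thesis"
  note \<rho>p = left_continuous_probD(1,2)[OF \<rho>]
  define V where "V = {v :: 'g \<Rightarrow> 'x \<Rightarrow> real. \<forall>g\<in>J. integrable M (v g)}"
  define N where "N v = (\<Sum>g\<in>J. \<integral>x. \<bar>v g x\<bar> \<partial>M)" for v :: "'g \<Rightarrow> 'x \<Rightarrow> real"
  define C where "C = {(\<lambda>g x. push g f' x - f' x) | f f'. f \<in> densities \<and> f' \<in> densities \<and> smears_to \<rho> f f'}"
  have V: "subspace V"
    by (rule subspaceI) (auto simp: V_def scaleR_fun_def plus_fun_def zero_fun_def)
  have CV: "C \<subseteq> V"
  proof
    fix v assume "v \<in> C"
    then obtain f' where f': "f' \<in> densities" and v: "v = (\<lambda>g x. push g f' x - f' x)" by (auto simp: C_def)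
    show "v \<in> V" unfolding v V_def using push_integrable[OF densitiesD(2)[OF f']] densitiesD(2)[OF f'] by simp
  qed
  have Cne: "C \<noteq> {}"
  proof -
    obtain f where f: "f \<in> densities" using densities_nonempty[OF \<mu>] by blast
    obtain f' where "f' \<in> densities" "smears_to \<rho> f f'" using smears_to_exists[OF \<rho>p f] by blast
    with f show ?thesis by (auto simp: C_def)
  qed
  have conv: "convex C"
  proof (rule convexI)
    fix x y :: "'g \<Rightarrow> 'x \<Rightarrow> real" and a b :: real
    assume xy: "x \<in> C" "y \<in> C" and ab: "0 \<le> a" "0 \<le> b" "a + b = 1"
    obtain f f' where f: "f \<in> densities" "f' \<in> densities" "smears_to \<rho> f f'" and x: "x = (\<lambda>g x. push g f' x - f' x)"
      using xy(1) by (auto simp: C_def)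
    obtain h h' where h: "h \<in> densities" "h' \<in> densities" "smears_to \<rho> h h'" and y: "y = (\<lambda>g x. push g h' x - h' x)"
      using xy(2) by (auto simp: C_def)
    have dens: "(\<lambda>x. a * p x + b * q x) \<in> densities" if "p \<in> densities" "q \<in> densities" for p q
      using that ab by (simp add: densities_def)
    have "smears_to \<rho> (\<lambda>x. a * f x + b * h x) (\<lambda>x. a * f' x + b * h' x)"
      unfolding smears_to_def
    proof
      fix \<phi> assume \<phi>: "\<phi> \<in> bounded_meas"
      note i = bounded_meas_mult_integrable[OF \<phi> densitiesD(2)] bounded_meas_mult_integrable[OF smear_bounded_meas[OF \<rho>p \<phi>] densitiesD(2)]
      have "(\<integral>x. \<phi> x * (a * f' x + b * h' x) \<partial>M) = (\<integral>x. a * (\<phi> x * f' x) + b * (\<phi> x * h' x) \<partial>M)"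
        by (simp add: algebra_simps)
      also have "\<dots> = a * (\<integral>x. \<phi> x * f' x \<partial>M) + b * (\<integral>x. \<phi> x * h' x \<partial>M)"
        using i(1)[OF f(2)] i(1)[OF h(2)] by simp
      also have "\<dots> = a * (\<integral>x. smear \<rho> \<phi> x * f x \<partial>M) + b * (\<integral>x. smear \<rho> \<phi> x * h x \<partial>M)"
        using f(3) h(3) \<phi> by (simp add: smears_to_def)
      also have "\<dots> = (\<integral>x. a * (smear \<rho> \<phi> x * f x) + b * (smear \<rho> \<phi> x * h x) \<partial>M)"
        using i(2)[OF f(1)] i(2)[OF h(1)] by simp
      also have "\<dots> = (\<integral>x. smear \<rho> \<phi> x * (a * f x + b * h x) \<partial>M)" by (simp add: algebra_simps)
      finally show "(\<integral>x. \<phi> x * (a * f' x + b * h' x) \<partial>M) = (\<integral>x. smear \<rho> \<phi> x * (a * f x + b * h x) \<partial>M)" .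
    qed
    moreover have "a *\<^sub>R x + b *\<^sub>R y = (\<lambda>g z. push g (\<lambda>x. a * f' x + b * h' x) z - (a * f' z + b * h' z))"
      by (auto simp: x y scaleR_fun_def plus_fun_def push_def fun_eq_iff algebra_simps)
    ultimately show "a *\<^sub>R x + b *\<^sub>R y \<in> C"
      unfolding C_def using dens[OF f(1) h(1)] dens[OF f(2) h(2)] by blast
  qed
  have NC: "\<epsilon> \<le> N c" if cC: "c \<in> C" for c
  proof -
    obtain f f' where f: "f \<in> densities" "f' \<in> densities" "smears_to \<rho> f f'" and c: "c = (\<lambda>g x. push g f' x - f' x)"
      using cC by (auto simp: C_def)
    then obtain g where g: "g \<in> J" "\<epsilon> \<le> (\<integral>x. \<bar>push g f' x - f' x\<bar> \<partial>M)"
      using neg by (force simp: not_less)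
    note g(2)
    also have "(\<integral>x. \<bar>push g f' x - f' x\<bar> \<partial>M) \<le> N c"
      unfolding N_def c using g J by (intro member_le_sum) auto
    finally show ?thesis .
  qed
  have N_add: "N (u + v) \<le> N u + N v" if "u \<in> V" "v \<in> V" for u v
    unfolding N_def sum.distrib[symmetric] plus_fun_def
  proof (rule sum_mono)
    fix g assume g: "g \<in> J"
    have i: "integrable M (u g)" "integrable M (v g)" using that g by (auto simp: V_def)
    have "(\<integral>x. \<bar>u g x + v g x\<bar> \<partial>M) \<le> (\<integral>x. \<bar>u g x\<bar> + \<bar>v g x\<bar> \<partial>M)"
      using i by (intro integral_mono) auto
    then show "(\<integral>x. \<bar>u g x + v g x\<bar> \<partial>M) \<le> (\<integral>x. \<bar>u g x\<bar> \<partial>M) + (\<integral>x. \<bar>v g x\<bar> \<partial>M)"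
      using i by simp
  qed
  have N_scale: "N (c *\<^sub>R v) = \<bar>c\<bar> * N v" if "v \<in> V" for c v
    by (simp add: N_def scaleR_fun_def abs_mult sum_distrib_left)
  obtain \<Lambda> where L_add: "\<And>u v. u \<in> V \<Longrightarrow> v \<in> V \<Longrightarrow> \<Lambda> (u + v) = \<Lambda> u + \<Lambda> v"
    and L_scale: "\<And>c v. v \<in> V \<Longrightarrow> \<Lambda> (c *\<^sub>R v) = c * \<Lambda> v" and L_bound: "\<And>v. v \<in> V \<Longrightarrow> \<bar>\<Lambda> v\<bar> \<le> N v"
    and L_C: "\<And>c. c \<in> C \<Longrightarrow> \<epsilon> \<le> \<Lambda> c"
  proof (rule convex_separation[where N = N and e = \<epsilon> and C = C and V = V])
  qed (rule V conv Cne CV NC N_add N_scale that; assumption?)+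
  \<comment> \<open>The inclusions of the summands of the direct sum of copies of
  \<open>L\<^sup>1\<close>; along each of them the functional is given by a bounded
  function.\<close>
  define emb where "emb g f = (\<lambda>g' x. if g' = g then f x else 0)" for g :: 'g and f :: "'x \<Rightarrow> real"
  have "integrable M (emb g f g')" if "integrable M f" for g g' f
    using that by (cases "g' = g") (simp_all add: emb_def)
  then have emb_V: "emb g f \<in> V" if "integrable M f" for g f
    using that by (simp add: V_def)
  have emb_add: "emb g (\<lambda>x. p x + q x) = emb g p + emb g q" for g p q
    by (auto simp: emb_def plus_fun_def fun_eq_iff)
  have emb_scale: "emb g (\<lambda>x. c * p x) = c *\<^sub>R emb g p" for g p c
    by (auto simp: emb_def scaleR_fun_def fun_eq_iff)
  have emb_N: "N (emb g f) = (\<integral>x. \<bar>f x\<bar> \<partial>M)" if "g \<in> J" for g f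
  proof -
    have "N (emb g f) = (\<Sum>g'\<in>J. if g' = g then (\<integral>x. \<bar>f x\<bar> \<partial>M) else 0)"
      unfolding N_def by (intro sum.cong) (auto simp: emb_def)
    then show ?thesis using that J by simp
  qed
  have "\<exists>\<phi>. \<phi> \<in> borel_measurable M \<and> (\<forall>x. \<bar>\<phi> x\<bar> \<le> 1) \<and> (\<forall>f. integrable M f \<longrightarrow> \<Lambda> (emb g f) = (\<integral>x. \<phi> x * f x \<partial>M))"
    if g: "g \<in> J" for g
  proof -
    have 1: "\<Lambda> (emb g (\<lambda>x. p x + q x)) = \<Lambda> (emb g p) + \<Lambda> (emb g q)" if "integrable M p" "integrable M q" for p q
      unfolding emb_add using that by (intro L_add emb_V)
    have 2: "\<Lambda> (emb g (\<lambda>x. c * p x)) = c * \<Lambda> (emb g p)" if "integrable M p" for c p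
      unfolding emb_scale using that by (intro L_scale emb_V)
    have 3: "\<bar>\<Lambda> (emb g p)\<bar> \<le> (\<integral>x. \<bar>p x\<bar> \<partial>M)" if "integrable M p" for p
      using L_bound[OF emb_V[OF that, of g]] emb_N[OF g] by simp
    obtain \<phi> where "\<phi> \<in> borel_measurable M" "\<And>x. \<bar>\<phi> x\<bar> \<le> 1" "\<And>f. integrable M f \<Longrightarrow> \<Lambda> (emb g f) = (\<integral>x. \<phi> x * f x \<partial>M)"
      using L1_dual[OF sf, of "\<lambda>f. \<Lambda> (emb g f)", OF 1 2 3] by blast
    then show ?thesis by blast
  qed
  then obtain \<phi> where \<phi>: "\<And>g. g \<in> J \<Longrightarrow> \<phi> g \<in> borel_measurable M" "\<And>g. g \<in> J \<Longrightarrow> \<forall>x. \<bar>\<phi> g x\<bar> \<le> 1"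
    "\<And>g f. g \<in> J \<Longrightarrow> integrable M f \<Longrightarrow> \<Lambda> (emb g f) = (\<integral>x. \<phi> g x * f x \<partial>M)"
    by metis
  have \<phi>b: "\<phi> g \<in> bounded_meas" if "g \<in> J" for g
    by (rule bounded_measI[OF \<phi>(1)[OF that]]) (use \<phi>(2)[OF that] in auto)
  have L_sum: "\<Lambda> v = (\<Sum>g\<in>J. \<integral>x. \<phi> g x * v g x \<partial>M)" if v: "v \<in> V" for v
  proof -
    have vi: "integrable M (v g)" if "g \<in> J" for g using v that by (auto simp: V_def)
    have sum_V: "(\<Sum>g\<in>F. emb g (v g)) \<in> V" if "F \<subseteq> J" for F
      using that vi emb_V V by (intro subspace_sum) auto
    have "\<Lambda> (\<Sum>g\<in>F. emb g (v g)) = (\<Sum>g\<in>F. \<Lambda> (emb g (v g)))" if "finite F" "F \<subseteq> J" for F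
      using that
    proof (induction F rule: finite_induct)
      case empty
      have "\<Lambda> (0 *\<^sub>R 0) = 0 * \<Lambda> 0" by (rule L_scale[OF subspace_0[OF V]])
      then have "\<Lambda> 0 = 0" by simp
      then show ?case unfolding sum.empty .
    next
      case (insert g F)
      have "\<Lambda> (emb g (v g) + (\<Sum>g\<in>F. emb g (v g))) = \<Lambda> (emb g (v g)) + \<Lambda> (\<Sum>g\<in>F. emb g (v g))"
        using insert.prems vi by (intro L_add emb_V sum_V) auto
      moreover have "\<Lambda> (\<Sum>g\<in>F. emb g (v g)) = (\<Sum>g\<in>F. \<Lambda> (emb g (v g)))"
        using insert.prems by (intro insert.IH) simp
      ultimately show ?case by (simp only: sum.insert[OF insert.hyps(1,2)])
    qed
    from this[OF J order_refl] have s: "\<Lambda> (\<Sum>g\<in>J. emb g (v g)) = (\<Sum>g\<in>J. \<integral>x. \<phi> g x * v g x \<partial>M)"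
      using vi by (simp add: \<phi>(3))
    \<comment> \<open>\<open>V\<close> contains families that differ outside
    \<open>J\<close>. Such a difference has norm 0 and is not seen by the
    functional.\<close>
    define d where "d = v + (-1) *\<^sub>R (\<Sum>g\<in>J. emb g (v g))"
    have scV: "(-1) *\<^sub>R (\<Sum>g\<in>J. emb g (v g)) \<in> V" by (rule subspace_scale[OF V sum_V[OF order_refl]])
    have dV: "d \<in> V" unfolding d_def by (rule subspace_add[OF V v scV])
    have "(\<Sum>g\<in>F. emb g (v g)) g' x = (\<Sum>g\<in>F. emb g (v g) g' x)" for F g' x
      by (induction F rule: infinite_finite_induct) (auto simp: plus_fun_def zero_fun_def)
    then have "d g x = 0" if "g \<in> J" for g x
      using that J by (simp add: d_def plus_fun_def scaleR_fun_def emb_def)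
    then have "N d = 0" by (simp add: N_def)
    then have "\<Lambda> d = 0" using L_bound[OF dV] by simp
    moreover have "\<Lambda> d = \<Lambda> v - \<Lambda> (\<Sum>g\<in>J. emb g (v g))"
      unfolding d_def using L_add[OF v scV] L_scale[OF sum_V[OF order_refl], of "-1"] by simp
    ultimately show ?thesis using s by simp
  qed
  define w where "w x = (\<Sum>g\<in>J. smear \<rho> (\<lambda>x. \<phi> g (act g x)) x - smear \<rho> (\<phi> g) x)" for x
  have terms: "(\<lambda>x. smear \<rho> (\<lambda>x. \<phi> g (act g x)) x - smear \<rho> (\<phi> g) x) \<in> bounded_meas" if "g \<in> J" for g
    using that by (intro bounded_meas_diff smear_bounded_meas[OF \<rho>p] bounded_meas_translate \<phi>b)
  have wb: "w \<in> bounded_meas"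
    unfolding w_def[abs_def] by (rule bounded_meas_sum) (rule terms)
  have "\<epsilon> \<le> (\<integral>x. w x * f x \<partial>M)" if f: "f \<in> densities" for f
  proof -
    obtain f' where f': "f' \<in> densities" "smears_to \<rho> f f'" using smears_to_exists[OF \<rho>p f] by blast
    let ?c = "\<lambda>g x. push g f' x - f' x"
    have c: "?c \<in> C" using f f' by (auto simp: C_def)
    have fi: "integrable M f" and f'i: "integrable M f'" using densitiesD(2) f f' by auto
    have "\<epsilon> \<le> \<Lambda> ?c" by (rule L_C[OF c])
    also have "\<dots> = (\<Sum>g\<in>J. \<integral>x. \<phi> g x * (push g f' x - f' x) \<partial>M)"
      using L_sum c CV by blast
    also have "\<dots> = (\<Sum>g\<in>J. \<integral>x. (smear \<rho> (\<lambda>x. \<phi> g (act g x)) x - smear \<rho> (\<phi> g) x) * f x \<partial>M)"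
    proof (rule sum.cong[OF refl])
      fix g assume g: "g \<in> J"
      have "(\<integral>x. \<phi> g x * (push g f' x - f' x) \<partial>M) = (\<integral>x. \<phi> g x * push g f' x \<partial>M) - (\<integral>x. \<phi> g x * f' x \<partial>M)"
        using bounded_meas_mult_integrable[OF \<phi>b[OF g] push_integrable[OF f'i, of g]] bounded_meas_mult_integrable[OF \<phi>b[OF g] f'i]
        by (simp add: right_diff_distrib)
      also have "\<dots> = (\<integral>x. \<phi> g (act g x) * f' x \<partial>M) - (\<integral>x. \<phi> g x * f' x \<partial>M)"
        by (simp add: push_integral[OF \<phi>b[OF g] f'i])
      also have "\<dots> = (\<integral>x. smear \<rho> (\<lambda>x. \<phi> g (act g x)) x * f x \<partial>M) - (\<integral>x. smear \<rho> (\<phi> g) x * f x \<partial>M)"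
        using f'(2) bounded_meas_translate[OF \<phi>b[OF g], of g] \<phi>b[OF g] by (simp add: smears_to_def)
      also have "\<dots> = (\<integral>x. (smear \<rho> (\<lambda>x. \<phi> g (act g x)) x - smear \<rho> (\<phi> g) x) * f x \<partial>M)"
        using bounded_meas_mult_integrable[OF smear_bounded_meas[OF \<rho>p bounded_meas_translate[OF \<phi>b[OF g]]] fi, of g]
          bounded_meas_mult_integrable[OF smear_bounded_meas[OF \<rho>p \<phi>b[OF g]] fi]
        by (simp add: left_diff_distrib)
      finally show "(\<integral>x. \<phi> g x * (push g f' x - f' x) \<partial>M)
          = (\<integral>x. (smear \<rho> (\<lambda>x. \<phi> g (act g x)) x - smear \<rho> (\<phi> g) x) * f x \<partial>M)" .
    qed
    also have "\<dots> = (\<integral>x. w x * f x \<partial>M)"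
      unfolding w_def sum_distrib_right
      by (rule Bochner_Integration.integral_sum[symmetric]) (intro bounded_meas_mult_integrable terms fi)
    finally show ?thesis .
  qed
  then have "\<epsilon> \<le> \<mu> w"
    by (intro mean_ge_const[OF \<mu> wb] ge_AE_if_tested_by_densities[OF wb])
  also have "\<mu> w = 0"
  proof -
    have "\<mu> w = (\<Sum>g\<in>J. \<mu> (\<lambda>x. smear \<rho> (\<lambda>x. \<phi> g (act g x)) x - smear \<rho> (\<phi> g) x))"
      unfolding w_def[abs_def] by (rule mean_sum[OF \<mu>]) (rule terms)
    also have "\<dots> = (\<Sum>g\<in>J. 0)"
    proof (rule sum.cong[OF refl])
      fix g assume g: "g \<in> J"
      show "\<mu> (\<lambda>x. smear \<rho> (\<lambda>x. \<phi> g (act g x)) x - smear \<rho> (\<phi> g) x) = 0"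
        using mean_diff[OF \<mu> smear_bounded_meas[OF \<rho>p bounded_meas_translate[OF \<phi>b[OF g]]] smear_bounded_meas[OF \<rho>p \<phi>b[OF g]], of g]
          mean_smear_translate[OF lc \<mu> \<rho> \<phi>(1)[OF g] \<phi>(2)[OF g], of g] by simp
    qed
    finally show ?thesis by simp
  qed
  finally show False using \<epsilon> by simp
qed

text \<open>
  The \<open>L\<^sup>1\<close> distance is attained by testing with the sign
  \<open>\<phi>\<close> of the difference. Moved to the test function, the difference between
  \<open>g + u\<close> and \<open>g\<close> becomes a translation of \<open>\<rho>\<close> by
  \<open>u\<close> along every orbit.
\<close>

lemma push_close:
  fixes \<rho> :: "'g measure"
  assumes \<rho>p: "prob_space \<rho>" "sets \<rho> = sets borel" and f: "f \<in> densities" and f': "f' \<in> densities" "smears_to \<rho> f f'"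
    and u: "shift_close \<rho> \<eta> u"
  shows "(\<integral>x. \<bar>push (g + u) f' x - push g f' x\<bar> \<partial>M) \<le> \<eta>"
proof -
  have fi: "integrable M f" and f'i: "integrable M f'" using densitiesD(2) f f' by auto
  have pi[measurable]: "push a f' \<in> borel_measurable M" for a
    by (rule borel_measurable_integrable[OF push_integrable[OF f'i]])
  define \<phi> where "\<phi> x = sgn (push (g + u) f' x - push g f' x)" for x
  have \<phi>m[measurable]: "\<phi> \<in> borel_measurable M" unfolding \<phi>_def[abs_def] by measurable
  have \<phi>1: "\<forall>x. \<bar>\<phi> x\<bar> \<le> 1" by (auto simp: \<phi>_def sgn_real_def)
  have \<phi>b: "\<phi> \<in> bounded_meas" by (rule bounded_measI[OF \<phi>m]) (use \<phi>1 in auto)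
  have sb: "smear \<rho> (\<lambda>x. \<phi> (act a x)) \<in> bounded_meas" for a
    by (intro smear_bounded_meas[OF \<rho>p] bounded_meas_translate \<phi>b)
  have pt: "smear \<rho> (\<lambda>x. \<phi> (act (g + u) x)) x - smear \<rho> (\<lambda>x. \<phi> (act g x)) x \<le> \<eta>" if x: "x \<in> space M" for x
  proof -
    have "(\<lambda>h. \<phi> (act g (act h x))) \<in> borel_measurable borel"
      by (rule orbit_measurable[OF _ x]) measurable
    then have "\<bar>(\<integral>h. \<phi> (act g (act (u + h) x)) \<partial>\<rho>) - (\<integral>h. \<phi> (act g (act h x)) \<partial>\<rho>)\<bar> \<le> \<eta>"
      using \<phi>1 by (intro shift_closeD[OF u, of "\<lambda>h. \<phi> (act g (act h x))"]) auto
    moreover have "act (g + u) (act h x) = act g (act (u + h) x)" for h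
      using act_add[OF act_space[OF x]] act_add[OF x] by simp
    ultimately show ?thesis by (simp add: smear_def)
  qed
  have "(\<integral>x. \<bar>push (g + u) f' x - push g f' x\<bar> \<partial>M) = (\<integral>x. \<phi> x * push (g + u) f' x - \<phi> x * push g f' x \<partial>M)"
    by (intro Bochner_Integration.integral_cong)
       (auto simp: \<phi>_def sgn_real_def right_diff_distrib[symmetric])
  also have "\<dots> = (\<integral>x. \<phi> x * push (g + u) f' x \<partial>M) - (\<integral>x. \<phi> x * push g f' x \<partial>M)"
    by (intro Bochner_Integration.integral_diff bounded_meas_mult_integrable \<phi>b push_integrable f'i)
  also have "\<dots> = (\<integral>x. \<phi> (act (g + u) x) * f' x \<partial>M) - (\<integral>x. \<phi> (act g x) * f' x \<partial>M)"
    by (simp only: push_integral[OF \<phi>b f'i])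
  also have "\<dots> = (\<integral>x. smear \<rho> (\<lambda>x. \<phi> (act (g + u) x)) x * f x \<partial>M) - (\<integral>x. smear \<rho> (\<lambda>x. \<phi> (act g x)) x * f x \<partial>M)"
    using f'(2) bounded_meas_translate[OF \<phi>b] by (simp add: smears_to_def)
  also have "\<dots> = (\<integral>x. smear \<rho> (\<lambda>x. \<phi> (act (g + u) x)) x * f x - smear \<rho> (\<lambda>x. \<phi> (act g x)) x * f x \<partial>M)"
    by (intro Bochner_Integration.integral_diff[symmetric] bounded_meas_mult_integrable sb fi)
  also have "\<dots> \<le> (\<integral>x. \<eta> * f x \<partial>M)"
  proof (rule integral_mono)
    show "integrable M (\<lambda>x. smear \<rho> (\<lambda>x. \<phi> (act (g + u) x)) x * f x - smear \<rho> (\<lambda>x. \<phi> (act g x)) x * f x)"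
      by (intro Bochner_Integration.integrable_diff bounded_meas_mult_integrable sb fi)
    show "integrable M (\<lambda>x. \<eta> * f x)" using fi by simp
    fix x assume x: "x \<in> space M"
    show "smear \<rho> (\<lambda>x. \<phi> (act (g + u) x)) x * f x - smear \<rho> (\<lambda>x. \<phi> (act g x)) x * f x \<le> \<eta> * f x"
      using mult_right_mono[OF pt[OF x] densitiesD(1)[OF f]] by (simp add: left_diff_distrib)
  qed
  also have "\<dots> = \<eta>" using densitiesD(3)[OF f] by simp
  finally show ?thesis .
qed

text \<open>
  A finite set \<open>J\<close> such that the translates \<open>g + U\<close> with
  \<open>g\<close> in \<open>J\<close> cover the compact set reduces the problem to
  \<open>almost_invariant_density\<close>, the difference being controlled by
  \<open>push_close\<close>. The vector is the square root of the density, since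
  \<open>(\<surd>a - \<surd>b)\<^sup>2 \<le> \<bar>a - b\<bar>\<close> bounds the square of
  the \<open>L\<^sup>2\<close> distance by the \<open>L\<^sup>1\<close> distance.
\<close>

theorem almost_invariant_if_co_amenable:
  assumes lc: "locally_compact_space (euclidean :: 'g topology)" and co: "co_amenable M act"
  shows "almost_has_invariant_vectors (L2 M) (lambda_rep M act)"
  unfolding almost_has_invariant_vectors_def
proof (intro allI impI, elim conjE)
  fix K :: "'g set" and \<epsilon> :: real assume K: "compact K" and \<epsilon>: "0 < \<epsilon>"
  obtain \<mu> where \<mu>: "invariant_mean \<mu>" using invariant_mean_exists[OF co] by blast
  \<comment> \<open>Half of the allowed square distance is spent on the passage to
  \<open>J\<close>, half on \<open>J\<close> itself.\<close>
  define \<eta> where "\<eta> = \<epsilon>\<^sup>2 / 2"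
  have \<eta>: "0 < \<eta>" using \<epsilon> by (simp add: \<eta>_def)
  obtain \<rho> :: "'g measure" where \<rho>: "left_continuous_prob \<rho>"
    by (rule ex_left_continuous_prob[OF lc open_UNIV UNIV_I])
  note \<rho>p = left_continuous_probD(1,2)[OF \<rho>]
  obtain U where U: "open U" "0 \<in> U" "\<forall>u\<in>U. shift_close \<rho> \<eta> u"
    by (rule left_continuous_prob_nbhd[OF \<rho> \<eta>])
  have opn: "open ((\<lambda>k. - g + k) -` U)" for g by (rule open_vimage[OF U(1)]) (intro continuous_intros)
  have cover: "K \<subseteq> (\<Union>g\<in>K. (\<lambda>k. - g + k) -` U)" using U(2) by auto
  obtain J where J: "J \<subseteq> K" "finite J" "K \<subseteq> (\<Union>g\<in>J. (\<lambda>k. - g + k) -` U)"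
    by (rule compactE_image[OF K opn cover])
  obtain f f' where f: "f \<in> densities" "f' \<in> densities" "smears_to \<rho> f f'"
    and close: "\<forall>g\<in>J. (\<integral>x. \<bar>push g f' x - f' x\<bar> \<partial>M) < \<eta>"
    using almost_invariant_density[OF lc \<mu> \<rho> J(2) \<eta>] by blast
  have f'i: "integrable M f'" by (rule densitiesD(2)[OF f(2)])
  note [measurable] = densitiesD(4)[OF f(2)] borel_measurable_integrable[OF push_integrable[OF f'i]]
  have near: "(\<integral>x. \<bar>push k f' x - f' x\<bar> \<partial>M) < \<epsilon>\<^sup>2" if k: "k \<in> K" for k
  proof -
    obtain g where g: "g \<in> J" "- g + k \<in> U" using J(3) k by auto
    have "(\<integral>x. \<bar>push (g + (- g + k)) f' x - push g f' x\<bar> \<partial>M) \<le> \<eta>"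
      by (rule push_close[OF \<rho>p f]) (rule U(3)[THEN bspec, OF g(2)])
    then have 1: "(\<integral>x. \<bar>push k f' x - push g f' x\<bar> \<partial>M) \<le> \<eta>" by (simp add: add.assoc[symmetric])
    have "(\<integral>x. \<bar>push k f' x - f' x\<bar> \<partial>M) \<le> (\<integral>x. \<bar>push k f' x - push g f' x\<bar> + \<bar>push g f' x - f' x\<bar> \<partial>M)"
      using push_integrable[OF f'i] f'i by (intro integral_mono) auto
    also have "\<dots> = (\<integral>x. \<bar>push k f' x - push g f' x\<bar> \<partial>M) + (\<integral>x. \<bar>push g f' x - f' x\<bar> \<partial>M)"
      using push_integrable[OF f'i] f'i by (intro Bochner_Integration.integral_add) auto
    also have "\<dots> < \<eta> + \<eta>" using 1 bspec[OF close g(1)] by (rule add_le_less_mono)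
    finally show ?thesis by (simp add: \<eta>_def)
  qed
  define z where "z x = complex_of_real (sqrt (f' x))" for x
  have nz: "(norm (z x))\<^sup>2 = f' x" for x using densitiesD(1)[OF f(2)] by (simp add: z_def)
  have z: "z \<in> sq_int M"
    unfolding sq_int_def using f'i by (simp add: nz) (simp add: z_def[abs_def])
  have z1: "sqn M z = 1" using densitiesD(3)[OF f(2)] by (simp add: sqn_def nz)
  have sqrt_diff: "(sqrt a - sqrt b)\<^sup>2 \<le> \<bar>a - b\<bar>" if "0 \<le> a" "0 \<le> b" for a b :: real
  proof -
    have "\<bar>sqrt a - sqrt b\<bar> * \<bar>sqrt a - sqrt b\<bar> \<le> \<bar>sqrt a - sqrt b\<bar> * \<bar>sqrt a + sqrt b\<bar>"
      using that by (intro mult_left_mono) (auto simp: abs_le_iff)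
    also have "\<dots> = \<bar>(sqrt a - sqrt b) * (sqrt a + sqrt b)\<bar>" by (simp only: abs_mult)
    also have "(sqrt a - sqrt b) * (sqrt a + sqrt b) = a - b" using that by (simp add: algebra_simps)
    finally show ?thesis by (simp add: power2_eq_square abs_mult[symmetric])
  qed
  show "\<exists>\<xi>\<in>vectors (L2 M). vnorm (L2 M) \<xi> = 1 \<and> (\<forall>g\<in>K. vnorm (L2 M) (vdiff (L2 M) (lambda_rep M act g \<xi>) \<xi>) < \<epsilon>)"
  proof (intro bexI conjI ballI)
    show "ae_class M z \<in> vectors (L2 M)" by (rule ae_class_in_L2[OF z])
    show "vnorm (L2 M) (ae_class M z) = 1" by (simp add: vnorm_L2 sqn_rep[OF z] z1)
    fix g assume g: "g \<in> K"
    have d: "(\<lambda>x. Lam g z x - z x) \<in> sq_int M" by (intro sq_int_diff Lam_sq_int z)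
    have "vnorm (L2 M) (vdiff (L2 M) (lambda_rep M act g (ae_class M z)) (ae_class M z)) = sqrt (sqn M (\<lambda>x. Lam g z x - z x))"
      unfolding lambda_rep_class[OF z] vdiff_L2[OF Lam_sq_int[OF z] z] by (simp add: vnorm_L2 sqn_rep[OF d])
    moreover have "sqn M (\<lambda>x. Lam g z x - z x) \<le> (\<integral>x. \<bar>push g f' x - f' x\<bar> \<partial>M)"
      unfolding sqn_def
    proof (rule integral_mono[OF sq_intD(2)[OF d]])
      show "integrable M (\<lambda>x. \<bar>push g f' x - f' x\<bar>)" using push_integrable[OF f'i] f'i by auto
      fix x
      have "Lam g z x - z x = complex_of_real (sqrt (push g f' x) - sqrt (f' x))"
        by (simp add: Lam_def z_def push_def real_sqrt_mult)
      then have "(norm (Lam g z x - z x))\<^sup>2 = (sqrt (push g f' x) - sqrt (f' x))\<^sup>2"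
        by (simp only: norm_of_real power2_abs)
      also have "\<dots> \<le> \<bar>push g f' x - f' x\<bar>"
        using densitiesD(1)[OF f(2)] jac_nonneg by (intro sqrt_diff) (auto simp: push_def)
      finally show "(norm (Lam g z x - z x))\<^sup>2 \<le> \<bar>push g f' x - f' x\<bar>" .
    qed
    ultimately show "vnorm (L2 M) (vdiff (L2 M) (lambda_rep M act g (ae_class M z)) (ae_class M z)) < \<epsilon>"
      using near[OF g] \<epsilon> by (simp add: real_less_lsqrt)
  qed
qed

end

theorem proposition8:
  fixes M :: "'x measure"
    and act :: "'g::{topological_group_add, second_countable_topology, t2_space} \<Rightarrow> 'x \<Rightarrow> 'x"
  assumes "locally_compact_space (euclidean :: 'g topology)"
    and "sigma_finite_measure M"
    and "measurable_action M act"
    and "quasi_invariant M act"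
  shows "(co_amenable M act \<longleftrightarrow>
            almost_has_invariant_vectors (L2 M) (lambda_rep M act)) \<and>
         (almost_has_invariant_vectors (L2 M) (lambda_rep M act) \<longleftrightarrow>
            almost_has_invariant_vectors (HS (L2 M)) (tensor_conj (L2 M) (lambda_rep M act)))"
proof -
  interpret quasi_invariant_action M act by (rule quasi_invariant_action.intro[OF assms(2-4)])
  show ?thesis
    using almost_invariant_if_co_amenable[OF assms(1)] almost_invariant_tensor co_amenable_if_tensor by blast
qed

end
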